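(* For any $\alpha>0$, any Bravais lattice $\Lambda\subset\mathbb R^d$ of density one and any vector $u\in\mathbb R^d$, we have $$\theta_{\Lambda+u}(\alpha)\le\theta_\Lambda(\alpha),$$ with equality if and only if $u\in\Lambda$. In particular, if $d=2$ and $A_2$ is the triangular lattice of length $1$, then for any Bravais lattice $\Lambda\subset\mathbb R^2$ such that $|\Lambda|=|A_2|$, any $\alpha>0$ and any $u\in\mathbb R^2$, $$\theta_{A_2+u}(\alpha)\le\theta_\Lambda(\alpha),$$ with equality if and only if $u\in A_2$ and $\Lambda=A_2$ up to rotation.
   Context: A Bravais lattice in $\mathbb R^d$ is the $\mathbb Z$-span of a basis of $\mathbb R^d$; $|\Lambda|$ denotes the volume of a fundamental domain (the inverse of the density, i.e. of the average number of points per unit volume). For a lattice $\Lambda$, $u\in\mathbb R^d$ and $\alpha>0$, $$\theta_{\Lambda+u}(\alpha)=\sum_{p\in\Lambda}e^{-\pi\alpha|p+u|^2},\qquad \theta_\Lambda(\alpha)=\sum_{p\in\Lambda}e^{-\pi\alpha|p|^2}.$$ $A_2=\mathbb Z(1,0)\oplus\mathbb Z(1/2,\sqrt3/2)\subset\mathbb R^2$. *)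

theory Defs
  imports "HOL-Analysis.Analysis"
begin

definition int_span :: "'a::real_vector set \<Rightarrow> 'a set" where
  "int_span B = {\<Sum>b\<in>B. real_of_int (c b) *\<^sub>R b | c. True}"

definition bravais_lattice :: "'a::euclidean_space set \<Rightarrow> bool" where
  "bravais_lattice L \<longleftrightarrow> (\<exists>B. independent B \<and> span B = UNIV \<and> L = int_span B)"

text \<open>A fundamental domain is a measurable set whose translates by the lattice points cover
  the space and are pairwise disjoint.\<close>

definition fundamental_domain :: "'a::euclidean_space set \<Rightarrow> 'a set \<Rightarrow> bool" where
  "fundamental_domain L F \<longleftrightarrow> F \<in> sets lebesgue \<and> (\<forall>x. \<exists>!p. p \<in> L \<and> x - p \<in> F)"

text \<open>All fundamental domains of a Bravais lattice have the same finite, positive volume, so the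
  definite description below is well defined for such lattices.\<close>

definition lattice_volume :: "'a::euclidean_space set \<Rightarrow> real" where
  "lattice_volume L = (THE v. \<exists>F. fundamental_domain L F \<and> v = measure lebesgue F)"

definition lattice_density :: "'a::euclidean_space set \<Rightarrow> real" where
  "lattice_density L = 1 / lattice_volume L"

text \<open>For a Bravais lattice and a positive parameter, the two families below are absolutely
  summable, so the infinite sums have their usual meaning.\<close>

definition theta_translate :: "'a::euclidean_space set \<Rightarrow> 'a \<Rightarrow> real \<Rightarrow> real" where
  "theta_translate L u \<alpha> = (\<Sum>\<^sub>\<infinity>p\<in>L. exp (- pi * \<alpha> * (norm (p + u))\<^sup>2))"

definition theta :: "'a::euclidean_space set \<Rightarrow> real \<Rightarrow> real" where
  "theta L \<alpha> = (\<Sum>\<^sub>\<infinity>p\<in>L. exp (- pi * \<alpha> * (norm p)\<^sup>2))"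

definition A2 :: "(real^2) set" where
  "A2 = {real_of_int m *\<^sub>R vector [1, 0] + real_of_int n *\<^sub>R vector [1/2, sqrt 3 / 2] | m n. True}"

text \<open>Rotations are proper: orthogonal with determinant 1.\<close>

definition equal_up_to_rotation :: "(real^'n) set \<Rightarrow> (real^'n) set \<Rightarrow> bool" where
  "equal_up_to_rotation L M \<longleftrightarrow> (\<exists>Q::real^'n^'n. rotation_matrix Q \<and> L = (*v) Q ` M)"

end

theory Submission
  imports Defs "HOL-Probability.Probability"
begin

text \<open>
  Both inequalities are proved with real Gaussian sums. The first one rests on the parallelogram law, the
  second one on the Poisson formula on the line and an inequality between exponentials.

  \<^bold>\<open>Translates.\<close> Write \<open>f\<^sub>\<alpha>(u)\<close> for the translated theta function of \<open>L\<close>. The substitution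
  \<open>(p, q) \<mapsto> (p + q, p - q)\<close> in the double sum \<open>f\<^sub>\<alpha>(u) f\<^sub>\<alpha>(v)\<close> gives
  \<open>f\<^sub>\<alpha>(u) f\<^sub>\<alpha>(v) = \<Sum>c. f\<^sub>2\<^sub>\<alpha>((u + v + c)/2) f\<^sub>2\<^sub>\<alpha>((u - v + c)/2)\<close>, with \<open>c\<close> running over \<open>L/2L\<close>. Hence
  \<open>f\<^sub>\<alpha>(0) (f\<^sub>\<alpha>(2u) + f\<^sub>\<alpha>(0)) - 2 f\<^sub>\<alpha>(u)\<^sup>2\<close> is the sum of the squares
  \<open>(f\<^sub>2\<^sub>\<alpha>(u + c/2) - f\<^sub>2\<^sub>\<alpha>(c/2))\<^sup>2\<close>, so it is nonnegative. If \<open>M\<close> is the supremum of \<open>f\<^sub>\<alpha>\<close>, this gives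
  \<open>2 M\<^sup>2 \<le> f\<^sub>\<alpha>(0) (M + f\<^sub>\<alpha>(0))\<close> and therefore \<open>M \<le> f\<^sub>\<alpha>(0)\<close>. If \<open>f\<^sub>\<alpha>(u) = f\<^sub>\<alpha>(0)\<close>, all squares vanish, so
  \<open>f\<^sub>2\<^sub>\<alpha>(u) = f\<^sub>2\<^sub>\<alpha>(0) \<ge> 1\<close>. Iterating \<open>\<alpha> \<mapsto> 2\<alpha>\<close> forces \<open>u \<in> L\<close>, because otherwise every term of
  \<open>f\<^sub>\<alpha>(u)\<close> is less than 1 and \<open>f\<^sub>\<beta>(u)\<close> tends to 0 along \<open>\<beta> = 2\<^sup>k \<alpha>\<close>.
  The lemmas are \<open>has_sum_theta_product\<close>, \<open>theta_translate_square_defect\<close>, \<open>theta_translate_le\<close> and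
  \<open>theta_translate_eq_iff\<close>.

  \<^bold>\<open>Minimality of the triangular lattice.\<close> A plane lattice has a reduced basis, in which its norm form is
  \<open>D (A m\<^sup>2 + B n\<^sup>2 + C (m - n)\<^sup>2)\<close> with \<open>A, B, C \<ge> 0\<close> and \<open>AB + BC + CA = 1\<close>, where \<open>D\<close> is the
  area of a cell. The triangular lattice is \<open>A = B = C = 1 / sqrt 3\<close>, and the theta function is
  invariant under permutations of \<open>(A, B, C)\<close>. The functional equation under \<open>\<alpha> \<mapsto> 1/\<alpha>\<close> allows the
  assumption \<open>\<alpha> \<ge> 1\<close>. Two cases remain.

  If \<open>A + B + C\<close> is not far above its minimum \<open>sqrt 3\<close>, the terms are grouped into triples by the cyclic
  permutations of \<open>(m\<^sup>2, n\<^sup>2, (m - n)\<^sup>2)\<close>, and each triple already dominates the corresponding triple of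
  the triangular lattice (\<open>orbit_sum_gt\<close>). The three exponents deviate from their mean
  like \<open>w cos(\<psi> + 2\<pi>i/3)\<close>, and a sum of three such exponentials is at least \<open>exp(-w) + 2 exp(w/2)\<close>
  (\<open>sum_three_exp_ge\<close>). This gain is of second order in \<open>w\<close> and it beats the increase of the mean
  (\<open>exp_trade_off\<close>).

  Otherwise the lattice has a nonzero vector so short that this vector and its negative contribute more
  than all nonzero vectors of the triangular lattice together (\<open>hex_theta_less_cusp\<close>).
\<close>

section \<open>Summability of Gaussians over lattices\<close>

lemma summable_on_int_exp_abs:
  fixes c :: real assumes "c > 0"
  shows "(\<lambda>n::int. exp (- c * \<bar>real_of_int n\<bar>)) summable_on UNIV"
proof -
  have "summable (\<lambda>n::nat. exp (- c) ^ n)" using assms by (intro summable_geometric) auto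
  then have "(\<lambda>n::nat. exp (- c) ^ n) summable_on UNIV"
    by (intro summable_nonneg_imp_summable_on) auto
  then have *: "(\<lambda>n::nat. exp (- c * real n)) summable_on UNIV"
    by (simp add: exp_of_nat_mult[symmetric] mult.commute)
  have "(\<lambda>n::int. exp (- c * \<bar>real_of_int n\<bar>)) summable_on (range int \<union> (range (\<lambda>n. - int n)))"
  proof (rule summable_on_union)
    show "(\<lambda>n::int. exp (- c * \<bar>real_of_int n\<bar>)) summable_on range int"
      by (subst summable_on_reindex) (use * in \<open>auto simp: o_def\<close>)
    show "(\<lambda>n::int. exp (- c * \<bar>real_of_int n\<bar>)) summable_on range (\<lambda>n. - int n)"
      by (subst summable_on_reindex) (use * in \<open>auto simp: o_def inj_def\<close>)
  qed
  moreover have "range int \<union> (range (\<lambda>n. - int n)) = UNIV"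
    by (auto, metis int_cases2 rangeI)
  ultimately show ?thesis by simp
qed

lemma summable_on_int_gaussian:
  fixes a x :: real assumes "a > 0"
  shows "(\<lambda>n::int. exp (- a * (real_of_int n + x)\<^sup>2)) summable_on UNIV"
proof (rule summable_on_comparison_test)
  show "(\<lambda>n::int. exp (a * (\<bar>x\<bar> + 1)\<^sup>2) * exp (- a * \<bar>real_of_int n\<bar>)) summable_on UNIV"
    by (rule summable_on_cmult_right[OF summable_on_int_exp_abs[OF assms]])
  fix n :: int
  have "\<bar>real_of_int n\<bar> \<le> \<bar>n + x\<bar> + \<bar>x\<bar>" by linarith
  also have "\<dots> \<le> (n + x)\<^sup>2 + (\<bar>x\<bar> + 1)\<^sup>2"
  proof -
    have *: "\<bar>y\<bar> \<le> y\<^sup>2 + 1 / 4" for y :: real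
    proof -
      have "0 \<le> (\<bar>y\<bar> - 1 / 2)\<^sup>2" by (rule zero_le_power2)
      also have "\<dots> = y\<^sup>2 - \<bar>y\<bar> + 1 / 4" by (simp add: power2_diff power_divide)
      finally show ?thesis by linarith
    qed
    have "(\<bar>x\<bar> + 1)\<^sup>2 = x\<^sup>2 + 2 * \<bar>x\<bar> + 1" by (simp add: power2_sum)
    then show ?thesis using *[of "n + x"] zero_le_power2[of x] abs_ge_zero[of x] by linarith
  qed
  finally have "a * \<bar>real_of_int n\<bar> \<le> a * ((n + x)\<^sup>2 + (\<bar>x\<bar> + 1)\<^sup>2)"
    using assms by (intro mult_left_mono) auto
  then show "exp (- a * (n + x)\<^sup>2) \<le> exp (a * (\<bar>x\<bar> + 1)\<^sup>2) * exp (- a * \<bar>real_of_int n\<bar>)"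
    unfolding exp_add[symmetric] exp_le_cancel_iff distrib_left mult_minus_left by linarith
qed (rule exp_ge_zero)

text \<open>
  By Tonelli, one factor at a time.
\<close>

lemma summable_on_prod_PiE:
  fixes f :: "'a \<Rightarrow> 'b \<Rightarrow> real"
  assumes "finite A" and "\<And>a. a \<in> A \<Longrightarrow> f a summable_on B" and "\<And>a b. 0 \<le> f a b"
  shows "(\<lambda>g. \<Prod>a\<in>A. f a (g a)) summable_on (PiE A (\<lambda>_. B))"
  using assms(1,2)
proof (induction A rule: finite_induct)
  case empty
  then show ?case by simp
next
  case (insert x A)
  have pos: "0 \<le> (\<Prod>a\<in>A. f a (g a))" for g by (intro prod_nonneg) (use assms in auto)
  have "(\<lambda>(y, g). f x y * (\<Prod>a\<in>A. f a (g a))) summable_on B \<times> PiE A (\<lambda>_. B)"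
    by (rule summable_on_SigmaI[where g = "\<lambda>y. f x y * (\<Sum>\<^sub>\<infinity>g\<in>PiE A (\<lambda>_. B). \<Prod>a\<in>A. f a (g a))"])
      (use insert assms pos in \<open>auto intro!: has_sum_cmult_right summable_on_cmult_left\<close>)
  then have "((\<lambda>h. \<Prod>a\<in>insert x A. f a (h a)) \<circ> (\<lambda>(y, g). g(x := y))) summable_on B \<times> PiE A (\<lambda>_. B)"
  proof (rule summable_on_cong[THEN iffD1, rotated], clarsimp)
    fix y g assume "y \<in> B" "g \<in> PiE A (\<lambda>_. B)"
    show "f x y * (\<Prod>a\<in>A. f a (g a)) = (\<Prod>a\<in>insert x A. f a (if a = x then y else g a))"
      using insert by (subst prod.insert) (auto intro!: prod.cong)
  qed
  then show ?case
    using insert inj_combinator[of x A "\<lambda>_. B"]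
    by (subst (asm) summable_on_reindex[symmetric]) (auto simp: PiE_insert_eq)
qed

lemma int_span_eq_image:
  assumes "finite B"
  shows "int_span B = (\<lambda>c. \<Sum>b\<in>B. real_of_int (c b) *\<^sub>R b) ` PiE B (\<lambda>_. UNIV)"
proof -
  have "(\<Sum>b\<in>B. real_of_int (c b) *\<^sub>R b) \<in> (\<lambda>c. \<Sum>b\<in>B. real_of_int (c b) *\<^sub>R b) ` PiE B (\<lambda>_. UNIV)" for c
    by (rule image_eqI[of _ _ "restrict c B"]) (auto intro!: sum.cong)
  then show ?thesis unfolding int_span_def by auto
qed

text \<open>
  The coordinates with respect to a basis are bounded linear functionals, so the Gaussian on the
  lattice is dominated by a product of one-dimensional Gaussians in the coordinates.
\<close>

lemma summable_on_lattice_gaussian: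
  fixes L :: "'a::euclidean_space set"
  assumes "bravais_lattice L" "\<alpha> > 0"
  shows "(\<lambda>p. exp (- pi * \<alpha> * (norm (p + u))\<^sup>2)) summable_on L"
proof -
  obtain B where B: "independent B" "span B = UNIV" "L = int_span B"
    using assms unfolding bravais_lattice_def by blast
  have fin: "finite B" using B(1) by (rule finiteI_independent)
  define e where "e = (\<lambda>c::'a \<Rightarrow> int. \<Sum>b\<in>B. real_of_int (c b) *\<^sub>R b)"
  have rep: "representation B (e c) b = c b" if "b \<in> B" for c b
  proof -
    have "representation B (e c) b = (\<Sum>i\<in>B. real_of_int (c i) * (if b = i then 1 else 0))"
      unfolding e_def using B fin
      by (simp add: real_vector.representation_sum real_vector.representation_scale real_vector.span_base
          real_vector.representation_basis real_vector.span_scale)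
    also have "\<dots> = (\<Sum>i\<in>B. if b = i then real_of_int (c i) else 0)"
      by (intro sum.cong) auto
    finally show ?thesis using that fin by simp
  qed
  have inj: "inj_on e (PiE B (\<lambda>_. UNIV))"
  proof (rule inj_onI)
    fix c d :: "'a \<Rightarrow> int" assume "c \<in> PiE B (\<lambda>_. UNIV)" "d \<in> PiE B (\<lambda>_. UNIV)" "e c = e d"
    have "real_of_int (c b) = real_of_int (d b)" if "b \<in> B" for b
      using rep[OF that, of c] rep[OF that, of d] \<open>e c = e d\<close> by simp
    then show "c = d" using \<open>c \<in> _\<close> \<open>d \<in> _\<close> by (intro PiE_ext) auto
  qed
  have lin: "linear (\<lambda>x. representation B x b)" for b
    using B by (intro linearI) (simp_all add: real_vector.representation_add real_vector.representation_scale)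
  have "\<exists>K>0. \<forall>x. \<bar>representation B x b\<bar> \<le> K * norm x" for b
    using linear_bounded_pos[OF lin[of b]] by (auto simp: mult.commute)
  then obtain K where K: "\<And>b. K b > 0" "\<And>b x. \<bar>representation B x b\<bar> \<le> K b * norm x" by metis
  \<comment> \<open>The summand 1 keeps the denominator positive for the empty basis.\<close>
  define a where "a = pi * \<alpha> / (1 + (\<Sum>b\<in>B. (K b)\<^sup>2))"
  have S: "0 < 1 + (\<Sum>b\<in>B. (K b)\<^sup>2)" by (intro add_pos_nonneg sum_nonneg) auto
  have a: "a > 0" unfolding a_def using assms S by simp
  have bound: "a * (\<Sum>b\<in>B. (representation B x b)\<^sup>2) \<le> pi * \<alpha> * (norm x)\<^sup>2" for x
  proof -
    have "(\<Sum>b\<in>B. (representation B x b)\<^sup>2) \<le> (\<Sum>b\<in>B. (K b)\<^sup>2 * (norm x)\<^sup>2)"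
    proof (rule sum_mono)
      fix b
      have "\<bar>representation B x b\<bar>\<^sup>2 \<le> (K b * norm x)\<^sup>2" by (rule power_mono[OF K(2)]) simp
      then show "(representation B x b)\<^sup>2 \<le> (K b)\<^sup>2 * (norm x)\<^sup>2" by (simp add: power_mult_distrib)
    qed
    also have "\<dots> \<le> (1 + (\<Sum>b\<in>B. (K b)\<^sup>2)) * (norm x)\<^sup>2"
      by (simp add: sum_distrib_right distrib_right)
    finally have "a * (\<Sum>b\<in>B. (representation B x b)\<^sup>2) \<le> a * ((1 + (\<Sum>b\<in>B. (K b)\<^sup>2)) * (norm x)\<^sup>2)"
      using a by (intro mult_left_mono) auto
    also have "\<dots> = pi * \<alpha> * (norm x)\<^sup>2" using S by (simp add: a_def)
    finally show ?thesis .
  qed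
  have "(\<lambda>c. \<Prod>b\<in>B. exp (- a * (real_of_int (c b) + representation B u b)\<^sup>2)) summable_on PiE B (\<lambda>_. UNIV)"
    by (rule summable_on_prod_PiE[where f = "\<lambda>b n. exp (- a * (real_of_int n + representation B u b)\<^sup>2)"])
      (use fin a in \<open>auto intro!: summable_on_int_gaussian[of a, simplified]\<close>)
  then have "((\<lambda>p. exp (- pi * \<alpha> * (norm (p + u))\<^sup>2)) \<circ> e) summable_on PiE B (\<lambda>_. UNIV)"
  proof (rule summable_on_comparison_test)
    fix c assume "c \<in> PiE B (\<lambda>_. UNIV :: int set)"
    have "((\<lambda>p. exp (- pi * \<alpha> * (norm (p + u))\<^sup>2)) \<circ> e) c \<le> exp (- (a * (\<Sum>b\<in>B. (representation B (e c + u) b)\<^sup>2)))"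
      using bound[of "e c + u"] by simp
    also have "\<dots> = exp (\<Sum>b\<in>B. - a * (real_of_int (c b) + representation B u b)\<^sup>2)"
      using B rep by (simp add: real_vector.representation_add sum_distrib_left sum_negf)
    also have "\<dots> = (\<Prod>b\<in>B. exp (- a * (real_of_int (c b) + representation B u b)\<^sup>2))"
      by (simp add: exp_sum fin)
    finally show "((\<lambda>p. exp (- pi * \<alpha> * (norm (p + u))\<^sup>2)) \<circ> e) c \<le> \<dots>" .
  qed auto
  then have "(\<lambda>p. exp (- pi * \<alpha> * (norm (p + u))\<^sup>2)) summable_on e ` PiE B (\<lambda>_. UNIV)"
    by (simp only: summable_on_reindex[OF inj])
  then show ?thesis
    unfolding B(3) int_span_eq_image[OF fin] e_def .
qed

section \<open>Translated theta functions\<close>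

lemma has_sum_product:
  fixes f :: "'a \<Rightarrow> real" and g :: "'b \<Rightarrow> real"
  assumes "(f has_sum s) A" "(g has_sum t) B" "\<And>x. x \<in> A \<Longrightarrow> 0 \<le> f x" "\<And>y. y \<in> B \<Longrightarrow> 0 \<le> g y"
  shows "((\<lambda>(x, y). f x * g y) has_sum (s * t)) (A \<times> B)"
proof (rule has_sum_SigmaI)
  show "((\<lambda>y. case (x, y) of (x, y) \<Rightarrow> f x * g y) has_sum f x * t) B" if "x \<in> A" for x
    using has_sum_cmult_right[OF assms(2), of "f x"] by simp
  show "((\<lambda>x. f x * t) has_sum s * t) A" by (rule has_sum_cmult_left[OF assms(1)])
  show "(\<lambda>(x, y). f x * g y) summable_on A \<times> B"
  proof (rule summable_on_SigmaI)
    show "((\<lambda>y. case (x, y) of (x, y) \<Rightarrow> f x * g y) has_sum f x * t) B" if "x \<in> A" for x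
      using has_sum_cmult_right[OF assms(2), of "f x"] by simp
    show "(\<lambda>x. f x * t) summable_on A"
      using has_sum_cmult_left[OF assms(1)] by (rule has_sum_imp_summable)
  qed (use assms in auto)
qed

lemma bravais_lattice_closed:
  assumes "bravais_lattice L"
  shows "0 \<in> L" and "p \<in> L \<Longrightarrow> q \<in> L \<Longrightarrow> p + q \<in> L" and "p \<in> L \<Longrightarrow> q \<in> L \<Longrightarrow> p - q \<in> L"
    and "p \<in> L \<Longrightarrow> - p \<in> L"
proof -
  obtain B where L: "L = {\<Sum>b\<in>B. real_of_int (c b) *\<^sub>R b | c. True}"
    using assms unfolding bravais_lattice_def int_span_def by blast
  show 0: "0 \<in> L" unfolding L by (rule CollectI, rule exI[of _ "\<lambda>_. 0"]) simp
  show "p + q \<in> L" if "p \<in> L" "q \<in> L" for p q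
  proof -
    from that obtain c d where "p = (\<Sum>b\<in>B. real_of_int (c b) *\<^sub>R b)" "q = (\<Sum>b\<in>B. real_of_int (d b) *\<^sub>R b)"
      unfolding L by blast
    then have "p + q = (\<Sum>b\<in>B. real_of_int (c b + d b) *\<^sub>R b)"
      by (simp add: sum.distrib scaleR_left_distrib)
    then show ?thesis unfolding L by (intro CollectI exI[of _ "\<lambda>b. c b + d b"]) auto
  qed
  show *: "p - q \<in> L" if "p \<in> L" "q \<in> L" for p q
  proof -
    from that obtain c d where "p = (\<Sum>b\<in>B. real_of_int (c b) *\<^sub>R b)" "q = (\<Sum>b\<in>B. real_of_int (d b) *\<^sub>R b)"
      unfolding L by blast
    then have "p - q = (\<Sum>b\<in>B. real_of_int (c b - d b) *\<^sub>R b)"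
      by (simp add: sum_subtractf scaleR_left_diff_distrib)
    then show ?thesis unfolding L by (intro CollectI exI[of _ "\<lambda>b. c b - d b"]) auto
  qed
  show "- p \<in> L" if "p \<in> L" using *[OF 0 that] by simp
qed

lemma has_sum_theta_translate:
  assumes "bravais_lattice L" "\<alpha> > 0"
  shows "((\<lambda>p. exp (- pi * \<alpha> * (norm (p + u))\<^sup>2)) has_sum theta_translate L u \<alpha>) L"
  unfolding theta_translate_def by (rule has_sum_infsum[OF summable_on_lattice_gaussian[OF assms]])

lemma theta_eq_translate: "theta L \<alpha> = theta_translate L 0 \<alpha>"
  by (simp add: theta_def theta_translate_def)

lemma theta_translate_nonneg: "theta_translate L u \<alpha> \<ge> 0"
  unfolding theta_translate_def by (intro infsum_nonneg) simp

lemma theta_translate_add: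
  assumes "bravais_lattice L" "l \<in> L"
  shows "theta_translate L (u + l) \<alpha> = theta_translate L u \<alpha>"
  unfolding theta_translate_def
  by (rule infsum_reindex_bij_witness[of _ "\<lambda>p. p - l" "\<lambda>p. p + l"])
    (use bravais_lattice_closed[OF assms(1)] assms(2) in \<open>auto simp: algebra_simps\<close>)

text \<open>
  By periodicity it is enough to consider \<open>u\<close> in the parallelotope spanned by a basis. There
  \<open>\<bar>p\<bar>\<^sup>2 \<le> 2 \<bar>p + u\<bar>\<^sup>2 + 2 \<bar>u\<bar>\<^sup>2\<close> compares the sum with the untranslated one at \<open>\<alpha>/2\<close>.
\<close>

lemma theta_translate_bounded:
  fixes L :: "'a::euclidean_space set"
  assumes L: "bravais_lattice L" and \<alpha>: "\<alpha> > 0"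
  shows "\<exists>M. \<forall>u. theta_translate L u \<alpha> \<le> M"
proof -
  obtain B where B: "independent B" "span B = UNIV" "L = int_span B"
    using assms unfolding bravais_lattice_def by blast
  have fin: "finite B" using B(1) by (rule finiteI_independent)
  define R where "R = (\<Sum>b\<in>B. norm b)"
  define M where "M = exp (pi * \<alpha> * R\<^sup>2) * theta_translate L 0 (\<alpha> / 2)"
  have "theta_translate L u \<alpha> \<le> M" for u
  proof -
    define l where "l = (\<Sum>b\<in>B. real_of_int \<lfloor>representation B u b\<rfloor> *\<^sub>R b)"
    have l: "l \<in> L" unfolding B(3) int_span_def l_def
      by (intro CollectI exI[of _ "\<lambda>b. \<lfloor>representation B u b\<rfloor>"]) auto
    define v where "v = u - l"
    have "u = (\<Sum>b\<in>B. representation B u b *\<^sub>R b)"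
      using B fin by (intro real_vector.sum_representation_eq[symmetric]) auto
    then have "v = (\<Sum>b\<in>B. (representation B u b - real_of_int \<lfloor>representation B u b\<rfloor>) *\<^sub>R b)"
      unfolding v_def l_def by (simp add: scaleR_left_diff_distrib sum_subtractf)
    also have "norm \<dots> \<le> (\<Sum>b\<in>B. norm ((representation B u b - real_of_int \<lfloor>representation B u b\<rfloor>) *\<^sub>R b))"
      by (rule norm_sum)
    also have "\<dots> \<le> R" unfolding R_def
    proof (rule sum_mono)
      fix b
      have "\<bar>representation B u b - real_of_int \<lfloor>representation B u b\<rfloor>\<bar> \<le> 1" by linarith
      then show "norm ((representation B u b - real_of_int \<lfloor>representation B u b\<rfloor>) *\<^sub>R b) \<le> norm b"
        by (simp add: mult_left_le_one_le)
    qed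
    finally have v: "norm v \<le> R" .
    have "theta_translate L u \<alpha> = theta_translate L v \<alpha>"
      using theta_translate_add[OF L l, of v] by (simp add: v_def)
    also have "\<dots> \<le> M"
    proof (rule has_sum_mono[OF has_sum_theta_translate[OF L \<alpha>]])
      show "((\<lambda>p. exp (pi * \<alpha> * R\<^sup>2) * exp (- pi * (\<alpha> / 2) * (norm (p + 0))\<^sup>2)) has_sum M) L"
        unfolding M_def by (rule has_sum_cmult_right[OF has_sum_theta_translate[OF L]]) (use \<alpha> in simp)
      fix p
      have "norm p \<le> norm (p + v) + R" using norm_triangle_ineq4[of "p + v" v] v by simp
      then have "(norm p)\<^sup>2 \<le> (norm (p + v) + R)\<^sup>2" by (intro power_mono) auto
      also have "\<dots> \<le> 2 * (norm (p + v))\<^sup>2 + 2 * R\<^sup>2"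
        using sum_squares_bound[of "norm (p + v)" R] by (simp add: power2_sum)
      finally have "pi * \<alpha> * (norm p)\<^sup>2 \<le> pi * \<alpha> * (2 * (norm (p + v))\<^sup>2 + 2 * R\<^sup>2)"
        using \<alpha> by (intro mult_left_mono) auto
      then show "exp (- pi * \<alpha> * (norm (p + v))\<^sup>2) \<le> exp (pi * \<alpha> * R\<^sup>2) * exp (- pi * (\<alpha> / 2) * (norm (p + 0))\<^sup>2)"
        unfolding exp_add[symmetric] exp_le_cancel_iff by (simp add: distrib_left)
    qed
    finally show ?thesis .
  qed
  then show ?thesis by blast
qed

text \<open>
  A choice of representatives for the classes of \<open>L\<close> modulo \<open>2L\<close>: \<open>r\<close> is constant on each class and
  picks a member of it. The image \<open>r ` L\<close> serves as the index set \<open>L/2L\<close>.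
\<close>

definition mod_double_rep :: "'a::real_vector set \<Rightarrow> ('a \<Rightarrow> 'a) \<Rightarrow> bool" where
  "mod_double_rep L r \<longleftrightarrow> (\<forall>x\<in>L. r x \<in> L \<and> (\<exists>l\<in>L. x = r x + 2 *\<^sub>R l) \<and> (\<forall>l\<in>L. r (x + 2 *\<^sub>R l) = r x))"

lemma ex_mod_double_rep:
  fixes L :: "'a::euclidean_space set"
  assumes L: "bravais_lattice L"
  shows "\<exists>r. mod_double_rep L r"
proof -
  note cl = bravais_lattice_closed[OF L]
  define P where "P = (\<lambda>x c. c \<in> L \<and> (\<exists>l\<in>L. x = c + 2 *\<^sub>R l))"
  define r where "r = (\<lambda>x. SOME c. P x c)"
  have "P x (r x)" if "x \<in> L" for x
    unfolding r_def by (rule someI[of _ x]) (use that cl in \<open>auto simp: P_def intro!: bexI[of _ 0]\<close>)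
  moreover have "r (x + 2 *\<^sub>R l) = r x" if "x \<in> L" "l \<in> L" for x l
  proof -
    have "P (x + 2 *\<^sub>R l) c \<longleftrightarrow> P x c" for c
    proof
      assume "P (x + 2 *\<^sub>R l) c"
      then obtain k where "c \<in> L" "k \<in> L" "x + 2 *\<^sub>R l = c + 2 *\<^sub>R k" unfolding P_def by blast
      then have "x = c + 2 *\<^sub>R (k - l)" by (simp add: algebra_simps)
      then show "P x c" unfolding P_def using \<open>c \<in> L\<close> \<open>k \<in> L\<close> that cl by blast
    next
      assume "P x c"
      then obtain k where "c \<in> L" "k \<in> L" "x = c + 2 *\<^sub>R k" unfolding P_def by blast
      then have "x + 2 *\<^sub>R l = c + 2 *\<^sub>R (k + l)" by (simp add: algebra_simps)
      then show "P (x + 2 *\<^sub>R l) c" unfolding P_def using \<open>c \<in> L\<close> \<open>k \<in> L\<close> that cl by blast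
    qed
    then have "P (x + 2 *\<^sub>R l) = P x" by (intro ext)
    then show ?thesis unfolding r_def by simp
  qed
  ultimately show ?thesis unfolding P_def mod_double_rep_def by blast
qed

text \<open>
  The pairs \<open>(p, q)\<close> correspond to triples \<open>(c, l, k)\<close> by \<open>p + q = c + 2l\<close> and \<open>p - q = c + 2k\<close>,
  and the parallelogram law turns \<open>\<bar>p + u\<bar>\<^sup>2 + \<bar>q + v\<bar>\<^sup>2\<close> into twice the sum of the squared norms of
  \<open>l + (u + v + c)/2\<close> and \<open>k + (u - v + c)/2\<close>.
\<close>

lemma has_sum_theta_product:
  fixes L :: "'a::euclidean_space set"
  assumes L: "bravais_lattice L" and \<alpha>: "\<alpha> > 0"
    and r: "mod_double_rep L r"
  shows "((\<lambda>c. theta_translate L ((1/2) *\<^sub>R (u + v + c)) (2 * \<alpha>) * theta_translate L ((1/2) *\<^sub>R (u - v + c)) (2 * \<alpha>))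
    has_sum (theta_translate L u \<alpha> * theta_translate L v \<alpha>)) (r ` L)"
proof -
  note cl = bravais_lattice_closed[OF L]
  have r: "r x \<in> L" "\<exists>l\<in>L. x = r x + 2 *\<^sub>R l" "\<And>l. l \<in> L \<Longrightarrow> r (x + 2 *\<^sub>R l) = r x" if "x \<in> L" for x
    using r that unfolding mod_double_rep_def by blast+
  define e where "e = (\<lambda>\<beta> x. exp (- pi * \<beta> * (norm (x :: 'a))\<^sup>2))"
  have e: "((\<lambda>p. e \<beta> (p + w)) has_sum theta_translate L w \<beta>) L" if "\<beta> > 0" for \<beta> w
    unfolding e_def by (rule has_sum_theta_translate[OF L that])
  have e_nonneg: "0 \<le> e \<beta> x" for \<beta> x by (simp add: e_def)
  have "((\<lambda>(p, q). e \<alpha> (p + u) * e \<alpha> (q + v)) has_sum (theta_translate L u \<alpha> * theta_translate L v \<alpha>)) (L \<times> L)"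
    by (intro has_sum_product e \<alpha> e_nonneg)
  also have "?this \<longleftrightarrow> ((\<lambda>(c, l, k). e (2 * \<alpha>) (l + (1/2) *\<^sub>R (u + v + c)) * e (2 * \<alpha>) (k + (1/2) *\<^sub>R (u - v + c)))
      has_sum (theta_translate L u \<alpha> * theta_translate L v \<alpha>)) (Sigma (r ` L) (\<lambda>_. L \<times> L))"
  proof (rule has_sum_reindex_bij_witness[of _
        "\<lambda>(c, l, k). (c + l + k, l - k)"
        "\<lambda>(p, q). let c = r (p - q); k = (1/2) *\<^sub>R (p - q - c) in (c, q + k, k)"], goal_cases)
    case (1 a)
    obtain p q where a: "a = (p, q)" by force
    have "(1 / 2) *\<^sub>R x + (1 / 2) *\<^sub>R x = x" for x :: 'a by (simp flip: scaleR_left_distrib)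
    then show ?case unfolding a by (simp add: Let_def algebra_simps)
  next
    case (2 a)
    obtain p q where a: "a = (p, q)" "p \<in> L" "q \<in> L" using 2 by force
    obtain l where "l \<in> L" "p - q = r (p - q) + 2 *\<^sub>R l" using r(2)[OF cl(3)[OF a(2,3)]] by blast
    then have "p - q - r (p - q) = 2 *\<^sub>R l" by (metis add_diff_cancel_left')
    then have "(1/2) *\<^sub>R (p - q - r (p - q)) = l" by simp
    then show ?case using a cl \<open>l \<in> L\<close> by (auto simp: Let_def)
  next
    case (3 b)
    obtain x l k where b: "b = (r x, l, k)" "x \<in> L" "l \<in> L" "k \<in> L" using 3 by force
    have d: "r x + l + k - (l - k) = r x + 2 *\<^sub>R k" by (simp add: scaleR_2)
    have "r (r x + 2 *\<^sub>R k) = r (r x)" using r(1,3) b by blast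
    moreover have "r (r x) = r x" using r(2)[OF b(2)] r(1)[OF b(2)] r(3) by metis
    ultimately show ?case unfolding b(1) by (simp add: Let_def d)
  next
    case (4 b)
    then show ?case using r(1) cl by auto
  next
    case (5 a)
    obtain p q where a: "a = (p, q)" "p \<in> L" "q \<in> L" using 5 by force
    define c where "c = r (p - q)"
    define k where "k = (1/2) *\<^sub>R (p - q - c)"
    have 1: "q + k + (1/2) *\<^sub>R (u + v + c) = (1/2) *\<^sub>R ((p + u) + (q + v))"
      and 2: "k + (1/2) *\<^sub>R (u - v + c) = (1/2) *\<^sub>R ((p + u) - (q + v))"
    proof -
      have "q = (1/2) *\<^sub>R q + (1/2) *\<^sub>R q" by (simp flip: scaleR_left_distrib)
      then show "q + k + (1/2) *\<^sub>R (u + v + c) = (1/2) *\<^sub>R ((p + u) + (q + v))"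
        unfolding k_def by (smt (verit) add.assoc add.commute add_diff_cancel_left' diff_add_eq scaleR_right_distrib)
      show "k + (1/2) *\<^sub>R (u - v + c) = (1/2) *\<^sub>R ((p + u) - (q + v))"
        unfolding k_def by (simp add: algebra_simps)
    qed
    have "2 * (norm ((1/2) *\<^sub>R (x + y)))\<^sup>2 + 2 * (norm ((1/2) *\<^sub>R (x - y)))\<^sup>2 = (norm x)\<^sup>2 + (norm y)\<^sup>2" for x y :: 'a
      by (simp add: power2_norm_eq_inner algebra_simps inner_commute)
    from this[of "p + u" "q + v"]
    have "e (2 * \<alpha>) (q + k + (1/2) *\<^sub>R (u + v + c)) * e (2 * \<alpha>) (k + (1/2) *\<^sub>R (u - v + c)) = e \<alpha> (p + u) * e \<alpha> (q + v)"
      unfolding 1 2 e_def exp_add[symmetric] 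
      by (metis (no_types, opaque_lifting) distrib_left mult.assoc mult.left_commute)
    then show ?case unfolding a by (simp add: Let_def c_def k_def)
  qed (rule refl)
  finally have *: "((\<lambda>(c, l, k). e (2 * \<alpha>) (l + (1/2) *\<^sub>R (u + v + c)) * e (2 * \<alpha>) (k + (1/2) *\<^sub>R (u - v + c)))
      has_sum (theta_translate L u \<alpha> * theta_translate L v \<alpha>)) (Sigma (r ` L) (\<lambda>_. L \<times> L))" .
  show ?thesis
  proof (rule has_sum_SigmaD[OF *])
    fix c
    show "((\<lambda>y. case (c, y) of (c, l, k) \<Rightarrow> e (2 * \<alpha>) (l + (1/2) *\<^sub>R (u + v + c)) * e (2 * \<alpha>) (k + (1/2) *\<^sub>R (u - v + c)))
       has_sum theta_translate L ((1/2) *\<^sub>R (u + v + c)) (2 * \<alpha>) * theta_translate L ((1/2) *\<^sub>R (u - v + c)) (2 * \<alpha>)) (L \<times> L)"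
      using has_sum_product[OF e e e_nonneg e_nonneg, of "2 * \<alpha>" "2 * \<alpha>" "(1/2) *\<^sub>R (u + v + c)" "(1/2) *\<^sub>R (u - v + c)"] \<alpha>
      by simp
  qed
qed

text \<open>
  The product formula is used at \<open>(2u, 0)\<close>, \<open>(0, 0)\<close> and twice at \<open>(u, u)\<close>; the three sums have the
  terms \<open>x\<^sup>2\<close>, \<open>y\<^sup>2\<close> and \<open>x y\<close> for the same \<open>x\<close> and \<open>y\<close>.
\<close>

lemma theta_translate_square_defect:
  fixes L :: "'a::euclidean_space set"
  assumes L: "bravais_lattice L" and \<alpha>: "\<alpha> > 0"
    and r: "mod_double_rep L r"
  shows "((\<lambda>c. (theta_translate L (u + (1/2) *\<^sub>R c) (2 * \<alpha>) - theta_translate L ((1/2) *\<^sub>R c) (2 * \<alpha>))\<^sup>2)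
    has_sum (theta L \<alpha> * (theta_translate L (2 *\<^sub>R u) \<alpha> + theta L \<alpha>) - 2 * (theta_translate L u \<alpha>)\<^sup>2)) (r ` L)"
proof -
  define F where "F = (\<lambda>x. theta_translate L x (2 * \<alpha>))"
  have *: "((\<lambda>c. F ((1/2) *\<^sub>R (u + v + c)) * F ((1/2) *\<^sub>R (u - v + c))) has_sum
     (theta_translate L u \<alpha> * theta_translate L v \<alpha>)) (r ` L)" for u v
    unfolding F_def by (rule has_sum_theta_product[OF L \<alpha> r])
  have uu: "(1/2) *\<^sub>R (u + u + c) = u + (1/2) *\<^sub>R c" "(1/2) *\<^sub>R (u - u + c) = (1/2) *\<^sub>R c"
    "(1/2) *\<^sub>R (2 *\<^sub>R u + 0 + c) = u + (1/2) *\<^sub>R c" "(1/2) *\<^sub>R (2 *\<^sub>R u - 0 + c) = u + (1/2) *\<^sub>R c"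
    "(1/2) *\<^sub>R (0 + 0 + c) = (1/2) *\<^sub>R c" "(1/2) *\<^sub>R (0 - 0 + c) = (1/2) *\<^sub>R c" for c
    by (simp_all add: scaleR_right_distrib flip: scaleR_left_distrib)
  have e1: "x * x + y * y + - 2 * (x * y) = (x - y)\<^sup>2" for x y :: real
    by (simp add: power2_eq_square algebra_simps)
  have e2: "x * t + t * t + - 2 * (y * y) = t * (x + t) - 2 * y\<^sup>2" for x y t :: real
    by (simp add: power2_eq_square algebra_simps)
  show ?thesis
    using has_sum_add[OF has_sum_add[OF *[of "2 *\<^sub>R u" 0] *[of 0 0]] has_sum_cmult_right[OF *[of u u], of "- 2"]]
    unfolding uu e1 e2 unfolding F_def theta_eq_translate .
qed

text \<open>
  The defect formula bounds \<open>2 f(u)\<^sup>2\<close> by \<open>f(0) (M + f(0))\<close>, where \<open>M\<close> is the supremum of \<open>f\<close>;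
  taking the supremum over \<open>u\<close> gives \<open>(2M + f(0)) (M - f(0)) \<le> 0\<close>.
\<close>

theorem theta_translate_le:
  fixes L :: "'a::euclidean_space set"
  assumes L: "bravais_lattice L" and \<alpha>: "\<alpha> > 0"
  shows "theta_translate L u \<alpha> \<le> theta L \<alpha>"
proof -
  obtain r where r: "mod_double_rep L r"
    using ex_mod_double_rep[OF L] by blast
  define f where "f = (\<lambda>u. theta_translate L u \<alpha>)"
  define t where "t = theta L \<alpha>"
  have t0: "t \<ge> 0" by (simp add: t_def theta_eq_translate theta_translate_nonneg)
  have step: "2 * (f u)\<^sup>2 \<le> t * (f (2 *\<^sub>R u) + t)" for u
    using has_sum_nonneg[OF theta_translate_square_defect[OF L \<alpha> r, of u]] by (simp add: f_def t_def)
  have bdd: "bdd_above (range f)"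
    using theta_translate_bounded[OF L \<alpha>] unfolding f_def bdd_above_def by auto
  define M where "M = (SUP u. f u)"
  have fM: "f u \<le> M" for u unfolding M_def by (rule cSUP_upper[OF _ bdd]) simp
  have f0: "0 \<le> f u" for u by (simp add: f_def theta_translate_nonneg)
  have "f u \<le> sqrt (t * (M + t) / 2)" for u
  proof (rule real_le_rsqrt)
    have "t * (f (2 *\<^sub>R u) + t) \<le> t * (M + t)" using t0 fM by (intro mult_left_mono) auto
    then show "(f u)\<^sup>2 \<le> t * (M + t) / 2" using step[of u] by simp
  qed
  then have "M \<le> sqrt (t * (M + t) / 2)" unfolding M_def by (intro cSUP_least) auto
  moreover have M0: "0 \<le> M" using f0[of 0] fM[of 0] by linarith
  ultimately have "M\<^sup>2 \<le> t * (M + t) / 2"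
    by (metis power_mono real_sqrt_pow2_iff real_sqrt_ge_0_iff order_trans)
  then have "(2 * M + t) * (M - t) \<le> 0" by (simp add: power2_eq_square algebra_simps)
  then have "M \<le> t" using M0 t0
    by (smt (verit) mult_pos_pos)
  then show ?thesis using fM[of u] by (simp add: f_def t_def)
qed

text \<open>
  In the case of equality the defect is zero. Its term for the trivial class gives equality at
  the doubled parameter, and repeated doubling concentrates the sum on the zero vectors among \<open>p + u\<close>.
\<close>

theorem theta_translate_eq_iff:
  fixes L :: "'a::euclidean_space set"
  assumes L: "bravais_lattice L" and \<alpha>: "\<alpha> > 0"
  shows "theta_translate L u \<alpha> = theta L \<alpha> \<longleftrightarrow> u \<in> L"
proof
  assume "u \<in> L"
  then show "theta_translate L u \<alpha> = theta L \<alpha>"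
    using theta_translate_add[OF L, of u 0] by (simp add: theta_eq_translate)
next
  assume eq: "theta_translate L u \<alpha> = theta L \<alpha>"
  note cl = bravais_lattice_closed[OF L]
  obtain r where r: "mod_double_rep L r"
    using ex_mod_double_rep[OF L] by blast
  have double: "theta_translate L u (2 * \<beta>) = theta L (2 * \<beta>)"
    if \<beta>: "\<beta> > 0" and eq: "theta_translate L u \<beta> = theta L \<beta>" for \<beta>
  proof -
    have "theta L \<beta> * (theta_translate L (2 *\<^sub>R u) \<beta> + theta L \<beta>) \<le> theta L \<beta> * (theta L \<beta> + theta L \<beta>)"
      using theta_translate_le[OF L \<beta>] by (intro mult_left_mono) (auto simp: theta_eq_translate theta_translate_nonneg)
    then have le0: "theta L \<beta> * (theta_translate L (2 *\<^sub>R u) \<beta> + theta L \<beta>) - 2 * (theta_translate L u \<beta>)\<^sup>2 \<le> 0"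
      unfolding eq by (simp add: power2_eq_square)
    obtain l where l: "l \<in> L" "0 = r 0 + 2 *\<^sub>R l" using r cl(1) unfolding mod_double_rep_def by blast
    then have "r 0 = 2 *\<^sub>R (- l)" by (simp add: eq_neg_iff_add_eq_0)
    then have "(1/2) *\<^sub>R r 0 = - l" by simp
    moreover have "(theta_translate L (u + (1/2) *\<^sub>R r 0) (2 * \<beta>) - theta_translate L ((1/2) *\<^sub>R r 0) (2 * \<beta>))\<^sup>2 = 0"
      by (rule nonneg_has_sum_le_0D[OF theta_translate_square_defect[OF L \<beta> r, of u] le0]) (use cl in auto)
    ultimately have "theta_translate L (u + - l) (2 * \<beta>) = theta_translate L (0 + - l) (2 * \<beta>)" by simp
    then show ?thesis
      unfolding theta_translate_add[OF L cl(4)[OF l(1)]] theta_eq_translate .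
  qed
  have pow: "theta_translate L u (2 ^ k * \<alpha>) = theta L (2 ^ k * \<alpha>)" for k
  proof (induction k)
    case (Suc k)
    then show ?case using double[of "2 ^ k * \<alpha>"] \<alpha> by (simp add: mult.assoc)
  qed (use eq in simp)
  have ge1: "1 \<le> theta L \<beta>" if "\<beta> > 0" for \<beta>
  proof -
    have "(\<Sum>p\<in>{0::'a}. exp (- pi * \<beta> * (norm (p + 0))\<^sup>2)) \<le> theta_translate L 0 \<beta>"
      by (rule finite_sum_le_has_sum[OF has_sum_theta_translate[OF L that]]) (use cl in auto)
    then show ?thesis by (simp add: theta_eq_translate)
  qed
  show "u \<in> L"
  proof (rule ccontr)
    assume u: "u \<notin> L"
    define t where "t = (\<lambda>p. exp (- pi * \<alpha> * (norm (p + u))\<^sup>2))"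
    have t01: "0 < t p" "t p \<le> 1" for p using \<alpha> by (auto simp: t_def)
    have t1: "t p < 1" if "p \<in> L" for p
    proof -
      have "p + u \<noteq> 0" using u cl(4)[OF that] by (metis add_eq_0_iff)
      then show ?thesis using \<alpha> by (simp add: t_def)
    qed
    have tpow: "exp (- pi * (2 ^ k * \<alpha>) * (norm (p + u))\<^sup>2) = t p ^ (2 ^ k)" for p k
      by (simp add: t_def mult_ac flip: exp_of_nat_mult)
    have ts: "(t has_sum theta_translate L u \<alpha>) L"
      unfolding t_def by (rule has_sum_theta_translate[OF L \<alpha>])
    \<comment> \<open>Outside a finite set the terms add up to at most 1/2 for every exponent; on the finite set they tend to 0.\<close>
    then obtain F where F: "finite F" "F \<subseteq> L" "dist (sum t F) (theta_translate L u \<alpha>) \<le> 1 / 2"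
      using has_sum_finite_approximation[OF ts, of "1/2"] by auto
    have rest: "(t has_sum (theta_translate L u \<alpha> - sum t F)) (L - F)"
      using ts F by (intro has_sum_Diff) auto
    have bound: "1 \<le> (\<Sum>p\<in>F. t p ^ (2 ^ k)) + 1 / 2" for k
    proof -
      have s: "((\<lambda>p. t p ^ (2 ^ k)) has_sum theta_translate L u (2 ^ k * \<alpha>)) L"
        using has_sum_theta_translate[OF L, of "2 ^ k * \<alpha>" u] \<alpha> unfolding tpow by simp
      then have "((\<lambda>p. t p ^ (2 ^ k)) has_sum (theta_translate L u (2 ^ k * \<alpha>) - (\<Sum>p\<in>F. t p ^ (2 ^ k)))) (L - F)"
        using F by (intro has_sum_Diff) auto
      then have "theta_translate L u (2 ^ k * \<alpha>) - (\<Sum>p\<in>F. t p ^ (2 ^ k)) \<le> theta_translate L u \<alpha> - sum t F"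
        by (rule has_sum_mono[OF _ rest]) (use t01 in \<open>auto intro!: power_le_one_iff power_decreasing[of 1, simplified] simp: less_imp_le\<close>)
      also have "\<dots> \<le> 1 / 2" using F(3) unfolding dist_real_def by linarith
      finally show ?thesis using ge1[of "2 ^ k * \<alpha>"] \<alpha> unfolding pow by simp
    qed
    have "(\<lambda>k. (\<Sum>p\<in>F. t p ^ (2 ^ k)) + 1 / 2) \<longlonglongrightarrow> (\<Sum>p\<in>F. 0) + 1 / 2"
    proof (intro tendsto_intros)
      fix p assume "p \<in> F"
      have "(\<lambda>n. t p ^ n) \<longlonglongrightarrow> 0" using t1[of p] t01[of p] F \<open>p \<in> F\<close> by (intro LIMSEQ_power_zero) auto
      moreover have "strict_mono (\<lambda>k::nat. 2 ^ k :: nat)" by (simp add: strict_mono_def)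
      ultimately show "(\<lambda>k. t p ^ (2 ^ k)) \<longlonglongrightarrow> 0" using LIMSEQ_subseq_LIMSEQ by (fastforce simp: o_def)
    qed
    then have "1 \<le> (\<Sum>p\<in>F. 0) + (1 / 2 :: real)" using bound by (intro LIMSEQ_le_const) auto
    then show False by simp
  qed
qed

section \<open>Poisson summation for Gaussians on the line\<close>

lemma has_sum_int_imp_sums:
  fixes f :: "int \<Rightarrow> real"
  assumes "(f has_sum s) UNIV"
  shows "(\<lambda>k. f (int_decode k)) sums s" "summable (\<lambda>k. norm (f (int_decode k)))"
proof -
  have "((\<lambda>k. f (int_decode k)) has_sum s) UNIV"
    using has_sum_reindex_bij_betw[OF bij_int_decode, of f s] assms by simp
  then show "(\<lambda>k. f (int_decode k)) sums s" by (rule has_sum_imp_sums)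
  from \<open>((\<lambda>k. f (int_decode k)) has_sum s) UNIV\<close>
  have "(\<lambda>k. norm (f (int_decode k))) summable_on UNIV"
    unfolding summable_on_iff_abs_summable_on_real[symmetric] by (rule has_sum_imp_summable)
  then show "summable (\<lambda>k. norm (f (int_decode k)))" by (rule summable_on_imp_summable)
qed

lemma borel_measurable_has_sum_int:
  fixes f :: "int \<Rightarrow> 'a \<Rightarrow> real"
  assumes [measurable]: "\<And>n. f n \<in> borel_measurable M" and s: "\<And>x. ((\<lambda>n. f n x) has_sum F x) UNIV"
  shows "F \<in> borel_measurable M"
proof -
  have "F = (\<lambda>x. \<Sum>k. f (int_decode k) x)"
    using has_sum_int_imp_sums(1)[OF s] by (auto simp: sums_iff)
  then show ?thesis by simp
qed

text \<open>
  An enumeration of the integers reduces the exchange of sum and integral to series over the natural numbers.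
\<close>

lemma has_sum_integral_int:
  fixes f :: "int \<Rightarrow> 'a \<Rightarrow> real"
  assumes int: "\<And>n. integrable M (f n)"
    and bound: "\<And>n. (\<integral>x. \<bar>f n x\<bar> \<partial>M) \<le> b n" and b: "b summable_on UNIV"
    and s: "\<And>x. ((\<lambda>n. f n x) has_sum F x) UNIV"
  shows "integrable M F" and "((\<lambda>n. \<integral>x. f n x \<partial>M) has_sum (\<integral>x. F x \<partial>M)) UNIV"
proof -
  define g where "g = (\<lambda>k. f (int_decode k))"
  have F: "F = (\<lambda>x. \<Sum>k. g k x)"
    using has_sum_int_imp_sums(1)[OF s] by (auto simp: sums_iff g_def)
  have g: "integrable M (g k)" for k by (simp add: g_def int)
  have AE: "AE x in M. summable (\<lambda>k. norm (g k x))"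
    using has_sum_int_imp_sums(2)[OF s] by (simp add: g_def)
  obtain S where "(b has_sum S) UNIV" using b by (auto simp: summable_on_def)
  then have sb: "summable (\<lambda>k. norm (b (int_decode k)))" by (rule has_sum_int_imp_sums)
  have sg: "summable (\<lambda>k. (\<integral>x. norm (g k x) \<partial>M))"
  proof (rule summable_comparison_test'[OF sb])
    show "norm (\<integral>x. norm (g k x) \<partial>M) \<le> norm (b (int_decode k))" for k
      using bound[of "int_decode k"] by (simp add: g_def)
  qed
  show "integrable M F" unfolding F by (rule integrable_suminf[OF g AE sg])
  have "summable (\<lambda>k. norm (\<integral>x. g k x \<partial>M))"
    by (rule summable_comparison_test'[OF sg]) (simp add: integral_norm_bound)
  moreover have "(\<lambda>k. \<integral>x. g k x \<partial>M) sums (\<integral>x. F x \<partial>M)"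
    unfolding F by (rule sums_integral[OF g AE sg])
  ultimately have "((\<lambda>k. \<integral>x. g k x \<partial>M) has_sum (\<integral>x. F x \<partial>M)) UNIV"
    by (rule norm_summable_imp_has_sum)
  then show "((\<lambda>n. \<integral>x. f n x \<partial>M) has_sum (\<integral>x. F x \<partial>M)) UNIV"
    using has_sum_reindex_bij_betw[OF bij_int_decode, of "\<lambda>n. \<integral>x. f n x \<partial>M"] by (simp add: g_def)
qed

text \<open>
  This is the real part of the characteristic function of the standard normal distribution.
\<close>

lemma std_normal_cos_integral:
  fixes s :: real
  shows "integrable lborel (\<lambda>x. exp (- x\<^sup>2 / 2) * cos (s * x))"
    and "(\<integral>x. exp (- x\<^sup>2 / 2) * cos (s * x) \<partial>lborel) = sqrt (2 * pi) * exp (- s\<^sup>2 / 2)"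
proof -
  interpret real_distribution std_normal_distribution by (rule real_dist_normal_dist)
  have d: "(\<lambda>x. std_normal_density x) \<in> borel_measurable lborel" by simp
  have "integrable std_normal_distribution (\<lambda>x. cos (s * x))"
    by (rule integrable_const_bound[of _ 1]) auto
  then have i: "integrable lborel (\<lambda>x. std_normal_density x *\<^sub>R cos (s * x))"
    by (subst (asm) integrable_density) auto
  have eq: "exp (- x\<^sup>2 / 2) * cos (s * x) = sqrt (2 * pi) * (std_normal_density x *\<^sub>R cos (s * x))" for x
    by (simp add: std_normal_density_def)
  show "integrable lborel (\<lambda>x. exp (- x\<^sup>2 / 2) * cos (s * x))"
    unfolding eq by (intro integrable_mult_right i)
  have "(\<lambda>x. Re (iexp (s * x))) = (\<lambda>x. cos (s * x))" by (simp add: Re_exp)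
  then have "Re (char std_normal_distribution s) = (\<integral>x. cos (s * x) \<partial>std_normal_distribution)"
    using integral_Re[of std_normal_distribution "\<lambda>x. iexp (s * x)", OF integrable_iexp] unfolding char_def by simp
  then have "exp (- s\<^sup>2 / 2) = (\<integral>x. std_normal_density x *\<^sub>R cos (s * x) \<partial>lborel)"
    by (simp add: char_std_normal_distribution integral_density)
  then show "(\<integral>x. exp (- x\<^sup>2 / 2) * cos (s * x) \<partial>lborel) = sqrt (2 * pi) * exp (- s\<^sup>2 / 2)"
    unfolding eq by simp
qed

lemma gaussian_cos_integral:
  fixes t k :: real
  assumes t: "t > 0"
  shows "integrable lborel (\<lambda>x. exp (- pi * t * x\<^sup>2) * cos (2 * pi * k * x))"
    and "(\<integral>x. exp (- pi * t * x\<^sup>2) * cos (2 * pi * k * x) \<partial>lborel) = exp (- pi * k\<^sup>2 / t) / sqrt t"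
proof -
  define c where "c = 1 / sqrt (2 * pi * t)"
  have c: "c > 0" "c\<^sup>2 = 1 / (2 * pi * t)" using t by (auto simp: c_def power_divide)
  define f where "f = (\<lambda>x. exp (- pi * t * x\<^sup>2) * cos (2 * pi * k * x))"
  have fc: "f (0 + c * x) = exp (- x\<^sup>2 / 2) * cos ((2 * pi * k * c) * x)" for x
  proof -
    have "pi * t * (c * x)\<^sup>2 = x\<^sup>2 / 2" using t by (simp add: power_mult_distrib c(2))
    then show ?thesis by (simp add: f_def mult_ac)
  qed
  have "integrable lborel (\<lambda>x. f (0 + c * x))" unfolding fc by (rule std_normal_cos_integral)
  then show "integrable lborel (\<lambda>x. exp (- pi * t * x\<^sup>2) * cos (2 * pi * k * x))"
    using lborel_integrable_real_affine_iff[of c f 0] c(1) by (simp add: f_def)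
  have "(\<integral>x. f x \<partial>lborel) = c * (sqrt (2 * pi) * exp (- (2 * pi * k * c)\<^sup>2 / 2))"
    using lborel_integral_real_affine[of c f 0] c(1) unfolding fc std_normal_cos_integral(2) by simp
  also have "c * sqrt (2 * pi) = 1 / sqrt t" using t by (simp add: c_def real_sqrt_mult)
  then have "c * (sqrt (2 * pi) * exp (- (2 * pi * k * c)\<^sup>2 / 2)) = exp (- (2 * pi * k * c)\<^sup>2 / 2) / sqrt t"
    by (simp add: mult.assoc[symmetric])
  also have "- (2 * pi * k * c)\<^sup>2 / 2 = - pi * k\<^sup>2 / t"
    unfolding power_mult_distrib c(2) using t by (simp add: power2_eq_square)
  finally show "(\<integral>x. exp (- pi * t * x\<^sup>2) * cos (2 * pi * k * x) \<partial>lborel) = exp (- pi * k\<^sup>2 / t) / sqrt t"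
    by (simp add: f_def)
qed

text \<open>
  The left-hand side of the Poisson formula: the Gaussian summed over all integer translates. Its value at
  \<open>x = 0\<close> is the one-dimensional theta function.
\<close>

definition periodic_gaussian :: "real \<Rightarrow> real \<Rightarrow> real" where
  "periodic_gaussian t x = (\<Sum>\<^sub>\<infinity>n::int. exp (- pi * t * (real_of_int n + x)\<^sup>2))"

text \<open>
  The cosine series of the right-hand side of the Poisson formula, without the factor \<open>1 / sqrt t\<close>.
\<close>

definition gaussian_series :: "real \<Rightarrow> real \<Rightarrow> real" where
  "gaussian_series t x = (\<Sum>\<^sub>\<infinity>n::int. exp (- pi * (real_of_int n)\<^sup>2 / t) * cos (2 * pi * real_of_int n * x))"

lemma has_sum_periodic_gaussian:
  assumes "t > 0"
  shows "((\<lambda>n::int. exp (- pi * t * (real_of_int n + x)\<^sup>2)) has_sum periodic_gaussian t x) UNIV"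
  unfolding periodic_gaussian_def
  using summable_on_int_gaussian[of "pi * t" x] assms by (intro has_sum_infsum) simp

lemma summable_on_int_gaussian_inverse:
  assumes "t > 0"
  shows "(\<lambda>n::int. exp (- pi * (real_of_int n)\<^sup>2 / t)) summable_on UNIV"
  using summable_on_int_gaussian[of "pi / t" 0] assms by simp

lemma abs_mult_cos_le:
  fixes a y :: real
  assumes "0 \<le> a"
  shows "\<bar>a * cos y\<bar> \<le> a"
  using mult_left_mono[OF abs_cos_le_one[of y] assms] assms by (simp add: abs_mult)

lemma has_sum_gaussian_series:
  assumes "t > 0"
  shows "((\<lambda>n::int. exp (- pi * (real_of_int n)\<^sup>2 / t) * cos (2 * pi * real_of_int n * x)) has_sum gaussian_series t x) UNIV"
proof -
  have "(\<lambda>n::int. norm (exp (- pi * (real_of_int n)\<^sup>2 / t) * cos (2 * pi * real_of_int n * x))) summable_on UNIV"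
  proof (rule summable_on_comparison_test)
    show "(\<lambda>n::int. exp (- pi * (real_of_int n)\<^sup>2 / t)) summable_on UNIV"
      by (rule summable_on_int_gaussian_inverse[OF assms])
    show "norm (exp (- pi * (real_of_int n)\<^sup>2 / t) * cos (2 * pi * real_of_int n * x)) \<le> exp (- pi * (real_of_int n)\<^sup>2 / t)" for n
      unfolding real_norm_def by (rule abs_mult_cos_le[OF exp_ge_zero])
  qed (rule norm_ge_zero)
  then show ?thesis unfolding gaussian_series_def by (rule has_sum_infsum[OF abs_summable_summable])
qed

lemma abs_gaussian_series_le:
  assumes "t > 0"
  shows "\<bar>gaussian_series t x\<bar> \<le> gaussian_series t 0"
proof -
  have "gaussian_series t x \<le> gaussian_series t 0"
  proof (rule has_sum_mono[OF has_sum_gaussian_series[OF assms] has_sum_gaussian_series[OF assms]])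
    fix n :: int
    show "exp (- pi * (real_of_int n)\<^sup>2 / t) * cos (2 * pi * real_of_int n * x)
        \<le> exp (- pi * (real_of_int n)\<^sup>2 / t) * cos (2 * pi * real_of_int n * 0)"
      using abs_mult_cos_le[of "exp (- pi * (real_of_int n)\<^sup>2 / t)" "2 * pi * real_of_int n * x"] by simp
  qed
  moreover have "- gaussian_series t x \<le> gaussian_series t 0"
  proof (rule has_sum_mono[OF _ has_sum_gaussian_series[OF assms]])
    show "((\<lambda>n::int. - (exp (- pi * (real_of_int n)\<^sup>2 / t) * cos (2 * pi * real_of_int n * x))) has_sum - gaussian_series t x) UNIV"
      unfolding has_sum_uminus minus_minus by (rule has_sum_gaussian_series[OF assms])
    fix n :: int
    show "- (exp (- pi * (real_of_int n)\<^sup>2 / t) * cos (2 * pi * real_of_int n * x))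
        \<le> exp (- pi * (real_of_int n)\<^sup>2 / t) * cos (2 * pi * real_of_int n * 0)"
      using abs_mult_cos_le[of "exp (- pi * (real_of_int n)\<^sup>2 / t)" "2 * pi * real_of_int n * x"] by simp
  qed
  ultimately show ?thesis by simp
qed

lemma periodic_gaussian_add_1: "periodic_gaussian t (x + 1) = periodic_gaussian t x"
  unfolding periodic_gaussian_def
  by (rule infsum_reindex_bij_witness[of _ "\<lambda>n. n - 1" "\<lambda>n. n + 1"]) (auto simp: algebra_simps)

lemma gaussian_series_add_1: "gaussian_series t (x + 1) = gaussian_series t x"
proof -
  have "cos (2 * pi * real_of_int n * (x + 1)) = cos (2 * pi * real_of_int n * x)" for n
    unfolding distrib_left cos_add by (simp add: cos_int_2pin sin_int_2pin)
  then show ?thesis unfolding gaussian_series_def by simp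
qed

lemma gaussian_shift_le:
  assumes "t > 0" "0 \<le> x" "x \<le> 1"
  shows "exp (- pi * t * (real_of_int n + x)\<^sup>2) \<le> exp (pi * t) * exp (- (pi * t / 2) * (real_of_int n + 0)\<^sup>2)"
proof -
  have "(real_of_int n)\<^sup>2 \<le> 2 * (n + x)\<^sup>2 + 2 * x\<^sup>2"
    using zero_le_power2[of "n + 2 * x"] by (simp add: power2_sum)
  also have "x\<^sup>2 \<le> 1" using assms by (simp add: power_le_one)
  finally have "(pi * t / 2) * (real_of_int n)\<^sup>2 \<le> (pi * t / 2) * (2 * (n + x)\<^sup>2 + 2)"
    using assms by (intro mult_left_mono) auto
  then show ?thesis unfolding exp_add[symmetric] exp_le_cancel_iff by (simp add: distrib_left)
qed

lemma periodic_eq_frac: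
  fixes \<phi> :: "real \<Rightarrow> real"
  assumes "\<And>x. \<phi> (x + 1) = \<phi> x"
  shows "\<phi> (real_of_int n + x) = \<phi> x"
proof -
  have *: "\<phi> (real k + x) = \<phi> x" for k :: nat and x
  proof (induction k)
    case (Suc k)
    have "\<phi> (real (Suc k) + x) = \<phi> ((real k + x) + 1)" by (simp add: ac_simps)
    then show ?case using assms Suc by simp
  qed simp
  show ?thesis
  proof (cases "n \<ge> 0")
    case True
    then show ?thesis using *[of "nat n" x] by simp
  next
    case False
    then show ?thesis using *[of "nat (- n)" "n + x"] by simp
  qed
qed

lemma periodic_gaussian_bounded:
  assumes "t > 0"
  shows "\<exists>K. \<forall>x. \<bar>periodic_gaussian t x\<bar> \<le> K"
proof -
  define K where "K = exp (pi * t) * (\<Sum>\<^sub>\<infinity>n::int. exp (- (pi * t / 2) * (real_of_int n + 0)\<^sup>2))"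
  have "\<bar>periodic_gaussian t x\<bar> \<le> K" if "0 \<le> x" "x \<le> 1" for x
  proof -
    have "periodic_gaussian t x \<le> K"
    proof (rule has_sum_mono[OF has_sum_periodic_gaussian[OF assms]])
      show "((\<lambda>n::int. exp (pi * t) * exp (- (pi * t / 2) * (real_of_int n + 0)\<^sup>2)) has_sum K) UNIV"
        unfolding K_def
        by (rule has_sum_cmult_right[OF has_sum_infsum[OF summable_on_int_gaussian]]) (use assms in simp)
    qed (rule gaussian_shift_le[OF assms that])
    moreover have "0 \<le> periodic_gaussian t x" unfolding periodic_gaussian_def by (intro infsum_nonneg) simp
    ultimately show ?thesis by simp
  qed
  then have "\<bar>periodic_gaussian t (frac x)\<bar> \<le> K" for x
    by (simp add: frac_ge_0 frac_lt_1 less_imp_le)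
  moreover have "periodic_gaussian t x = periodic_gaussian t (frac x)" for x
    using periodic_eq_frac[of "periodic_gaussian t" "\<lfloor>x\<rfloor>" "frac x", OF periodic_gaussian_add_1] by (simp add: frac_def)
  ultimately show ?thesis by metis
qed

lemma continuous_on_periodic_gaussian:
  assumes "t > 0"
  shows "continuous_on {0..1} (periodic_gaussian t)"
proof (rule uniform_limit_theorem)
  show "\<forall>\<^sub>F X in finite_subsets_at_top UNIV. continuous_on {0..1} (\<lambda>x. \<Sum>n\<in>X. exp (- pi * t * (real_of_int n + x)\<^sup>2))"
    by (intro always_eventually allI continuous_intros)
  show "uniform_limit {0..1} (\<lambda>X x. \<Sum>n\<in>X. exp (- pi * t * (real_of_int n + x)\<^sup>2)) (periodic_gaussian t) (finite_subsets_at_top UNIV)"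
  proof (rule Weierstrass_m_test_general')
    show "(\<lambda>n. exp (pi * t) * exp (- (pi * t / 2) * (real_of_int n + 0)\<^sup>2)) summable_on UNIV"
      by (rule summable_on_cmult_right[OF summable_on_int_gaussian]) (use assms in simp)
    show "norm (exp (- pi * t * (real_of_int n + x)\<^sup>2)) \<le> exp (pi * t) * exp (- (pi * t / 2) * (real_of_int n + 0)\<^sup>2)"
      if "x \<in> {0..1}" for n x
      using gaussian_shift_le[OF assms, of x n] that by simp
  qed (rule has_sum_periodic_gaussian[OF assms])
qed (rule finite_subsets_at_top_neq_bot)

lemma continuous_on_gaussian_series:
  assumes "t > 0"
  shows "continuous_on UNIV (gaussian_series t)"
proof (rule uniform_limit_theorem)
  show "\<forall>\<^sub>F X in finite_subsets_at_top UNIV. continuous_on UNIV (\<lambda>x. \<Sum>n\<in>X. exp (- pi * (real_of_int n)\<^sup>2 / t) * cos (2 * pi * real_of_int n * x))"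
    by (intro always_eventually allI continuous_intros)
  show "uniform_limit UNIV (\<lambda>X x. \<Sum>n\<in>X. exp (- pi * (real_of_int n)\<^sup>2 / t) * cos (2 * pi * real_of_int n * x)) (gaussian_series t) (finite_subsets_at_top UNIV)"
  proof (rule Weierstrass_m_test_general'[OF _ has_sum_gaussian_series[OF assms] summable_on_int_gaussian_inverse[OF assms]])
    show "norm (exp (- pi * (real_of_int n)\<^sup>2 / t) * cos (2 * pi * real_of_int n * x)) \<le> exp (- pi * (real_of_int n)\<^sup>2 / t)" for n x
      unfolding real_norm_def by (rule abs_mult_cos_le[OF exp_ge_zero])
  qed
qed (rule finite_subsets_at_top_neq_bot)

text \<open>
  Unfolding: the unit intervals starting at the integers tile the line, and \<open>\<phi>\<close> is the same on all of
  them.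
\<close>

lemma periodic_gaussian_unfold:
  fixes \<phi> :: "real \<Rightarrow> real"
  assumes t: "t > 0" and [measurable]: "\<phi> \<in> borel_measurable borel" and K: "\<And>x. \<bar>\<phi> x\<bar> \<le> K"
    and per: "\<And>x. \<phi> (x + 1) = \<phi> x"
  shows "integrable lborel (\<lambda>x. indicator {0..<1} x * (periodic_gaussian t x * \<phi> x))"
    and "(\<integral>x. indicator {0..<1} x * (periodic_gaussian t x * \<phi> x) \<partial>lborel) = (\<integral>x. exp (- pi * t * x\<^sup>2) * \<phi> x \<partial>lborel)"
proof -
  define f where "f = (\<lambda>(n::int) x. indicator {0..<1} x * (exp (- pi * t * (real_of_int n + x)\<^sup>2) * \<phi> x))"
  define h where "h = (\<lambda>(n::int) x. indicator {real_of_int n..<real_of_int n + 1} x * (exp (- pi * t * x\<^sup>2) * \<phi> x))"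
  define b where "b = (\<lambda>n::int. K * (exp (pi * t) * exp (- (pi * t / 2) * (real_of_int n + 0)\<^sup>2)))"
  have K0: "K \<ge> 0" using K[of 0] by simp
  have b: "b summable_on UNIV"
    unfolding b_def by (rule summable_on_cmult_right[OF summable_on_cmult_right[OF summable_on_int_gaussian]]) (use t in simp)
  have fb: "\<bar>f n x\<bar> \<le> b n * indicator {0..<1} x" for n x
  proof (cases "x \<in> {0..<1}")
    case True
    then have "exp (- pi * t * (real_of_int n + x)\<^sup>2) * \<bar>\<phi> x\<bar>
        \<le> (exp (pi * t) * exp (- (pi * t / 2) * (real_of_int n + 0)\<^sup>2)) * K"
      using gaussian_shift_le[OF t, of x n] K by (intro mult_mono) auto
    then show ?thesis using True by (simp add: f_def b_def abs_mult mult_ac)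
  qed (simp add: f_def)
  have [measurable]: "f n \<in> borel_measurable lborel" for n unfolding f_def by measurable
  have ib: "integrable lborel (\<lambda>x. b n * indicator {0..<1::real} x)" for n
    by (intro integrable_mult_right integrable_real_indicator) auto
  have fi: "integrable lborel (f n)" for n
    by (rule Bochner_Integration.integrable_bound[OF ib[of n]]) (use fb in \<open>auto intro!: AE_I2 order_trans[OF fb]\<close>)
  have fbi: "(\<integral>x. \<bar>f n x\<bar> \<partial>lborel) \<le> b n" for n
  proof -
    have "(\<integral>x. \<bar>f n x\<bar> \<partial>lborel) \<le> (\<integral>x. b n * indicator {0..<1::real} x \<partial>lborel)"
      by (intro integral_mono integrable_abs fi ib fb)
    also have "\<dots> = b n" by simp
    finally show ?thesis .
  qed
  have fs: "((\<lambda>n. f n x) has_sum indicator {0..<1} x * (periodic_gaussian t x * \<phi> x)) UNIV" for x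
    unfolding f_def by (intro has_sum_cmult_right has_sum_cmult_left has_sum_periodic_gaussian[OF t])
  note F = has_sum_integral_int[OF fi fbi b fs]
  show "integrable lborel (\<lambda>x. indicator {0..<1} x * (periodic_gaussian t x * \<phi> x))" by (rule F(1))
  have hf: "h n (real_of_int n + 1 * x) = f n x" for n x
    using periodic_eq_frac[of \<phi> n x, OF per] by (simp add: f_def h_def indicator_def)
  have hi: "integrable lborel (h n)" for n
    using lborel_integrable_real_affine_iff[of 1 "h n" "real_of_int n"] fi[of n] unfolding hf by simp
  have hfi: "(\<integral>x. h n x \<partial>lborel) = (\<integral>x. f n x \<partial>lborel)" for n
    using lborel_integral_real_affine[of 1 "h n" "real_of_int n"] unfolding hf by simp
  have hbi: "(\<integral>x. \<bar>h n x\<bar> \<partial>lborel) \<le> b n" for n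
    using lborel_integral_real_affine[of 1 "\<lambda>x. \<bar>h n x\<bar>" "real_of_int n"] fbi[of n] unfolding hf by simp
  have hs: "((\<lambda>n. h n x) has_sum exp (- pi * t * x\<^sup>2) * \<phi> x) UNIV" for x
  proof (rule has_sum_finite_neutralI[of "{\<lfloor>x\<rfloor>}"])
    show "h n x = 0" if "n \<in> UNIV - {\<lfloor>x\<rfloor>}" for n
    proof -
      have "\<not> (real_of_int n \<le> x \<and> x < real_of_int n + 1)" using that floor_unique by blast
      then show ?thesis by (auto simp: h_def indicator_def)
    qed
    show "exp (- pi * t * x\<^sup>2) * \<phi> x = (\<Sum>n\<in>{\<lfloor>x\<rfloor>}. h n x)"
      by (simp add: h_def indicator_def)
  qed auto
  from has_sum_unique[OF F(2)] has_sum_integral_int(2)[OF hi hbi b hs]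
  show "(\<integral>x. indicator {0..<1} x * (periodic_gaussian t x * \<phi> x) \<partial>lborel) = (\<integral>x. exp (- pi * t * x\<^sup>2) * \<phi> x \<partial>lborel)"
    unfolding hfi by blast
qed

lemma cos_int_integral:
  fixes m :: int
  shows "(\<integral>x. indicator {0..<1} x * cos (2 * pi * real_of_int m * x) \<partial>lborel) = (if m = 0 then 1 else 0)"
proof (cases "m = 0")
  case False
  have ae: "AE x in lborel. x \<noteq> (1::real)" by (rule AE_lborel_singleton)
  have "(\<integral>x. indicator {0..<1} x * cos (2 * pi * real_of_int m * x) \<partial>lborel) =
    (\<integral>x. cos (2 * pi * real_of_int m * x) * indicator {0..1} x \<partial>lborel)"
    by (rule integral_cong_AE) (use ae in \<open>auto simp: indicator_def\<close>)
  also have "\<dots> = sin (2 * pi * real_of_int m * 1) / (2 * pi * real_of_int m) - sin (2 * pi * real_of_int m * 0) / (2 * pi * real_of_int m)"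
    by (rule integral_FTC_Icc_real) (use False in \<open>auto intro!: derivative_eq_intros continuous_intros\<close>)
  also have "\<dots> = 0" by (simp add: sin_int_2pin)
  finally show ?thesis using False by simp
qed simp

lemma cos_cos_integral:
  fixes j k :: int
  shows "(\<integral>x. indicator {0..<1} x * cos (2 * pi * real_of_int j * x) * cos (2 * pi * real_of_int k * x) \<partial>lborel)
    = ((if j = k then 1 else 0) + (if j = - k then 1 else 0)) / 2"
proof -
  have i: "integrable lborel (\<lambda>x. indicator {0..<1} x * cos (2 * pi * real_of_int m * x))" for m
    by (rule Bochner_Integration.integrable_bound[of _ "indicator {0..<1}"])
      (auto intro!: AE_I2 integrable_real_indicator simp: indicator_def)
  have eq: "indicator {0..<1} x * cos (2 * pi * real_of_int j * x) * cos (2 * pi * real_of_int k * x) =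
    (indicator {0..<1} x * cos (2 * pi * real_of_int (j - k) * x) + indicator {0..<1} x * cos (2 * pi * real_of_int (j + k) * x)) / 2" for x :: real
  proof -
    have "cos (2 * pi * real_of_int j * x) * cos (2 * pi * real_of_int k * x) =
      (cos (2 * pi * real_of_int (j - k) * x) + cos (2 * pi * real_of_int (j + k) * x)) / 2"
      unfolding cos_times_cos by (simp add: algebra_simps)
    then show ?thesis by (simp only: mult.assoc) (simp add: distrib_left)
  qed
  show ?thesis
    unfolding eq using Bochner_Integration.integral_add[OF i[of "j - k"] i[of "j + k"]]
    by (simp add: cos_int_integral eq_neg_iff_add_eq_0 flip: of_int_add of_int_diff)
qed

text \<open>
  Termwise integration of the cosine series against an integrable weight. It is applied with a Gaussian
  weight, with a cosine on the unit interval, and with the series itself on the unit interval.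
\<close>

lemma gaussian_series_weighted_integral:
  fixes w :: "real \<Rightarrow> real"
  assumes t: "t > 0" and w: "integrable lborel w"
  shows "((\<lambda>n::int. exp (- pi * (real_of_int n)\<^sup>2 / t) * (\<integral>x. w x * cos (2 * pi * real_of_int n * x) \<partial>lborel))
      has_sum (\<integral>x. w x * gaussian_series t x \<partial>lborel)) UNIV"
    and "integrable lborel (\<lambda>x. w x * gaussian_series t x)"
proof -
  define a where "a = (\<lambda>n::int. exp (- pi * (real_of_int n)\<^sup>2 / t))"
  define f where "f = (\<lambda>(n::int) x. w x * (a n * cos (2 * pi * real_of_int n * x)))"
  have [measurable]: "w \<in> borel_measurable borel" using w by (auto dest: borel_measurable_integrable)
  have fb: "\<bar>f n x\<bar> \<le> a n * \<bar>w x\<bar>" for n x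
    using mult_left_mono[OF abs_mult_cos_le[of "a n" "2 * pi * real_of_int n * x"], of "\<bar>w x\<bar>"]
    by (simp add: f_def abs_mult a_def mult_ac)
  have ib: "integrable lborel (\<lambda>x. a n * \<bar>w x\<bar>)" for n by (intro integrable_mult_right integrable_abs w)
  have fi: "integrable lborel (f n)" for n
  proof (rule Bochner_Integration.integrable_bound[OF ib[of n]])
    show "f n \<in> borel_measurable lborel" unfolding f_def by measurable
    show "AE x in lborel. norm (f n x) \<le> norm (a n * \<bar>w x\<bar>)"
      unfolding real_norm_def using order_trans[OF fb abs_ge_self] by (intro AE_I2)
  qed
  have fbi: "(\<integral>x. \<bar>f n x\<bar> \<partial>lborel) \<le> a n * (\<integral>x. \<bar>w x\<bar> \<partial>lborel)" for n
  proof -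
    have "(\<integral>x. \<bar>f n x\<bar> \<partial>lborel) \<le> (\<integral>x. a n * \<bar>w x\<bar> \<partial>lborel)"
      by (intro integral_mono integrable_abs fi ib fb)
    then show ?thesis by simp
  qed
  have b: "(\<lambda>n. a n * (\<integral>x. \<bar>w x\<bar> \<partial>lborel)) summable_on UNIV"
    unfolding a_def by (rule summable_on_cmult_left[OF summable_on_int_gaussian_inverse[OF t]])
  have fs: "((\<lambda>n. f n x) has_sum w x * gaussian_series t x) UNIV" for x
    unfolding f_def a_def by (rule has_sum_cmult_right[OF has_sum_gaussian_series[OF t]])
  have "(\<integral>x. f n x \<partial>lborel) = a n * (\<integral>x. w x * cos (2 * pi * real_of_int n * x) \<partial>lborel)" for n
    unfolding f_def by (simp add: mult.left_commute flip: Bochner_Integration.integral_mult_right_zero)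
  then show "((\<lambda>n::int. exp (- pi * (real_of_int n)\<^sup>2 / t) * (\<integral>x. w x * cos (2 * pi * real_of_int n * x) \<partial>lborel))
      has_sum (\<integral>x. w x * gaussian_series t x \<partial>lborel)) UNIV"
    using has_sum_integral_int(2)[OF fi fbi b fs] by (simp add: a_def)
  show "integrable lborel (\<lambda>x. w x * gaussian_series t x)"
    by (rule has_sum_integral_int(1)[OF fi fbi b fs])
qed

lemma has_sum_theta_scaled:
  assumes "s > 0"
  shows "((\<lambda>n::int. exp (- pi * s * (real_of_int n)\<^sup>2)) has_sum periodic_gaussian s 0) UNIV"
  using has_sum_periodic_gaussian[OF assms, of 0] by simp

lemma borel_measurable_periodic_gaussian:
  assumes "t > 0"
  shows "periodic_gaussian t \<in> borel_measurable borel"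
  by (rule borel_measurable_has_sum_int[OF _ has_sum_periodic_gaussian[OF assms]]) measurable

lemma periodic_gaussian_norm_sq:
  assumes t: "t > 0"
  shows "(\<integral>x. indicator {0..<1} x * (periodic_gaussian t x * periodic_gaussian t x) \<partial>lborel) = periodic_gaussian (t / 2) 0 / sqrt (2 * t)"
proof -
  obtain K where K: "\<And>x. \<bar>periodic_gaussian t x\<bar> \<le> K" using periodic_gaussian_bounded[OF t] by blast
  define f where "f = (\<lambda>(n::int) x. exp (- pi * t * x\<^sup>2) * exp (- pi * t * (real_of_int n + x)\<^sup>2))"
  have f: "f n x = exp (- pi * (t / 2) * (real_of_int n)\<^sup>2) * exp (- pi * (2 * t) * (n / 2 + 1 * x)\<^sup>2)" for n x
    unfolding f_def exp_add[symmetric] by (simp add: power2_eq_square field_simps)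
  have g: "integrable lborel (\<lambda>x. exp (- pi * (2 * t) * x\<^sup>2))" "(\<integral>x. exp (- pi * (2 * t) * x\<^sup>2) \<partial>lborel) = 1 / sqrt (2 * t)"
    using gaussian_cos_integral[of "2 * t" 0] t by simp_all
  have fi: "integrable lborel (f n)" for n
    unfolding f by (intro integrable_mult_right lborel_integrable_real_affine[OF g(1)]) simp
  have fint: "(\<integral>x. f n x \<partial>lborel) = exp (- pi * (t / 2) * (real_of_int n)\<^sup>2) * (1 / sqrt (2 * t))" for n
    using lborel_integral_real_affine[of 1 "\<lambda>x. exp (- pi * (2 * t) * x\<^sup>2)" "n / 2"] g(2) unfolding f by simp
  have fbi: "(\<integral>x. \<bar>f n x\<bar> \<partial>lborel) \<le> exp (- pi * (t / 2) * (real_of_int n)\<^sup>2) * (1 / sqrt (2 * t))" for n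
    using fint[of n] by (simp add: f_def)
  have th: "((\<lambda>n::int. exp (- pi * (t / 2) * (real_of_int n)\<^sup>2) * (1 / sqrt (2 * t))) has_sum periodic_gaussian (t / 2) 0 * (1 / sqrt (2 * t))) UNIV"
    by (rule has_sum_cmult_left[OF has_sum_theta_scaled]) (use t in simp)
  have fs: "((\<lambda>n. f n x) has_sum exp (- pi * t * x\<^sup>2) * periodic_gaussian t x) UNIV" for x
    unfolding f_def by (rule has_sum_cmult_right[OF has_sum_periodic_gaussian[OF t]])
  have "((\<lambda>n. \<integral>x. f n x \<partial>lborel) has_sum (\<integral>x. exp (- pi * t * x\<^sup>2) * periodic_gaussian t x \<partial>lborel)) UNIV"
    by (rule has_sum_integral_int(2)[OF fi fbi has_sum_imp_summable[OF th] fs])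
  then have "(\<integral>x. exp (- pi * t * x\<^sup>2) * periodic_gaussian t x \<partial>lborel) = periodic_gaussian (t / 2) 0 * (1 / sqrt (2 * t))"
    unfolding fint using th has_sum_unique by blast
  then show ?thesis
    unfolding periodic_gaussian_unfold(2)[OF t borel_measurable_periodic_gaussian[OF t] K periodic_gaussian_add_1] by simp
qed

lemma borel_measurable_gaussian_series:
  assumes "t > 0"
  shows "gaussian_series t \<in> borel_measurable borel"
  using continuous_on_gaussian_series[OF assms] by (rule borel_measurable_continuous_onI)

lemma periodic_gaussian_inner_series:
  assumes t: "t > 0"
  shows "(\<integral>x. indicator {0..<1} x * (periodic_gaussian t x * gaussian_series t x) \<partial>lborel) = periodic_gaussian (2 / t) 0 / sqrt t"
proof -
  have g: "integrable lborel (\<lambda>x. exp (- pi * t * x\<^sup>2))" using gaussian_cos_integral(1)[OF t, of 0] by simp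
  have "((\<lambda>n::int. exp (- pi * (real_of_int n)\<^sup>2 / t) * (exp (- pi * (real_of_int n)\<^sup>2 / t) / sqrt t))
      has_sum (\<integral>x. exp (- pi * t * x\<^sup>2) * gaussian_series t x \<partial>lborel)) UNIV"
    using gaussian_series_weighted_integral(1)[OF t g] unfolding gaussian_cos_integral(2)[OF t] .
  moreover have "exp (- pi * (real_of_int n)\<^sup>2 / t) * (exp (- pi * (real_of_int n)\<^sup>2 / t) / sqrt t)
      = exp (- pi * (2 / t) * (real_of_int n)\<^sup>2) * (1 / sqrt t)" for n :: int
    by (simp flip: exp_add)
  moreover have "((\<lambda>n::int. exp (- pi * (2 / t) * (real_of_int n)\<^sup>2) * (1 / sqrt t)) has_sum periodic_gaussian (2 / t) 0 * (1 / sqrt t)) UNIV"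
    by (rule has_sum_cmult_left[OF has_sum_theta_scaled]) (use t in simp)
  ultimately have "(\<integral>x. exp (- pi * t * x\<^sup>2) * gaussian_series t x \<partial>lborel) = periodic_gaussian (2 / t) 0 * (1 / sqrt t)"
    using has_sum_unique by (simp only:) blast
  then show ?thesis
    unfolding periodic_gaussian_unfold(2)[OF t borel_measurable_gaussian_series[OF t] abs_gaussian_series_le[OF t] gaussian_series_add_1] by simp
qed

lemma gaussian_series_norm_sq:
  assumes t: "t > 0"
  shows "integrable lborel (\<lambda>x. indicator {0..<1} x * (gaussian_series t x * gaussian_series t x))"
    and "(\<integral>x. indicator {0..<1} x * (gaussian_series t x * gaussian_series t x) \<partial>lborel) = periodic_gaussian (2 / t) 0"
proof -
  define a where "a = (\<lambda>n::int. exp (- pi * (real_of_int n)\<^sup>2 / t))"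
  have [measurable]: "gaussian_series t \<in> borel_measurable borel" by (rule borel_measurable_gaussian_series[OF t])
  have iS: "integrable lborel (\<lambda>x. indicator {0..<1} x * gaussian_series t x)"
  proof (rule Bochner_Integration.integrable_bound)
    show "integrable lborel (\<lambda>x. gaussian_series t 0 * indicator {0..<1::real} x)"
      by (intro integrable_mult_right integrable_real_indicator) auto
    show "AE x in lborel. norm (indicator {0..<1} x * gaussian_series t x) \<le> norm (gaussian_series t 0 * indicator {0..<1::real} x)"
      using abs_gaussian_series_le[OF t] by (intro AE_I2) (auto simp: indicator_def intro: order_trans[OF _ abs_ge_self])
  qed measurable
  have icos: "integrable lborel (\<lambda>x. indicator {0..<1} x * cos (2 * pi * real_of_int j * x))" for j
    by (rule Bochner_Integration.integrable_bound[of _ "indicator {0..<1}"])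
      (auto intro!: AE_I2 integrable_real_indicator simp: indicator_def)
  have coeff: "(\<integral>x. indicator {0..<1} x * gaussian_series t x * cos (2 * pi * real_of_int j * x) \<partial>lborel) = a j" for j
  proof -
    have "((\<lambda>n. a n * (\<integral>x. indicator {0..<1} x * cos (2 * pi * real_of_int j * x) * cos (2 * pi * real_of_int n * x) \<partial>lborel))
      has_sum (\<integral>x. indicator {0..<1} x * cos (2 * pi * real_of_int j * x) * gaussian_series t x \<partial>lborel)) UNIV"
      unfolding a_def by (rule gaussian_series_weighted_integral(1)[OF t icos])
    then have 1: "((\<lambda>n. a n * (((if j = n then 1 else 0) + (if j = - n then 1 else 0)) / 2))
      has_sum (\<integral>x. indicator {0..<1} x * cos (2 * pi * real_of_int j * x) * gaussian_series t x \<partial>lborel)) UNIV"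
      unfolding cos_cos_integral .
    have 2: "((\<lambda>n. a n * (((if j = n then 1 else 0) + (if j = - n then 1 else 0)) / 2)) has_sum a j) UNIV"
    proof (rule has_sum_finite_neutralI[of "{j, - j}"])
      show "a j = (\<Sum>n\<in>{j, - j}. a n * (((if j = n then 1 else 0) + (if j = - n then 1 else 0)) / 2))"
        by (cases "j = 0") (auto simp: a_def)
    qed auto
    show ?thesis using has_sum_unique[OF 1 2] by (simp add: mult_ac)
  qed
  have "((\<lambda>n. a n * a n) has_sum (\<integral>x. indicator {0..<1} x * gaussian_series t x * gaussian_series t x \<partial>lborel)) UNIV"
    using gaussian_series_weighted_integral(1)[OF t iS] unfolding coeff by (simp add: a_def)
  moreover have "((\<lambda>n. a n * a n) has_sum periodic_gaussian (2 / t) 0) UNIV"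
  proof -
    have "a n * a n = exp (- pi * (2 / t) * (real_of_int n)\<^sup>2)" for n
      unfolding a_def exp_add[symmetric] by (simp add: field_simps)
    then show ?thesis using has_sum_theta_scaled[of "2 / t"] t by simp
  qed
  ultimately show "(\<integral>x. indicator {0..<1} x * (gaussian_series t x * gaussian_series t x) \<partial>lborel) = periodic_gaussian (2 / t) 0"
    unfolding mult.assoc using has_sum_unique by blast
  show "integrable lborel (\<lambda>x. indicator {0..<1} x * (gaussian_series t x * gaussian_series t x))"
    using gaussian_series_weighted_integral(2)[OF t iS] by (simp add: mult.assoc)
qed

text \<open>
  The squared \<open>L\<^sup>2\<close> distance of the two sides of the Poisson formula over one period. The three inner
  products have closed forms in terms of theta values at zero, so the distance does as well.
\<close>

lemma poisson_defect:
  assumes t: "t > 0"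
  shows "integrable lborel (\<lambda>x. indicator {0..<1} x * (periodic_gaussian t x - gaussian_series t x / sqrt t)\<^sup>2)"
    and "(\<integral>x. indicator {0..<1} x * (periodic_gaussian t x - gaussian_series t x / sqrt t)\<^sup>2 \<partial>lborel)
      = periodic_gaussian (t / 2) 0 / sqrt (2 * t) - periodic_gaussian (2 / t) 0 / t"
proof -
  obtain K where K: "\<And>x. \<bar>periodic_gaussian t x\<bar> \<le> K" using periodic_gaussian_bounded[OF t] by blast
  define c where "c = 1 / sqrt t"
  note 1 = periodic_gaussian_unfold(1)[OF t borel_measurable_periodic_gaussian[OF t] K periodic_gaussian_add_1]
  note 2 = periodic_gaussian_unfold(1)[OF t borel_measurable_gaussian_series[OF t] abs_gaussian_series_le[OF t] gaussian_series_add_1]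
  note 3 = gaussian_series_norm_sq(1)[OF t]
  have eq: "indicator {0..<1} x * (periodic_gaussian t x - gaussian_series t x / sqrt t)\<^sup>2 =
    indicator {0..<1} x * (periodic_gaussian t x * periodic_gaussian t x)
    - (2 * c) * (indicator {0..<1} x * (periodic_gaussian t x * gaussian_series t x))
    + c\<^sup>2 * (indicator {0..<1} x * (gaussian_series t x * gaussian_series t x))" for x :: real
  proof -
    have "gaussian_series t x / sqrt t = c * gaussian_series t x" by (simp add: c_def)
    then show ?thesis by (simp only:) (simp add: power2_eq_square algebra_simps)
  qed
  show "integrable lborel (\<lambda>x. indicator {0..<1} x * (periodic_gaussian t x - gaussian_series t x / sqrt t)\<^sup>2)"
    unfolding eq using 1 2 3 by simp
  have "(\<integral>x. indicator {0..<1} x * (periodic_gaussian t x - gaussian_series t x / sqrt t)\<^sup>2 \<partial>lborel)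
    = periodic_gaussian (t / 2) 0 / sqrt (2 * t) - (2 * c) * (periodic_gaussian (2 / t) 0 / sqrt t) + c\<^sup>2 * periodic_gaussian (2 / t) 0"
    unfolding eq using 1 2 3
    by (simp add: periodic_gaussian_norm_sq[OF t] periodic_gaussian_inner_series[OF t] gaussian_series_norm_sq(2)[OF t])
  also have "\<dots> = periodic_gaussian (t / 2) 0 / sqrt (2 * t) - periodic_gaussian (2 / t) 0 / t"
    using t by (simp add: c_def power2_eq_square field_simps)
  finally show "(\<integral>x. indicator {0..<1} x * (periodic_gaussian t x - gaussian_series t x / sqrt t)\<^sup>2 \<partial>lborel)
      = periodic_gaussian (t / 2) 0 / sqrt (2 * t) - periodic_gaussian (2 / t) 0 / t" .
qed

text \<open>
  The closed form of the squared distance is nonnegative for every \<open>t\<close>. Up to a positive factor it changes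
  its sign when \<open>t\<close> is replaced by \<open>4/t\<close>. So it is zero, the two sides agree almost everywhere, and by
  continuity everywhere.
\<close>

theorem poisson_gaussian:
  assumes t: "t > 0"
  shows "periodic_gaussian t x = gaussian_series t x / sqrt t"
proof -
  define D where "D = (\<lambda>x. periodic_gaussian t x - gaussian_series t x / sqrt t)"
  have ge: "periodic_gaussian (2 / s) 0 / s \<le> periodic_gaussian (s / 2) 0 / sqrt (2 * s)" if "s > 0" for s
  proof -
    have "0 \<le> (\<integral>x. indicator {0..<1} x * (periodic_gaussian s x - gaussian_series s x / sqrt s)\<^sup>2 \<partial>lborel)"
      by (intro integral_nonneg_AE AE_I2) auto
    then show ?thesis unfolding poisson_defect(2)[OF that] by simp
  qed
  have int0: "(\<integral>x. indicator {0..<1} x * (D x)\<^sup>2 \<partial>lborel) = 0"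
  proof -
    define P Q where "P = periodic_gaussian (t / 2) 0" and "Q = periodic_gaussian (2 / t) 0"
    have 1: "Q / t \<le> P / sqrt (2 * t)" using ge[OF t] by (simp add: P_def Q_def)
    \<comment> \<open>The same inequality at \<open>4/t\<close>, which exchanges \<open>t/2\<close> and \<open>2/t\<close>.\<close>
    have "P / (4 / t) \<le> Q / sqrt (2 * (4 / t))" using ge[of "4 / t"] t by (simp add: P_def Q_def)
    then have "P * t / 4 \<le> Q * sqrt (2 * t) / 4"
    proof -
      have "sqrt (2 * (4 / t)) = 4 / sqrt (2 * t)"
      proof (rule real_sqrt_unique)
        show "(4 / sqrt (2 * t))\<^sup>2 = 2 * (4 / t)" using t by (simp add: power_divide)
      qed (use t in simp)
      then show ?thesis using \<open>P / (4 / t) \<le> _\<close> t by simp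
    qed
    then have "(P * t) / (t * sqrt (2 * t)) \<le> (Q * sqrt (2 * t)) / (t * sqrt (2 * t))"
      using t by (intro divide_right_mono) auto
    then have "P / sqrt (2 * t) \<le> Q / t" using t by simp
    with 1 show ?thesis unfolding D_def poisson_defect(2)[OF t] by (simp add: P_def Q_def)
  qed
  have "AE x in lborel. indicator {0..<1} x * (D x)\<^sup>2 = 0"
    using integral_nonneg_eq_0_iff_AE[of lborel "\<lambda>x. indicator {0..<1} x * (D x)\<^sup>2"] poisson_defect(1)[OF t] int0
    by (auto simp: D_def)
  then have ae: "AE x in lborel. x \<in> {0<..<1} \<longrightarrow> D x = 0"
    by eventually_elim (auto simp: indicator_def split: if_splits)
  have cont: "continuous_on {0..1} D"
    unfolding D_def using t
    by (intro continuous_intros continuous_on_periodic_gaussian continuous_on_subset[OF continuous_on_gaussian_series]) auto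
  have D0: "D x = 0" if "x \<in> {0<..<1}" for x
  proof (rule ccontr)
    assume "D x \<noteq> 0"
    define U where "U = D -` (- {0}) \<inter> {0<..<1}"
    have "open ({0<..<1} \<inter> D -` (- {0}))"
      by (rule continuous_open_preimage[OF continuous_on_subset[OF cont]]) auto
    then have "open U" unfolding U_def by (simp only: Int_commute)
    moreover have "x \<in> U" using that \<open>D x \<noteq> 0\<close> by (simp add: U_def)
    ultimately have "\<not> negligible U" using open_not_negligible by blast
    moreover have "negligible U"
    proof -
      have "AE x in lebesgue. x \<notin> U" using AE_completion[OF ae] by eventually_elim (auto simp: U_def)
      moreover have "U \<in> sets lebesgue" using \<open>open U\<close> by simp
      ultimately show ?thesis unfolding negligible_iff_null_sets using AE_iff_null_sets by blast
    qed
    ultimately show False by blast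
  qed
  have "D x = 0" if "x \<in> {0..1}" for x
  proof (rule continuous_constant_on_closure[of "{0<..<1::real}" D 0])
    show "continuous_on (closure {0<..<1}) D" using cont by simp
  qed (use D0 that in auto)
  then have "D (frac x) = 0" using frac_ge_0[of x] frac_lt_1[of x] by simp
  moreover have "D (y + 1) = D y" for y
    by (simp add: D_def periodic_gaussian_add_1 gaussian_series_add_1)
  then have "D x = D (frac x)" using periodic_eq_frac[of D "\<lfloor>x\<rfloor>" "frac x"] by (simp add: frac_def)
  ultimately show ?thesis by (simp add: D_def)
qed

section \<open>Binary quadratic forms and the functional equation\<close>

definition form_theta :: "real \<Rightarrow> real \<Rightarrow> real \<Rightarrow> real \<Rightarrow> real" where
  "form_theta p q r \<alpha> = (\<Sum>\<^sub>\<infinity>(m, n)\<in>(UNIV :: (int \<times> int) set).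
     exp (- pi * \<alpha> * (p * (real_of_int m)\<^sup>2 + 2 * q * real_of_int m * real_of_int n + r * (real_of_int n)\<^sup>2)))"

lemma summable_on_gaussian_int2:
  assumes "a > 0"
  shows "(\<lambda>(m::int, n::int). exp (- a * (real_of_int m)\<^sup>2) * exp (- a * (real_of_int n)\<^sup>2)) summable_on UNIV"
proof -
  obtain s where s: "((\<lambda>n::int. exp (- a * (real_of_int n)\<^sup>2)) has_sum s) UNIV"
    using summable_on_int_gaussian[OF assms, of 0] by (auto simp: summable_on_def)
  show ?thesis
    using has_sum_product[OF s s] by (auto intro: has_sum_imp_summable)
qed

text \<open>
  The determinant divided by the trace is a lower bound for the smaller eigenvalue.
\<close>

lemma pos_def_form_ge:
  fixes p q r x y :: real
  assumes "p > 0" "r > 0"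
  shows "(p * r - q\<^sup>2) / (p + r) * (x\<^sup>2 + y\<^sup>2) \<le> p * x\<^sup>2 + 2 * q * x * y + r * y\<^sup>2"
proof -
  have "(p + r) * (p * x\<^sup>2 + 2 * q * x * y + r * y\<^sup>2) - (p * r - q\<^sup>2) * (x\<^sup>2 + y\<^sup>2) = (p * x + q * y)\<^sup>2 + (q * x + r * y)\<^sup>2"
    by (simp add: power2_eq_square algebra_simps)
  then have "(p * r - q\<^sup>2) * (x\<^sup>2 + y\<^sup>2) \<le> (p + r) * (p * x\<^sup>2 + 2 * q * x * y + r * y\<^sup>2)"
    by (smt (verit) zero_le_power2)
  then show ?thesis using assms by (simp add: field_simps)
qed

lemma has_sum_form_theta:
  assumes "p > 0" "r > 0" "q\<^sup>2 < p * r" "\<alpha> > 0"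
  shows "((\<lambda>(m, n). exp (- pi * \<alpha> * (p * (real_of_int m)\<^sup>2 + 2 * q * real_of_int m * real_of_int n + r * (real_of_int n)\<^sup>2)))
    has_sum form_theta p q r \<alpha>) UNIV"
proof -
  define a where "a = pi * \<alpha> * ((p * r - q\<^sup>2) / (p + r))"
  have a: "a > 0" using assms by (simp add: a_def)
  have "(\<lambda>(m::int, n::int). exp (- pi * \<alpha> * (p * (real_of_int m)\<^sup>2 + 2 * q * real_of_int m * real_of_int n + r * (real_of_int n)\<^sup>2))) summable_on UNIV"
  proof (rule summable_on_comparison_test[OF summable_on_gaussian_int2[OF a]])
    fix v :: "int \<times> int"
    obtain m n where v: "v = (m, n)" by force
    have "a * ((real_of_int m)\<^sup>2 + (real_of_int n)\<^sup>2) \<le> pi * \<alpha> * (p * (real_of_int m)\<^sup>2 + 2 * q * real_of_int m * real_of_int n + r * (real_of_int n)\<^sup>2)"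
      unfolding a_def mult.assoc[of "pi * \<alpha>"] using assms by (intro mult_left_mono pos_def_form_ge) auto
    then show "(case v of (m, n) \<Rightarrow> exp (- pi * \<alpha> * (p * (real_of_int m)\<^sup>2 + 2 * q * real_of_int m * real_of_int n + r * (real_of_int n)\<^sup>2)))
       \<le> (case v of (m, n) \<Rightarrow> exp (- a * (real_of_int m)\<^sup>2) * exp (- a * (real_of_int n)\<^sup>2))"
      unfolding v prod.case exp_add[symmetric] exp_le_cancel_iff by (simp only: distrib_left mult_minus_left)
  qed auto
  then show ?thesis unfolding form_theta_def by (rule has_sum_infsum)
qed

text \<open>
  Completing the square in \<open>m\<close> makes each row a translated one-dimensional Gaussian sum. Poisson summation
  in \<open>m\<close>, an exchange of the sums and Poisson summation in \<open>n\<close> produce the same form again with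
  the two variables interchanged.
\<close>

theorem form_theta_functional_equation:
  assumes p: "p > 0" and det: "p * r - q\<^sup>2 = 1" and \<alpha>: "\<alpha> > 0"
  shows "form_theta p q r \<alpha> = form_theta p q r (1 / \<alpha>) / \<alpha>"
proof -
  have r: "r = (1 + q\<^sup>2) / p" using p det by (simp add: field_simps)
  have r0: "r > 0" unfolding r using p by (simp add: add_pos_nonneg)
  have det': "q\<^sup>2 < p * r" using det by simp
  have rows: "form_theta p q r \<beta> = (\<Sum>\<^sub>\<infinity>n::int. exp (- pi * (real_of_int n)\<^sup>2 / (p / \<beta>)) * periodic_gaussian (\<beta> * p) (q * n / p))"
    if \<beta>: "\<beta> > 0" for \<beta>
  proof -
    have split: "exp (- pi * \<beta> * (p * (real_of_int m)\<^sup>2 + 2 * q * real_of_int m * real_of_int n + r * (real_of_int n)\<^sup>2))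
      = exp (- pi * (real_of_int n)\<^sup>2 / (p / \<beta>)) * exp (- pi * (\<beta> * p) * (real_of_int m + q * n / p)\<^sup>2)" for m n :: int
      unfolding exp_add[symmetric] r using p \<beta> by (simp add: power2_eq_square field_simps)
    have hs: "((\<lambda>(n::int, m::int). exp (- pi * (real_of_int n)\<^sup>2 / (p / \<beta>)) * exp (- pi * (\<beta> * p) * (real_of_int m + q * n / p)\<^sup>2))
      has_sum form_theta p q r \<beta>) (UNIV \<times> UNIV)"
      using has_sum_swap[THEN iffD1, OF has_sum_form_theta[OF p r0 det' \<beta>, folded UNIV_Times_UNIV]]
      unfolding prod.case split .
    have "((\<lambda>n::int. exp (- pi * (real_of_int n)\<^sup>2 / (p / \<beta>)) * periodic_gaussian (\<beta> * p) (q * n / p)) has_sum form_theta p q r \<beta>) UNIV"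
    proof (rule has_sum_SigmaD[OF hs])
      show "((\<lambda>m. case (n, m) of (n, m) \<Rightarrow> exp (- pi * (real_of_int n)\<^sup>2 / (p / \<beta>)) * exp (- pi * (\<beta> * p) * (real_of_int m + q * n / p)\<^sup>2))
        has_sum exp (- pi * (real_of_int n)\<^sup>2 / (p / \<beta>)) * periodic_gaussian (\<beta> * p) (q * n / p)) UNIV" for n
        unfolding prod.case by (rule has_sum_cmult_right[OF has_sum_periodic_gaussian]) (use p \<beta> in simp)
    qed
    then show ?thesis by (simp add: has_sum_iff)
  qed
  define u where "u = (\<lambda>n::int. exp (- pi * (real_of_int n)\<^sup>2 / (p / \<alpha>)))"
  define v where "v = (\<lambda>j::int. exp (- pi * (real_of_int j)\<^sup>2 / (\<alpha> * p)))"
  have pa: "\<alpha> * p > 0" "p / \<alpha> > 0" using p \<alpha> by auto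
  have us: "u summable_on UNIV" and vs: "v summable_on UNIV"
    unfolding u_def v_def using summable_on_int_gaussian_inverse[OF pa(1)] summable_on_int_gaussian_inverse[OF pa(2)] by auto
  have swap: "(\<Sum>\<^sub>\<infinity>n::int. \<Sum>\<^sub>\<infinity>j::int. u n * (v j * cos (2 * pi * real_of_int j * (q * n / p))))
    = (\<Sum>\<^sub>\<infinity>j::int. \<Sum>\<^sub>\<infinity>n::int. u n * (v j * cos (2 * pi * real_of_int j * (q * n / p))))"
  proof (rule infsum_swap_banach)
    have "(\<lambda>(n, j). u n * v j) summable_on UNIV \<times> UNIV"
      using has_sum_product[OF has_sum_infsum[OF us] has_sum_infsum[OF vs]] by (auto simp: u_def v_def intro: has_sum_imp_summable)
    then have "(\<lambda>z. norm (case z of (n, j) \<Rightarrow> u n * (v j * cos (2 * pi * real_of_int j * (q * n / p))))) summable_on UNIV \<times> UNIV"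
    proof (rule summable_on_comparison_test)
      fix z :: "int \<times> int"
      obtain n j where z: "z = (n, j)" by force
      have "\<bar>u n * v j * cos (2 * pi * real_of_int j * (q * n / p))\<bar> \<le> u n * v j"
        by (rule abs_mult_cos_le) (simp add: u_def v_def)
      then show "norm (case z of (n, j) \<Rightarrow> u n * (v j * cos (2 * pi * real_of_int j * (q * n / p)))) \<le> (case z of (n, j) \<Rightarrow> u n * v j)"
        unfolding z prod.case real_norm_def by (simp only: mult.assoc)
    qed (rule norm_ge_zero)
    then show "(\<lambda>(n, j). u n * (v j * cos (2 * pi * real_of_int j * (q * n / p)))) summable_on UNIV \<times> UNIV"
      by (rule abs_summable_summable)
  qed
  have "form_theta p q r \<alpha> = (\<Sum>\<^sub>\<infinity>n::int. u n * (gaussian_series (\<alpha> * p) (q * n / p) / sqrt (\<alpha> * p)))"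
    unfolding rows[OF \<alpha>] u_def poisson_gaussian[OF pa(1)] ..
  also have "\<dots> = (\<Sum>\<^sub>\<infinity>n::int. (u n * gaussian_series (\<alpha> * p) (q * n / p)) * (1 / sqrt (\<alpha> * p)))"
    by simp
  also have "\<dots> = (\<Sum>\<^sub>\<infinity>n::int. u n * gaussian_series (\<alpha> * p) (q * n / p)) * (1 / sqrt (\<alpha> * p))"
    by (rule infsum_cmult_left')
  also have "(\<Sum>\<^sub>\<infinity>n::int. u n * gaussian_series (\<alpha> * p) (q * n / p)) = (\<Sum>\<^sub>\<infinity>n::int. \<Sum>\<^sub>\<infinity>j::int. u n * (v j * cos (2 * pi * real_of_int j * (q * n / p))))"
    unfolding gaussian_series_def v_def by (simp only: infsum_cmult_right')
  also have "\<dots> = (\<Sum>\<^sub>\<infinity>j::int. \<Sum>\<^sub>\<infinity>n::int. v j * (u n * cos (2 * pi * real_of_int n * (q * j / p))))"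
    unfolding swap by (intro infsum_cong) (simp add: mult_ac)
  also have "\<dots> = (\<Sum>\<^sub>\<infinity>j::int. v j * gaussian_series (p / \<alpha>) (q * j / p))"
    unfolding gaussian_series_def u_def by (simp only: infsum_cmult_right')
  also have "\<dots> = (\<Sum>\<^sub>\<infinity>j::int. (v j * periodic_gaussian (p / \<alpha>) (q * j / p)) * sqrt (p / \<alpha>))"
    unfolding poisson_gaussian[OF pa(2)] using p \<alpha> by simp
  also have "\<dots> = (\<Sum>\<^sub>\<infinity>j::int. v j * periodic_gaussian (p / \<alpha>) (q * j / p)) * sqrt (p / \<alpha>)"
    by (rule infsum_cmult_left')
  also have "(\<Sum>\<^sub>\<infinity>j::int. v j * periodic_gaussian (p / \<alpha>) (q * j / p)) = form_theta p q r (1 / \<alpha>)"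
    using rows[of "1 / \<alpha>"] \<alpha> by (simp add: v_def mult.commute)
  finally have "form_theta p q r \<alpha> = form_theta p q r (1 / \<alpha>) * (sqrt (p / \<alpha>) * (1 / sqrt (\<alpha> * p)))"
    by (simp only: mult.assoc)
  also have "sqrt (p / \<alpha>) * (1 / sqrt (\<alpha> * p)) = 1 / \<alpha>"
    using p \<alpha> by (simp add: real_sqrt_mult real_sqrt_divide field_simps)
  finally show ?thesis by simp
qed

text \<open>
  The form \<open>A m\<^sup>2 + B n\<^sup>2 + C (m - n)\<^sup>2\<close>; for nonnegative weights these are the forms of obtuse superbases in
  the sense of Selling.
\<close>

definition weight_theta :: "real \<Rightarrow> real \<Rightarrow> real \<Rightarrow> real \<Rightarrow> real" where
  "weight_theta A B C \<alpha> = form_theta (A + C) (- C) (B + C) \<alpha>"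

lemma has_sum_weight_theta:
  assumes "A \<ge> 0" "B \<ge> 0" "C \<ge> 0" "A * B + B * C + C * A = 1" "\<alpha> > 0"
  shows "((\<lambda>(m, n). exp (- (pi * \<alpha>) * (A * (real_of_int m)\<^sup>2 + B * (real_of_int n)\<^sup>2 + C * (real_of_int m - real_of_int n)\<^sup>2)))
    has_sum weight_theta A B C \<alpha>) UNIV"
proof -
  have det: "(A + C) * (B + C) = 1 + C\<^sup>2" using assms(4) by (simp add: power2_eq_square algebra_simps)
  then have "(A + C) * (B + C) > 0" by (simp add: add_pos_nonneg)
  then have pos: "A + C > 0" "B + C > 0" using assms by (auto simp: zero_less_mult_iff)
  have eq: "(A + C) * (real_of_int m)\<^sup>2 + 2 * - C * real_of_int m * real_of_int n + (B + C) * (real_of_int n)\<^sup>2 =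
    A * (real_of_int m)\<^sup>2 + B * (real_of_int n)\<^sup>2 + C * (real_of_int m - real_of_int n)\<^sup>2" for m n :: int
    by (simp add: power2_eq_square algebra_simps)
  show ?thesis
    using has_sum_form_theta[OF pos, of "- C" \<alpha>] assms(5) det unfolding eq weight_theta_def by simp
qed

lemma weight_theta_functional_equation:
  assumes "A \<ge> 0" "B \<ge> 0" "C \<ge> 0" "A * B + B * C + C * A = 1" "\<alpha> > 0"
  shows "weight_theta A B C \<alpha> = weight_theta A B C (1 / \<alpha>) / \<alpha>"
proof -
  have det: "(A + C) * (B + C) = 1 + C\<^sup>2" using assms(4) by (simp add: power2_eq_square algebra_simps)
  then have "(A + C) * (B + C) > 0" by (simp add: add_pos_nonneg)
  then have pos: "A + C > 0" "B + C > 0" using assms by (auto simp: zero_less_mult_iff)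
  show ?thesis unfolding weight_theta_def
    by (rule form_theta_functional_equation[OF pos(1) _ assms(5)]) (use det in simp)
qed


section \<open>The inequality for a triple of exponentials\<close>

text \<open>
  The right-hand side of the inequality touches the parabola at \<open>t = 0\<close> to first order and meets it again at
  \<open>t = -s\<close>. The inequality holds because \<open>(exp t - 1 - t) / t\<^sup>2\<close> is increasing.
\<close>

lemma exp_quadratic_below:
  fixes s t :: real
  assumes s: "s > 0" and t: "- s \<le> t"
  shows "1 + t + (exp (- s) - 1 + s) / s\<^sup>2 * t\<^sup>2 \<le> exp t"
proof -
  define h where "h = (\<lambda>x::real. (exp x - 1 - x) / x\<^sup>2)"
  define N where "N = (\<lambda>x::real. (x - 2) * exp x + x + 2)"
  have N_mono: "N x \<le> N y" if "x \<le> y" for x y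
  proof (rule DERIV_nonneg_imp_nondecreasing[OF that])
    fix x :: real
    have "(N has_real_derivative (x - 1) * exp x + 1) (at x)"
      unfolding N_def by (auto intro!: derivative_eq_intros simp: algebra_simps)
    moreover have "(x - 1) * exp x + 1 \<ge> 0"
    proof -
      have "1 - x \<le> exp (- x)" using exp_ge_add_one_self[of "- x"] by simp
      then have "(1 - x) * exp x \<le> exp (- x) * exp x" by (intro mult_right_mono) auto
      then show ?thesis by (simp add: exp_minus algebra_simps)
    qed
    ultimately show "\<exists>y. (N has_real_derivative y) (at x) \<and> 0 \<le> y" by blast
  qed
  have N0: "N 0 = 0" by (simp add: N_def)
  have hs: "h (- s) \<le> 1 / 2"
  proof -
    have "exp (- s) \<le> 1 - s + s\<^sup>2 / 2"
    proof -
      define g where "g = (\<lambda>x::real. exp (- x) - 1 + x - x\<^sup>2 / 2)"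
      have "g s \<le> g 0"
      proof (rule DERIV_nonpos_imp_nonincreasing[of 0 s g])
        show "0 \<le> s" using s by simp
        fix x :: real assume "0 \<le> x"
        have "(g has_real_derivative - exp (- x) + 1 - x) (at x)"
          unfolding g_def by (auto intro!: derivative_eq_intros)
        moreover have "- exp (- x) + 1 - x \<le> 0" using exp_ge_add_one_self[of "- x"] by simp
        ultimately show "\<exists>y. (g has_real_derivative y) (at x) \<and> y \<le> 0"
          by blast
      qed
      then show ?thesis by (simp add: g_def)
    qed
    then show ?thesis using s unfolding h_def by (simp add: field_simps)
  qed
  have key: "h (- s) * t\<^sup>2 \<le> exp t - 1 - t"
  proof (cases "t < 0")
    case True
    have "h (- s) \<le> h t"
    proof (rule DERIV_nonneg_imp_nondecreasing[OF t])
      fix x assume x: "- s \<le> x" "x \<le> t"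
      then have x0: "x < 0" using True by simp
      have "(h has_real_derivative ((exp x - 1) * x\<^sup>2 - (exp x - 1 - x) * (2 * x)) / (x\<^sup>2 * x\<^sup>2)) (at x)"
        unfolding h_def using x0 by (auto intro!: derivative_eq_intros)
      moreover have "((exp x - 1) * x\<^sup>2 - (exp x - 1 - x) * (2 * x)) = x * N x"
        by (simp add: N_def power2_eq_square algebra_simps)
      moreover have "x * N x \<ge> 0" using N_mono[of x 0] x0 N0 by (simp add: mult_nonpos_nonpos)
      ultimately show "\<exists>y. (h has_real_derivative y) (at x) \<and> 0 \<le> y" by fastforce
    qed
    then have "h (- s) * t\<^sup>2 \<le> h t * t\<^sup>2" by (intro mult_right_mono) auto
    then show ?thesis using True by (simp add: h_def)
  next
    case False
    then have "1 + t + t\<^sup>2 / 2 \<le> exp t" by (intro exp_lower_Taylor_quadratic) simp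
    moreover have "h (- s) * t\<^sup>2 \<le> 1 / 2 * t\<^sup>2" using hs by (intro mult_right_mono) auto
    ultimately show ?thesis by simp
  qed
  then show ?thesis by (simp add: h_def)
qed

text \<open>
  Apply the parabola bound at \<open>y - w/2\<close> with \<open>s = 3w/2\<close>: the sum of the three parabola values depends only
  on the sum and the sum of squares of the \<open>y\<close>. Equality holds for \<open>(-w, w/2, w/2)\<close>.
\<close>

lemma sum_three_exp_ge:
  fixes y\<^sub>1 y\<^sub>2 y\<^sub>3 w :: real
  assumes sum: "y\<^sub>1 + y\<^sub>2 + y\<^sub>3 = 0" and sq: "y\<^sub>1\<^sup>2 + y\<^sub>2\<^sup>2 + y\<^sub>3\<^sup>2 = 3 / 2 * w\<^sup>2" and w: "w > 0"
  shows "exp (- w) + 2 * exp (w / 2) \<le> exp y\<^sub>1 + exp y\<^sub>2 + exp y\<^sub>3"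
proof -
  define s where "s = 3 / 2 * w"
  have bound: "- w \<le> y" if "y + y' + y'' = 0" "y\<^sup>2 + y'\<^sup>2 + y''\<^sup>2 = 3 / 2 * w\<^sup>2" for y y' y''
  proof -
    have y'': "y'' = - y - y'" using that(1) by simp
    have "w\<^sup>2 - y\<^sup>2 = (y + 2 * y')\<^sup>2 / 3" using that(2) unfolding y''
      by (simp add: power2_eq_square algebra_simps)
    then have "y\<^sup>2 \<le> w\<^sup>2" by (smt (verit) divide_nonneg_pos zero_le_power2)
    then have "\<bar>y\<bar> \<le> w" using w by (simp add: abs_le_square_iff[symmetric])
    then show ?thesis by simp
  qed
  define c where "c = (exp (- s) - 1 + s) / s\<^sup>2"
  have s: "s > 0" using w by (simp add: s_def)
  have "- s \<le> y\<^sub>1 - w / 2" "- s \<le> y\<^sub>2 - w / 2" "- s \<le> y\<^sub>3 - w / 2"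
    using bound[of y\<^sub>1 y\<^sub>2 y\<^sub>3] bound[of y\<^sub>2 y\<^sub>3 y\<^sub>1] bound[of y\<^sub>3 y\<^sub>1 y\<^sub>2] sum sq by (simp_all add: s_def)
  note this[THEN exp_quadratic_below[OF s], folded c_def]
  moreover have "(y\<^sub>1 - w / 2)\<^sup>2 + (y\<^sub>2 - w / 2)\<^sup>2 + (y\<^sub>3 - w / 2)\<^sup>2 =
     (y\<^sub>1\<^sup>2 + y\<^sub>2\<^sup>2 + y\<^sub>3\<^sup>2) - w * (y\<^sub>1 + y\<^sub>2 + y\<^sub>3) + 3 * (w / 2)\<^sup>2"
    by (simp add: power2_eq_square algebra_simps)
  then have "(y\<^sub>1 - w / 2)\<^sup>2 + (y\<^sub>2 - w / 2)\<^sup>2 + (y\<^sub>3 - w / 2)\<^sup>2 = s\<^sup>2"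
    unfolding sum sq by (simp add: s_def power2_eq_square)
  then have "c * (y\<^sub>1 - w / 2)\<^sup>2 + c * (y\<^sub>2 - w / 2)\<^sup>2 + c * (y\<^sub>3 - w / 2)\<^sup>2 = c * s\<^sup>2"
    by (simp flip: distrib_left)
  moreover have "c * s\<^sup>2 = exp (- s) - 1 + s" using s by (simp add: c_def)
  ultimately have "2 + exp (- s) \<le> exp (y\<^sub>1 - w / 2) + exp (y\<^sub>2 - w / 2) + exp (y\<^sub>3 - w / 2)"
    using sum by (simp add: s_def)
  then have "exp (w / 2) * (2 + exp (- s)) \<le> exp (w / 2) * (exp (y\<^sub>1 - w / 2) + exp (y\<^sub>2 - w / 2) + exp (y\<^sub>3 - w / 2))"
    by (intro mult_left_mono) auto
  moreover have "w / 2 - s = - w" by (simp add: s_def)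
  ultimately show ?thesis by (simp add: distrib_left flip: exp_add)
qed

lemma exp_le_chord:
  fixes y a :: real
  assumes "0 \<le> a" "a \<le> 1"
  shows "exp (a * y) \<le> 1 + a * (exp y - 1)"
proof -
  have "convex_on UNIV (exp :: real \<Rightarrow> real)" by (rule exp_convex)
  from convex_onD[OF this, of a 0 y] assms show ?thesis by (simp add: algebra_simps)
qed

text \<open>
  With \<open>q = exp(X/2)\<close> the claim compares \<open>q\<close> to the power \<open>2\<theta>\<close> with \<open>1/q\<^sup>4 + 2 q\<^sup>2\<close>. For \<open>\<theta> \<le> 1/2\<close> the power
  is bounded by the chord between the exponents 0 and 1, otherwise by the chord between the exponents 1
  and 2; what remains is a polynomial inequality in \<open>q\<close>, and the lower bound on \<open>X\<close> keeps \<open>q\<close> away from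
  the range in which it fails.
\<close>

lemma exp_trade_off:
  fixes X \<theta> :: real
  assumes \<theta>: "0 < \<theta>" "\<theta> \<le> 0.583" and X: "X \<ge> 1.81 * \<theta>"
  shows "3 * exp (\<theta> * X) < exp (- 2 * X) + 2 * exp X"
proof -
  define q where "q = exp (X / 2)"
  have X0: "X > 0" using \<theta> X by auto
  have q2: "exp X = q\<^sup>2" and q4: "exp (- 2 * X) = 1 / q ^ 4"
    by (simp_all add: q_def exp_minus field_simps flip: exp_of_nat_mult exp_add)
  have q1: "q > 1" using X0 by (simp add: q_def)
  show ?thesis
  proof (cases "\<theta> \<le> 1 / 2")
    case True
    have "exp (2 * \<theta> * (X / 2)) \<le> 1 + 2 * \<theta> * (exp (X / 2) - 1)"
      by (rule exp_le_chord) (use True \<theta> in auto)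
    then have *: "exp (\<theta> * X) \<le> 1 + 2 * \<theta> * (q - 1)" by (simp add: q_def)
    have qX: "q \<ge> 1 + 0.905 * \<theta>" using exp_ge_add_one_self[of "X / 2"] X unfolding q_def[symmetric] by (simp add: field_simps)
    have main: "6 * \<theta> * q ^ 4 < (q + 1)\<^sup>2 * (q - 1) * (2 * q\<^sup>2 + 1)"
    proof (cases "q \<le> 1.45")
      case True
      have "6 * \<theta> \<le> (6 / 0.905) * (q - 1)" using qX by simp
      then have "6 * \<theta> * q ^ 4 \<le> (6 / 0.905) * (q - 1) * q ^ 4" using q1 by (intro mult_right_mono) auto
      also have "\<dots> < (q + 1)\<^sup>2 * (q - 1) * (2 * q\<^sup>2 + 1)"
      proof -
        have "(6 / 0.905) * q ^ 4 < (q + 1)\<^sup>2 * (2 * q\<^sup>2 + 1)"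
        proof -
          have a: "1.68 * q < q + 1" using True by simp
          then have "(1.68 * q)\<^sup>2 < (q+1)\<^sup>2" using q1 by (intro power_strict_mono) auto
          moreover have "q\<^sup>2 \<le> 1.45\<^sup>2" using True q1 by (intro power_mono) auto
          then have "2.47 * q\<^sup>2 \<le> 2 * q\<^sup>2 + 1" by (simp add: power2_eq_square)
          ultimately have "(1.68 * q)\<^sup>2 * (2.47 * q\<^sup>2) < (q + 1)\<^sup>2 * (2 * q\<^sup>2 + 1)"
            using q1 by (intro mult_less_le_imp_less) auto
          moreover have "(1.68 * q)\<^sup>2 * (2.47 * q\<^sup>2) = 1.68\<^sup>2 * 2.47 * q ^ 4"
            by (simp add: power2_eq_square power4_eq_xxxx)
          moreover have "(6 / 0.905) * q^4 \<le> 1.68\<^sup>2 * 2.47 * q ^ 4"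
            using q1 by (intro mult_right_mono) (auto simp: power2_eq_square)
          ultimately show ?thesis by linarith
        qed
        then have "(q - 1) * ((6 / 0.905) * q ^ 4) < (q - 1) * ((q + 1)\<^sup>2 * (2 * q\<^sup>2 + 1))"
          using q1 by (intro mult_strict_left_mono) auto
        then show ?thesis by (simp only: mult_ac)
      qed
      finally show ?thesis .
    next
      case False
      have "6 * \<theta> * q ^ 4 \<le> 3 * q ^ 4" using \<open>\<theta> \<le> 1/2\<close> by (intro mult_right_mono) auto
      also have "\<dots> < (q + 1)\<^sup>2 * (q - 1) * (2 * q\<^sup>2 + 1)"
      proof -
        have mono: "29 * x \<le> 20 * (q * x)" if "x > 0" for x
        proof -
          have "29 * x \<le> (20 * q) * x" using False that by (intro mult_right_mono) auto
          then show ?thesis by simp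
        qed
        have "29 * q ^ 4 \<le> 20 * q ^ 5" "29 * q ^ 3 \<le> 20 * q ^ 4" "29 * q ^ 2 \<le> 20 * q ^ 3" "29 * q \<le> 20 * q ^ 2"
          using mono[of "q ^ 4"] mono[of "q ^ 3"] mono[of "q ^ 2"] mono[of q] q1 by (simp_all add: eval_nat_numeral)
        moreover have "29 < 20 * q" using False by simp
        ultimately have "0 < 2 * q ^ 5 - q ^ 4 - q ^ 3 - q ^ 2 - q - 1"
          by linarith
        moreover have "(q + 1)\<^sup>2 * (q - 1) * (2 * q\<^sup>2 + 1) - 3 * q ^ 4 = 2 * q ^ 5 - q ^ 4 - q ^ 3 - q ^ 2 - q - 1"
          by (simp add: eval_nat_numeral algebra_simps)
        ultimately show ?thesis by simp
      qed
      finally show ?thesis .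
    qed
    have "(1 / q ^ 4 + 2 * q\<^sup>2 - 3 * (1 + 2 * \<theta> * (q - 1))) * q ^ 4 =
       (q - 1) * ((q + 1)\<^sup>2 * (q - 1) * (2 * q\<^sup>2 + 1) - 6 * \<theta> * q ^ 4)"
      using q1 by (simp add: field_simps power2_eq_square power4_eq_xxxx)
    also have "\<dots> > 0" using q1 main by (intro mult_pos_pos) auto
    finally have "1 / q ^ 4 + 2 * q\<^sup>2 - 3 * (1 + 2 * \<theta> * (q - 1)) > 0"
      using q1 by (simp add: zero_less_mult_iff)
    then have "3 * (1 + 2 * \<theta> * (q - 1)) < 1 / q ^ 4 + 2 * q\<^sup>2" by (simp only: diff_gt_0_iff_gt)
    with * have "3 * exp (\<theta> * X) < 1 / q ^ 4 + 2 * q\<^sup>2" by (smt (verit))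
    then show ?thesis unfolding q2 q4 .
  next
    case False
    define \<eta> where "\<eta> = 2 * \<theta> - 1"
    have \<eta>: "0 < \<eta>" "\<eta> \<le> 0.166" using False \<theta> by (auto simp: \<eta>_def)
    have "exp (\<eta> * (X / 2)) \<le> 1 + \<eta> * (q - 1)"
      unfolding q_def by (rule exp_le_chord) (use \<eta> in auto)
    then have "q * exp (\<eta> * (X / 2)) \<le> q * (1 + \<eta> * (q - 1))" using q1 by (intro mult_left_mono) auto
    moreover have "q * exp (\<eta> * (X / 2)) = exp (\<theta> * X)"
      unfolding q_def exp_add[symmetric] by (simp add: \<eta>_def field_simps)
    ultimately have *: "exp (\<theta> * X) \<le> q * (1 + \<eta> * (q - 1))" by simp
    have "1.57 \<le> (1 + 0.113125 + 0.113125\<^sup>2 / 2 :: real) ^ 4"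
      by (simp add: power2_eq_square power4_eq_xxxx)
    also have "\<dots> \<le> exp 0.113125 ^ 4"
      by (intro power_mono exp_lower_Taylor_quadratic) (auto simp: power2_eq_square)
    also have "\<dots> = exp (0.4525 :: real)" by (simp flip: exp_of_nat_mult)
    finally have e: "1.57 \<le> exp (0.4525 :: real)" .
    have "1.57 * (1 + 0.4525 * \<eta>) \<le> exp 0.4525 * exp (0.4525 * \<eta>)"
      by (intro mult_mono e exp_ge_add_one_self) (use \<eta> in auto)
    also have "\<dots> \<le> q" unfolding q_def exp_add[symmetric] using X by (simp add: \<eta>_def field_simps)
    finally have q\<eta>: "1.57 * (1 + 0.4525 * \<eta>) \<le> q" .
    have "0 < 1 / q ^ 4 + 2 * q\<^sup>2 - 3 * (q * (1 + \<eta> * (q - 1)))"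
    proof -
      have "\<exists>c. 0 < 1 / q ^ 4 + q * ((2 - 3 * c) * q - (3 - 3 * c)) \<and> \<eta> \<le> c"
      proof -
        have inv: "0 < 1 / q ^ 4" using q1 by simp
        \<comment> \<open>A constant \<open>c\<close> above \<open>\<eta>\<close> for each range of \<open>q\<close>: since \<open>q\<close> grows with \<open>\<eta>\<close>, a small \<open>q\<close> forces a small \<open>\<eta>\<close>.\<close>
        consider "q \<le> 1.62" | "1.62 \<le> q" "q \<le> 1.67" | "1.67 \<le> q" by linarith
        then show ?thesis
        proof cases
          case 1
          have "0 \<le> q * ((2 - 3 * 0.0704) * q - (3 - 3 * 0.0704))"
            using q\<eta> \<eta> q1 by (intro mult_nonneg_nonneg) auto
          then have "0 < 1 / q ^ 4 + q * ((2 - 3 * 0.0704) * q - (3 - 3 * 0.0704))" by (rule add_pos_nonneg[OF inv])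
          moreover have "\<eta> \<le> 0.0704" using q\<eta> 1 by simp
          ultimately show ?thesis by blast
        next
          case 2
          have "q ^ 4 \<le> 1.67 ^ 4" using 2 q1 by (intro power_mono) auto
          then have "1 / 1.67 ^ 4 \<le> 1 / q ^ 4" using q1 by (intro divide_left_mono) auto
          then have "1 / 10 < 1 / q ^ 4" by (simp add: power4_eq_xxxx)
          moreover have "- (6 / 100) \<le> q * ((2 - 3 * 0.141) * q - (3 - 3 * 0.141))"
          proof -
            have "- (6 / 100) \<le> q * (- 0.03)" using 2 by simp
            also have "\<dots> \<le> q * ((2 - 3 * 0.141) * q - (3 - 3 * 0.141))"
              using 2 q1 by (intro mult_left_mono) auto
            finally show ?thesis .
          qed
          ultimately have "0 < 1 / q ^ 4 + q * ((2 - 3 * 0.141) * q - (3 - 3 * 0.141))" by linarith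
          moreover have "\<eta> \<le> 0.141" using q\<eta> 2 by simp
          ultimately show ?thesis by blast
        next
          case 3
          have "0 \<le> q * ((2 - 3 * 0.166) * q - (3 - 3 * 0.166))"
            using 3 q1 by (intro mult_nonneg_nonneg) auto
          then have "0 < 1 / q ^ 4 + q * ((2 - 3 * 0.166) * q - (3 - 3 * 0.166))" by (rule add_pos_nonneg[OF inv])
          then show ?thesis using \<eta> by blast
        qed
      qed
      then obtain c where c: "0 < 1 / q ^ 4 + q * ((2 - 3 * c) * q - (3 - 3 * c))" "\<eta> \<le> c" by blast
      have "\<eta> * (q * (q - 1)) \<le> c * (q * (q - 1))" using c q1 by (intro mult_right_mono) auto
      with c(1) show ?thesis by (simp add: power2_eq_square algebra_simps)
    qed
    then have "3 * (q * (1 + \<eta> * (q - 1))) < 1 / q ^ 4 + 2 * q\<^sup>2" by (simp only: diff_gt_0_iff_gt)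
    with * have "3 * exp (\<theta> * X) < 1 / q ^ 4 + 2 * q\<^sup>2" by (smt (verit))
    then show ?thesis unfolding q2 q4 .
  qed
qed

text \<open>
  For \<open>k = (m\<^sup>2, n\<^sup>2, (m - n)\<^sup>2)\<close> the two hypotheses on the \<open>k\<close> hold with \<open>K = 2 (m\<^sup>2 - m n + n\<^sup>2)\<close>. With
  \<open>\<sigma> = A + B + C\<close> they determine the mean \<open>\<sigma> K / 3\<close> of the three exponents and the sum of the squares of
  their deviations. In the notation of \<open>exp_trade_off\<close> the deviations have amplitude \<open>w = 2X\<close>, and
  \<open>\<theta> X\<close> is the excess of the mean over its value \<open>K / sqrt 3\<close> for equal weights, both after scaling by
  \<open>\<mu>\<close>. The bounds \<open>\<sigma> \<le> 2.053\<close> and \<open>\<mu> K \<ge> 2\<pi>\<close> give \<open>\<theta> \<le> 0.583\<close> and \<open>X \<ge> 1.81 \<theta>\<close>.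
\<close>

lemma orbit_sum_gt:
  fixes A B C k\<^sub>1 k\<^sub>2 k\<^sub>3 K \<mu> :: real
  assumes det: "A * B + B * C + C * A = 1"
    and lo: "sqrt 3 < A + B + C" and hi: "A + B + C \<le> 2.053"
    and K: "k\<^sub>1 + k\<^sub>2 + k\<^sub>3 = K" "k\<^sub>1\<^sup>2 + k\<^sub>2\<^sup>2 + k\<^sub>3\<^sup>2 = K\<^sup>2 / 2" "2 \<le> K"
    and \<mu>: "\<mu> \<ge> pi"
  shows "3 * exp (- \<mu> * (K / sqrt 3)) <
    exp (- \<mu> * (A * k\<^sub>1 + B * k\<^sub>2 + C * k\<^sub>3)) + exp (- \<mu> * (A * k\<^sub>2 + B * k\<^sub>3 + C * k\<^sub>1))
    + exp (- \<mu> * (A * k\<^sub>3 + B * k\<^sub>1 + C * k\<^sub>2))"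
proof -
  define \<sigma> r where "\<sigma> = A + B + C" and "r = sqrt 3"
  define a b where "a = sqrt (\<sigma> - r)" and "b = sqrt (\<sigma> + r)"
  have r: "r\<^sup>2 = 3" "1.732 \<le> r" "r > 0"
    using real_le_rsqrt[of "1.732" 3] by (auto simp: r_def power2_eq_square)
  have ab: "a > 0" "b > 0" "a\<^sup>2 = \<sigma> - r" "b\<^sup>2 = \<sigma> + r"
    using lo r by (auto simp: a_def b_def \<sigma>_def r_def)
  have pi: "pi \<ge> 3.14" using pi_approx by simp
  define \<theta> w where "\<theta> = 2 * a / b" and "w = \<mu> * K * a * b / 3"
  have \<mu>0: "\<mu> > 0" using \<mu> pi by simp
  have w0: "w > 0" using ab \<mu>0 K by (simp add: w_def)
  have \<theta>w: "\<theta> * (w / 2) = \<mu> * K * (\<sigma> - r) / 3"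
    using ab by (simp add: \<theta>_def w_def power2_eq_square flip: ab(3))
  have "(\<theta>)\<^sup>2 \<le> 0.583\<^sup>2"
  proof -
    have "\<theta>\<^sup>2 = 4 * (\<sigma> - r) / (\<sigma> + r)" using ab by (simp add: \<theta>_def power_divide power_mult_distrib)
    also have "\<dots> \<le> 0.583\<^sup>2" using hi lo r unfolding \<sigma>_def[symmetric] r_def[symmetric]
      by (simp add: divide_simps power2_eq_square)
    finally show ?thesis .
  qed
  then have \<theta>: "0 < \<theta>" "\<theta> \<le> 0.583"
    using ab power2_le_imp_le[of \<theta> "0.583"] by (auto simp: \<theta>_def)
  have X: "1.81 * \<theta> \<le> w / 2"
  proof -
    have "3.14 * 2 * (2 * 1.732) \<le> \<mu> * K * b\<^sup>2"
      using \<mu> pi K r lo unfolding ab \<sigma>_def r_def by (intro mult_mono) auto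
    then have "a * (1.81 * 12) \<le> a * (\<mu> * K * b\<^sup>2)" using ab by (intro mult_left_mono) auto
    then show ?thesis using ab by (simp add: \<theta>_def w_def divide_simps power2_eq_square mult_ac)
  qed
  note trade = exp_trade_off[OF \<theta> X]
  define x\<^sub>1 x\<^sub>2 x\<^sub>3 where "x\<^sub>1 = A * k\<^sub>1 + B * k\<^sub>2 + C * k\<^sub>3" and "x\<^sub>2 = A * k\<^sub>2 + B * k\<^sub>3 + C * k\<^sub>1"
    and "x\<^sub>3 = A * k\<^sub>3 + B * k\<^sub>1 + C * k\<^sub>2"
  define m where "m = \<sigma> * K / 3"
  have sx: "x\<^sub>1 + x\<^sub>2 + x\<^sub>3 = \<sigma> * K"
    unfolding x\<^sub>1_def x\<^sub>2_def x\<^sub>3_def \<sigma>_def K(1)[symmetric] by (simp add: algebra_simps)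
  have kk: "2 * (k\<^sub>1 * k\<^sub>2 + k\<^sub>2 * k\<^sub>3 + k\<^sub>3 * k\<^sub>1) = K\<^sup>2 / 2"
    using K(2) unfolding K(1)[symmetric] by (simp add: power2_eq_square algebra_simps)
  have AA: "A\<^sup>2 + B\<^sup>2 + C\<^sup>2 = \<sigma>\<^sup>2 - 2"
    using det by (simp add: \<sigma>_def power2_eq_square algebra_simps)
  have "x\<^sub>1\<^sup>2 + x\<^sub>2\<^sup>2 + x\<^sub>3\<^sup>2 = (A\<^sup>2 + B\<^sup>2 + C\<^sup>2) * (k\<^sub>1\<^sup>2 + k\<^sub>2\<^sup>2 + k\<^sub>3\<^sup>2)
     + (A * B + B * C + C * A) * (2 * (k\<^sub>1 * k\<^sub>2 + k\<^sub>2 * k\<^sub>3 + k\<^sub>3 * k\<^sub>1))"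
    unfolding x\<^sub>1_def x\<^sub>2_def x\<^sub>3_def by (simp add: power2_eq_square algebra_simps)
  also have "\<dots> = (\<sigma>\<^sup>2 - 1) * K\<^sup>2 / 2"
    unfolding AA K(2) det kk by (simp add: field_simps)
  finally have sx2: "x\<^sub>1\<^sup>2 + x\<^sub>2\<^sup>2 + x\<^sub>3\<^sup>2 = (\<sigma>\<^sup>2 - 1) * K\<^sup>2 / 2" .
  define y\<^sub>1 y\<^sub>2 y\<^sub>3 where "y\<^sub>1 = \<mu> * (m - x\<^sub>1)" and "y\<^sub>2 = \<mu> * (m - x\<^sub>2)" and "y\<^sub>3 = \<mu> * (m - x\<^sub>3)"
  have s1: "y\<^sub>1 + y\<^sub>2 + y\<^sub>3 = 0"
  proof -
    have "y\<^sub>1 + y\<^sub>2 + y\<^sub>3 = \<mu> * (3 * m - (x\<^sub>1 + x\<^sub>2 + x\<^sub>3))"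
      by (simp add: y\<^sub>1_def y\<^sub>2_def y\<^sub>3_def algebra_simps)
    then show ?thesis unfolding sx by (simp add: m_def)
  qed
  have s2: "y\<^sub>1\<^sup>2 + y\<^sub>2\<^sup>2 + y\<^sub>3\<^sup>2 = 3 / 2 * w\<^sup>2"
  proof -
    have "y\<^sub>1\<^sup>2 + y\<^sub>2\<^sup>2 + y\<^sub>3\<^sup>2 = \<mu>\<^sup>2 * (3 * m\<^sup>2 - 2 * m * (x\<^sub>1 + x\<^sub>2 + x\<^sub>3) + (x\<^sub>1\<^sup>2 + x\<^sub>2\<^sup>2 + x\<^sub>3\<^sup>2))"
      by (simp add: y\<^sub>1_def y\<^sub>2_def y\<^sub>3_def power2_eq_square algebra_simps)
    also have "\<dots> = \<mu>\<^sup>2 * K\<^sup>2 * (\<sigma>\<^sup>2 - 3) / 6"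
      unfolding sx sx2 by (simp add: m_def power2_eq_square field_simps)
    also have "\<sigma>\<^sup>2 - 3 = a\<^sup>2 * b\<^sup>2" unfolding ab r(1)[symmetric] by (simp add: power2_eq_square algebra_simps)
    finally show ?thesis by (simp add: w_def power2_eq_square)
  qed
  have "3 * exp (\<theta> * (w / 2)) < exp y\<^sub>1 + exp y\<^sub>2 + exp y\<^sub>3"
    using trade sum_three_exp_ge[OF s1 s2 w0] by simp
  then have "exp (- \<mu> * m) * (3 * exp (\<theta> * (w / 2))) < exp (- \<mu> * m) * (exp y\<^sub>1 + exp y\<^sub>2 + exp y\<^sub>3)"
    by (intro mult_strict_left_mono) auto
  moreover have "- \<mu> * m + \<theta> * (w / 2) = - \<mu> * (K / sqrt 3)"
  proof -
    have "K / r = r * K / 3" using r by (simp add: field_simps power2_eq_square)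
    then have "- \<mu> * (K / r) = - \<mu> * (r * K / 3)" by (simp only:)
    also have "\<dots> = - \<mu> * m + \<mu> * K * (\<sigma> - r) / 3" by (simp add: m_def field_simps)
    finally show ?thesis unfolding \<theta>w r_def[symmetric] by (rule sym)
  qed
  then have "exp (- \<mu> * m) * (3 * exp (\<theta> * (w / 2))) = 3 * exp (- \<mu> * (K / sqrt 3))"
    by (simp flip: exp_add)
  moreover have "- \<mu> * m + y\<^sub>1 = - \<mu> * x\<^sub>1" "- \<mu> * m + y\<^sub>2 = - \<mu> * x\<^sub>2" "- \<mu> * m + y\<^sub>3 = - \<mu> * x\<^sub>3"
    by (simp_all add: y\<^sub>1_def y\<^sub>2_def y\<^sub>3_def algebra_simps)
  then have "exp (- \<mu> * m) * (exp y\<^sub>1 + exp y\<^sub>2 + exp y\<^sub>3) = exp (- \<mu> * x\<^sub>1) + exp (- \<mu> * x\<^sub>2) + exp (- \<mu> * x\<^sub>3)"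
    by (simp add: distrib_left flip: exp_add)
  ultimately have "3 * exp (- \<mu> * (K / sqrt 3)) < exp (- \<mu> * x\<^sub>1) + exp (- \<mu> * x\<^sub>2) + exp (- \<mu> * x\<^sub>3)"
    by (simp only:)
  then show ?thesis unfolding x\<^sub>1_def x\<^sub>2_def x\<^sub>3_def .
qed

lemma weight_sum_ge:
  fixes A B C :: real
  assumes "A \<ge> 0" "B \<ge> 0" "C \<ge> 0" and det: "A * B + B * C + C * A = 1"
  shows "sqrt 3 \<le> A + B + C"
    and "A + B + C = sqrt 3 \<Longrightarrow> A = B \<and> B = C"
proof -
  have *: "(A + B + C)\<^sup>2 = 3 + ((A - B)\<^sup>2 + (B - C)\<^sup>2 + (C - A)\<^sup>2) / 2"
    using det by (simp add: power2_eq_square field_simps)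
  show "sqrt 3 \<le> A + B + C" using assms by (intro real_le_lsqrt) (auto simp: *)
  assume "A + B + C = sqrt 3"
  then have "(A + B + C)\<^sup>2 = 3" by simp
  with * have "(A - B)\<^sup>2 + (B - C)\<^sup>2 + (C - A)\<^sup>2 = 0" by simp
  then have "(A - B)\<^sup>2 = 0 \<and> (B - C)\<^sup>2 = 0"
    by (smt (verit) zero_le_power2)
  then show "A = B \<and> B = C" by simp
qed

text \<open>
  For \<open>A \<ge> B \<ge> C\<close> and \<open>s = B + C\<close> the constraint gives \<open>A \<le> 1/s\<close> and \<open>s\<^sup>2 \<le> 4/3\<close>, so the sum is at most
  \<open>s + 1/s\<close> with \<open>s\<close> between 0.795 and 1.2. The threshold 0.795 is a compromise: this bound must stay
  below the range of \<open>orbit_sum_gt\<close>, and the remaining lattices must have a vector that is short enough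
  for \<open>hex_theta_less_cusp\<close>.
\<close>

lemma weight_sum_le:
  fixes A B C :: real
  assumes "A \<ge> 0" "B \<ge> 0" "C \<ge> 0" and det: "A * B + B * C + C * A = 1"
    and pairs: "A + B \<ge> 0.795" "B + C \<ge> 0.795" "C + A \<ge> 0.795"
  shows "A + B + C \<le> 2.053"
proof -
  have *: "A + B + C \<le> 2.053"
    if "A \<ge> B" "B \<ge> C" "C \<ge> 0" "A * B + B * C + C * A = 1" "B + C \<ge> 0.795" for A B C :: real
  proof -
    define s where "s = B + C"
    have s: "s \<ge> 0.795" using that by (simp add: s_def)
    have "0 \<le> B * C" using that by simp
    then have As: "A * s \<le> 1" using that(4) unfolding s_def by (simp add: algebra_simps)
    have "s\<^sup>2 \<le> 4 / 3"
    proof -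
      have "0 \<le> (A - B) * s" using that by (simp add: s_def)
      moreover have "0 \<le> (B - C) * (B + 3 * C)" using that by simp
      ultimately have "0 \<le> (A - B) * s + (B - C) * (B + 3 * C) / 4" by simp
      also have "\<dots> = (A * B + B * C + C * A) - 3 / 4 * s\<^sup>2"
        by (simp add: s_def power2_eq_square field_simps)
      finally show ?thesis using that by simp
    qed
    then have s': "s \<le> 6 / 5" by (intro power2_le_imp_le[of s "6 / 5"]) (auto simp: power2_eq_square)
    have "(s - 159 / 200) * (s - 6 / 5) \<le> 0" using s s' by (intro mult_nonneg_nonpos) auto
    moreover have "(s - 159 / 200) * (s - 6 / 5) = s * s - 399 / 200 * s + 477 / 500"
      by (simp add: field_simps)
    moreover have "159 / 200 \<le> s" using s by simp
    ultimately have "s * s + 1 \<le> 2053 / 1000 * s" by linarith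
    then have "(A + s) * s \<le> 2.053 * s" using As unfolding distrib_right by simp
    then have "A + s \<le> 2.053" by (rule mult_right_le_imp_le) (use s in simp)
    then show ?thesis by (simp add: s_def)
  qed
  show ?thesis
    using *[of A B C] *[of A C B] *[of B A C] *[of B C A] *[of C A B] *[of C B A] assms
    by (smt (verit) mult.commute)
qed

section \<open>Minimality of the hexagonal form\<close>

abbreviation hex_weight :: real where "hex_weight \<equiv> 1 / sqrt 3"

lemma has_sum_hex_theta:
  assumes "\<alpha> > 0"
  shows "((\<lambda>(m, n). exp (- (pi * \<alpha>) * (((real_of_int m)\<^sup>2 + (real_of_int n)\<^sup>2 + (real_of_int m - real_of_int n)\<^sup>2) / sqrt 3)))
    has_sum weight_theta hex_weight hex_weight hex_weight \<alpha>) UNIV"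
  using has_sum_weight_theta[of hex_weight hex_weight hex_weight, OF _ _ _ _ assms]
  by (simp add: add_divide_distrib)

lemma int_form_ge_1:
  fixes m n :: int
  assumes "(m, n) \<noteq> (0, 0)"
  shows "1 \<le> m\<^sup>2 - m * n + n\<^sup>2"
proof -
  have "4 * (m\<^sup>2 - m * n + n\<^sup>2) = (2 * m - n)\<^sup>2 + 3 * n\<^sup>2" by (simp add: power2_eq_square algebra_simps)
  moreover have "(2 * m - n)\<^sup>2 + 3 * n\<^sup>2 > 0"
  proof (cases "n = 0")
    case True
    then show ?thesis using assms by simp
  next
    case False
    then show ?thesis by (intro add_nonneg_pos) auto
  qed
  ultimately have "0 < 4 * (m\<^sup>2 - m * n + n\<^sup>2)" by (simp only:)
  then have "0 < m\<^sup>2 - m * n + n\<^sup>2" by (simp only: zero_less_mult_iff) auto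
  then show ?thesis by (simp only: int_one_le_iff_zero_less)
qed

text \<open>
  The map \<open>(m, n) \<mapsto> (n, n - m)\<close> permutes the three squares cyclically. So three times the theta function is
  the sum over all \<open>(m, n)\<close> of the orbit sums, which are compared term by term.
\<close>

lemma weight_theta_gt_hex_compact:
  assumes nn: "A \<ge> 0" "B \<ge> 0" "C \<ge> 0" and det: "A * B + B * C + C * A = 1" and \<alpha>: "\<alpha> \<ge> 1"
    and lo: "sqrt 3 < A + B + C" and hi: "A + B + C \<le> 2.053"
  shows "weight_theta hex_weight hex_weight hex_weight \<alpha> < weight_theta A B C \<alpha>"
proof -
  define \<mu> where "\<mu> = pi * \<alpha>"
  have \<mu>: "\<mu> \<ge> pi" using \<alpha> by (simp add: \<mu>_def)
  define E where "E = (\<lambda>x y z :: real. exp (- \<mu> * (A * x + B * y + C * z)))"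
  define k1 k2 k3 :: "int \<times> int \<Rightarrow> real" where "k1 = (\<lambda>(m, n). (real_of_int m)\<^sup>2)" and "k2 = (\<lambda>(m, n). (real_of_int n)\<^sup>2)"
    and "k3 = (\<lambda>(m, n). (real_of_int m - real_of_int n)\<^sup>2)"
  have h1: "((\<lambda>v. E (k1 v) (k2 v) (k3 v)) has_sum weight_theta A B C \<alpha>) UNIV"
    using has_sum_weight_theta[OF nn det, of \<alpha>] \<alpha> by (simp add: E_def \<mu>_def k1_def k2_def k3_def case_prod_unfold)
  have h2: "((\<lambda>v. E (k2 v) (k3 v) (k1 v)) has_sum weight_theta A B C \<alpha>) UNIV"
    by (rule has_sum_reindex_bij_witness[THEN iffD2, OF _ _ _ _ _ _ h1, of _ "\<lambda>(m, n). (m - n, m)" "\<lambda>(m, n). (n, n - m)"])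
      (auto simp: k1_def k2_def k3_def power2_commute)
  have h3: "((\<lambda>v. E (k3 v) (k1 v) (k2 v)) has_sum weight_theta A B C \<alpha>) UNIV"
    by (rule has_sum_reindex_bij_witness[THEN iffD2, OF _ _ _ _ _ _ h2, of _ "\<lambda>(m, n). (m - n, m)" "\<lambda>(m, n). (n, n - m)"])
      (auto simp: k1_def k2_def k3_def power2_commute)
  define S where "S = (\<lambda>v. E (k1 v) (k2 v) (k3 v) + E (k2 v) (k3 v) (k1 v) + E (k3 v) (k1 v) (k2 v))"
  have hS: "(S has_sum (weight_theta A B C \<alpha> + weight_theta A B C \<alpha> + weight_theta A B C \<alpha>)) UNIV"
    unfolding S_def by (intro has_sum_add h1 h2 h3)
  define H where "H = (\<lambda>v. 3 * exp (- \<mu> * ((k1 v + k2 v + k3 v) / sqrt 3)))"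
  have hH: "(H has_sum (3 * weight_theta hex_weight hex_weight hex_weight \<alpha>)) UNIV"
    unfolding H_def
    by (rule has_sum_cmult_right) (use has_sum_hex_theta[of \<alpha>] \<alpha> in \<open>simp add: \<mu>_def k1_def k2_def k3_def case_prod_unfold\<close>)
  have gt: "H v < S v" if "v \<noteq> (0, 0)" for v
  proof -
    obtain m n where v: "v = (m, n)" by force
    have N: "1 \<le> m\<^sup>2 - m * n + n\<^sup>2" using int_form_ge_1 that v by blast
    have K: "k1 v + k2 v + k3 v = 2 * real_of_int (m\<^sup>2 - m * n + n\<^sup>2)"
      unfolding v k1_def k2_def k3_def by (simp add: power2_eq_square algebra_simps)
    have "(1::real) \<le> real_of_int (m\<^sup>2 - m * n + n\<^sup>2)" using N by (metis of_int_1 of_int_le_iff)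
    then have "2 \<le> k1 v + k2 v + k3 v" unfolding K by simp
    moreover have "(k1 v)\<^sup>2 + (k2 v)\<^sup>2 + (k3 v)\<^sup>2 = (k1 v + k2 v + k3 v)\<^sup>2 / 2"
      unfolding v k1_def k2_def k3_def by (simp add: power2_eq_square field_simps)
    ultimately show ?thesis
      unfolding H_def S_def E_def by (intro orbit_sum_gt[OF det lo hi refl _ _ \<mu>])
  qed
  have "3 * weight_theta hex_weight hex_weight hex_weight \<alpha> < weight_theta A B C \<alpha> + weight_theta A B C \<alpha> + weight_theta A B C \<alpha>"
  proof (rule has_sum_strict_mono[OF hH hS])
    show "H v \<le> S v" for v
    proof (cases "v = (0, 0)")
      case True
      then show ?thesis by (simp add: H_def S_def E_def k1_def k2_def k3_def)
    qed (use gt in \<open>simp add: less_imp_le\<close>)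
    show "H (1, 0) < S (1, 0)" by (rule gt) simp
  qed simp
  then show ?thesis by simp
qed

lemma exp_ge_power:
  fixes x :: real
  assumes "0 \<le> x" "n > 0"
  shows "(1 + x / n + (x / n)\<^sup>2 / 2) ^ n \<le> exp x"
proof -
  have "(1 + x / n + (x / n)\<^sup>2 / 2) ^ n \<le> exp (x / n) ^ n"
    using assms by (intro power_mono exp_lower_Taylor_quadratic add_nonneg_nonneg) auto
  also have "\<dots> = exp x" using assms by (simp flip: exp_of_nat_mult)
  finally show ?thesis .
qed

text \<open>
  By \<open>k\<^sup>2 \<ge> 2k - 1\<close> both halves of the sum are dominated by a geometric series with ratio \<open>1/e\<close>.
\<close>

lemma int_gaussian_half_le_3: "(\<Sum>\<^sub>\<infinity>n::int. exp (- (1 / 2) * (real_of_int n)\<^sup>2)) \<le> 3"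
proof -
  define f where "f = (\<lambda>n::int. exp (- (1 / 2) * (real_of_int n)\<^sup>2))"
  define q where "q = exp (-1 :: real)"
  have e: "exp 1 \<ge> (2.7 :: real)"
    using exp_ge_power[of 1 8] by (simp add: eval_nat_numeral)
  have q: "0 < q" "q \<le> 10 / 27" using e by (auto simp: q_def exp_minus field_simps)
  have fs: "f summable_on A" for A
    using summable_on_int_gaussian[of "1 / 2" 0] by (intro summable_on_subset[of f UNIV A]) (auto simp: f_def)
  have half: "infsum f (g ` UNIV) \<le> exp (1 / 2) * (q / (1 - q))"
    if g: "inj g" "\<And>k::nat. \<bar>g k\<bar> = int (Suc k)" for g :: "nat \<Rightarrow> int"
  proof -
    have gs: "((\<lambda>k. q ^ Suc k) has_sum (q / (1 - q))) UNIV"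
    proof -
      have "(\<lambda>k. q * q ^ k) sums (q * (1 / (1 - q)))" using q by (intro sums_mult geometric_sums) auto
      then show ?thesis using q by (intro sums_nonneg_imp_has_sum) auto
    qed
    have "infsum f (g ` UNIV) = infsum (f \<circ> g) UNIV" using g(1) by (rule infsum_reindex)
    also have "\<dots> \<le> exp (1 / 2) * (q / (1 - q))"
    proof (rule has_sum_mono[OF has_sum_infsum has_sum_cmult_right[OF gs]])
      show "(f \<circ> g) summable_on UNIV" using fs[of "g ` UNIV"] g(1) by (simp add: summable_on_reindex)
      fix k
      have "(real_of_int (g k))\<^sup>2 = (real (Suc k))\<^sup>2"
        using g(2)[of k] by (metis of_int_abs of_int_of_nat_eq power2_abs)
      moreover have "2 * real (Suc k) - 1 \<le> (real (Suc k))\<^sup>2"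
        by (simp add: power2_eq_square algebra_simps)
      ultimately have "- (1 / 2) * (real_of_int (g k))\<^sup>2 \<le> 1 / 2 + real (Suc k) * (- 1)" by simp
      then have "f (g k) \<le> exp (1 / 2 + real (Suc k) * (- 1))" unfolding f_def exp_le_cancel_iff .
      also have "\<dots> = exp (1 / 2) * q ^ Suc k" unfolding q_def exp_add exp_of_nat_mult ..
      finally show "(f \<circ> g) k \<le> exp (1 / 2) * q ^ Suc k" by simp
    qed
    finally show ?thesis .
  qed
  have U: "UNIV = insert 0 (range (\<lambda>k. int (Suc k)) \<union> range (\<lambda>k. - int (Suc k)))"
  proof -
    have "x \<in> insert 0 (range (\<lambda>k. int (Suc k)) \<union> range (\<lambda>k. - int (Suc k)))" for x
      by (cases x rule: int_cases3) (auto simp: image_iff gr0_conv_Suc)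
    then show ?thesis by blast
  qed
  have "infsum f UNIV = f 0 + (infsum f (range (\<lambda>k. int (Suc k))) + infsum f (range (\<lambda>k. - int (Suc k))))"
    by (subst U, subst infsum_insert, use fs in simp, force, subst infsum_Un_disjoint) (use fs in auto)
  also have "\<dots> \<le> 1 + (exp (1 / 2) * (q / (1 - q)) + exp (1 / 2) * (q / (1 - q)))"
    by (intro add_mono half) (auto simp: f_def inj_def)
  also have "\<dots> \<le> 3"
  proof -
    have "exp (1 / 2) \<le> (1.7 :: real)"
    proof -
      have "(exp (1 / 2 :: real))\<^sup>2 = exp 1" by (simp flip: exp_of_nat_mult)
      also have "\<dots> \<le> (1.7)\<^sup>2" using e_less_272 by (simp add: power2_eq_square)
      finally show ?thesis by (rule power2_le_imp_le) simp
    qed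
    moreover have "q / (1 - q) \<le> 10 / 17" using q by (simp add: divide_simps)
    ultimately have "exp (1 / 2) * (q / (1 - q)) \<le> 1.7 * (10 / 17)" using q by (intro mult_mono) auto
    also have "1.7 * (10 / 17) = (1 :: real)" by simp
    finally show ?thesis by linarith
  qed
  finally show ?thesis by (simp add: f_def)
qed


definition int_form :: "int \<times> int \<Rightarrow> int" where
  "int_form = (\<lambda>(m, n). m\<^sup>2 - m * n + n\<^sup>2)"

text \<open>
  The six shortest nonzero vectors of the triangular lattice, in coordinates.
\<close>

definition hex_shell :: "(int \<times> int) set" where
  "hex_shell = {(1, 0), (-1, 0), (0, 1), (0, -1), (1, 1), (-1, -1)}"

lemma int_form_ge_3:
  assumes "v \<noteq> (0, 0)" "v \<notin> hex_shell"
  shows "3 \<le> int_form v"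
proof (rule ccontr)
  assume "\<not> 3 \<le> int_form v"
  then have le: "int_form v \<le> 2" by simp
  obtain m n where v: "v = (m, n)" by force
  have a: "4 * int_form v = (2 * m - n)\<^sup>2 + 3 * n\<^sup>2" and b: "4 * int_form v = (2 * n - m)\<^sup>2 + 3 * m\<^sup>2"
    unfolding v int_form_def by (simp_all add: power2_eq_square algebra_simps)
  have "n\<^sup>2 < 4" using a le zero_le_power2[of "2 * m - n"] by linarith
  moreover have "m\<^sup>2 < 4" using b le zero_le_power2[of "2 * n - m"] by linarith
  ultimately have "\<bar>n\<bar>\<^sup>2 < 2\<^sup>2" "\<bar>m\<bar>\<^sup>2 < 2\<^sup>2" by simp_all
  then have "\<bar>n\<bar> < 2" "\<bar>m\<bar> < 2" by (meson power2_less_imp_less zero_le_numeral)+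
  then have "n \<in> {-1, 0, 1}" "m \<in> {-1, 0, 1}" by auto
  then show False using assms le unfolding v by (auto simp: int_form_def hex_shell_def)
qed

text \<open>
  After division by \<open>exp(-0.795 \<pi> \<alpha>)\<close> every nonzero term decreases in \<open>\<alpha>\<close>, so the worst case is \<open>\<alpha> = 1\<close>. There
  the six shortest vectors contribute at most 6/3.084, about 1.946, and all others at most
  \<open>0.0055 \<cdot> 9\<close>, about 0.05; together this is less than 2.
\<close>

lemma hex_theta_less_cusp:
  assumes \<alpha>: "\<alpha> \<ge> 1"
  shows "weight_theta hex_weight hex_weight hex_weight \<alpha> < 1 + 2 * exp (- (pi * \<alpha>) * 0.795)"
proof -
  define \<mu> where "\<mu> = pi * \<alpha>"
  have "3.1415 \<le> pi" using pi_approx by simp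
  then have \<mu>: "\<mu> \<ge> 3.1415" using \<alpha> mult_mono[of "3.1415" pi 1 \<alpha>] by (simp add: \<mu>_def)
  define w where "w = exp (- \<mu> * 0.795)"
  have w: "w > 0" by (simp add: w_def)
  have s3: "1.1547 \<le> 2 / sqrt 3"
  proof -
    have "sqrt 3 \<le> 1.73205081" by (rule real_le_lsqrt) (auto simp: power2_eq_square)
    then show ?thesis by (simp add: field_simps)
  qed
  define s :: real where "s = (\<Sum>\<^sub>\<infinity>n::int. exp (- (1 / 2) * (real_of_int n)\<^sup>2))"
  have s: "((\<lambda>n::int. exp (- (1 / 2) * (real_of_int n)\<^sup>2)) has_sum s) UNIV"
    unfolding s_def using summable_on_int_gaussian[of "1 / 2" 0] by (intro has_sum_infsum) simp
  have s_le: "0 \<le> s" "s \<le> 3"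
    using int_gaussian_half_le_3 by (auto simp: s_def intro!: infsum_nonneg)
  define G where "G = (\<lambda>(m::int, n::int). exp (- (1 / 2) * (real_of_int m)\<^sup>2) * exp (- (1 / 2) * (real_of_int n)\<^sup>2))"
  have G: "(G has_sum (s * s)) UNIV"
    unfolding G_def using has_sum_product[OF s s] by simp
  define F where "F = (\<lambda>v. exp (- \<mu> * (2 / sqrt 3 * real_of_int (int_form v))))"
  have F: "(F has_sum weight_theta hex_weight hex_weight hex_weight \<alpha>) UNIV"
  proof -
    have "((real_of_int m)\<^sup>2 + (real_of_int n)\<^sup>2 + (real_of_int m - real_of_int n)\<^sup>2) / sqrt 3 = 2 / sqrt 3 * real_of_int (int_form (m, n))" for m n
      by (simp add: int_form_def power2_eq_square field_simps)
    then show ?thesis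
      using has_sum_hex_theta[of \<alpha>] \<alpha> by (simp add: F_def \<mu>_def case_prod_unfold)
  qed
  \<comment> \<open>A pointwise majorant: exact at the origin, constant on the first shell, and Gaussian in all coordinates elsewhere.\<close>
  define U where "U = (\<lambda>v. (if v = (0, 0) then 1 else 0) + ((if v \<in> hex_shell then 1 / 3.084 * w else 0) + (0.0055 * w) * G v))"
  have sU: "(U has_sum (1 + (6 * (1 / 3.084 * w) + (0.0055 * w) * (s * s)))) UNIV"
    unfolding U_def
  proof (intro has_sum_add has_sum_cmult_right G)
    show "((\<lambda>v. if v = (0, 0) then 1 else 0) has_sum (1::real)) (UNIV :: (int \<times> int) set)"
      by (rule has_sum_finite_neutralI[of "{(0, 0)}"]) auto
    show "((\<lambda>v. if v \<in> hex_shell then 1 / 3.084 * w else 0) has_sum (6 * (1 / 3.084 * w))) UNIV"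
      by (rule has_sum_finite_neutralI[of hex_shell]) (auto simp: hex_shell_def)
  qed
  have "F v \<le> U v" for v
  proof -
    have G0: "0 \<le> (0.0055 * w) * G v" using w by (simp add: G_def case_prod_unfold)
    consider "v = (0, 0)" | "v \<in> hex_shell" | "v \<noteq> (0, 0)" "v \<notin> hex_shell" by blast
    then show ?thesis
    proof cases
      case 1
      then show ?thesis using G0 by (simp add: F_def U_def int_form_def hex_shell_def)
    next
      case 2
      have e: "3.084 \<le> exp (1.1299 :: real)"
        using exp_ge_power[of "1.1299" 8] by (simp add: eval_nat_numeral)
      have "3.1415 * (1.1547 - 0.795) \<le> \<mu> * (2 / sqrt 3 - 0.795)" using \<mu> s3 by (intro mult_mono) auto
      then have "- \<mu> * (2 / sqrt 3) \<le> - 1.1299 + - \<mu> * 0.795" by (simp add: right_diff_distrib)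
      then have "exp (- \<mu> * (2 / sqrt 3)) \<le> exp (- 1.1299) * w" unfolding w_def exp_add[symmetric] exp_le_cancel_iff .
      also have "exp (- 1.1299 :: real) \<le> 1 / 3.084" using e unfolding exp_minus by (simp add: divide_simps)
      finally have "exp (- \<mu> * (2 / sqrt 3)) \<le> 1 / 3.084 * w" using w by simp
      moreover have "int_form v = 1" using 2 by (auto simp: hex_shell_def int_form_def)
      moreover have "v \<noteq> (0, 0)" using 2 by (auto simp: hex_shell_def)
      ultimately show ?thesis using 2 G0 by (simp add: F_def U_def)
    next
      case 3
      obtain m n where v: "v = (m, n)" by force
      define N where "N = real_of_int (int_form v)"
      have N: "3 \<le> N" using int_form_ge_3[OF 3] unfolding N_def by simp
      have N2: "((real_of_int m)\<^sup>2 + (real_of_int n)\<^sup>2) / 2 \<le> N"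
        using zero_le_power2[of "real_of_int m - real_of_int n"] unfolding N_def v int_form_def
        by (simp add: power2_eq_square field_simps)
      have e: "1 / 0.0055 \<le> exp (5.3 :: real)"
        using exp_ge_power[of "5.3" 32] by (simp add: eval_nat_numeral)
      \<comment> \<open>For \<open>N \<ge> 3\<close> the offset 0.795 is at most \<open>0.265 N\<close>, which leaves \<open>exp(-5.3) exp(-N)\<close>.\<close>
      have "3.1415 * (1.1547 * N - 0.265 * N) \<le> \<mu> * (2 / sqrt 3 * N - 0.795)"
        using \<mu> s3 N by (intro mult_mono diff_mono mult_right_mono) auto
      then have "- \<mu> * (2 / sqrt 3 * N) \<le> - 5.3 + - \<mu> * 0.795 + - N" using N by (simp add: right_diff_distrib)
      also have "\<dots> \<le> - 5.3 + - \<mu> * 0.795 + (- (1 / 2) * (real_of_int m)\<^sup>2 + - (1 / 2) * (real_of_int n)\<^sup>2)"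
        using N2 by simp
      finally have "F v \<le> exp (- 5.3) * w * G v"
        unfolding F_def G_def w_def v prod.case exp_add[symmetric] exp_le_cancel_iff N_def v .
      also have "\<dots> \<le> 0.0055 * w * G v"
      proof -
        have "exp (- 5.3 :: real) \<le> 0.0055" using e unfolding exp_minus by (simp add: divide_simps)
        then show ?thesis using w by (intro mult_right_mono) (auto simp: G_def case_prod_unfold)
      qed
      finally show ?thesis using 3 by (simp add: U_def)
    qed
  qed
  then have "weight_theta hex_weight hex_weight hex_weight \<alpha> \<le> 1 + (6 * (1 / 3.084 * w) + (0.0055 * w) * (s * s))"
    by (intro has_sum_mono[OF F sU])
  also have "(0.0055 * w) * (s * s) \<le> (0.0055 * w) * (3 * 3)"
    using s_le w by (intro mult_left_mono mult_mono) auto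
  also have "1 + (6 * (1 / 3.084 * w) + (0.0055 * w) * (3 * 3)) < 1 + 2 * w" using w by simp
  finally show ?thesis by (simp add: w_def \<mu>_def)
qed

text \<open>
  The pairwise sums of the weights are the values of the form at \<open>(1, 1)\<close>, \<open>(0, 1)\<close> and \<open>(1, 0)\<close>.
\<close>

lemma weight_theta_gt_hex_cusp:
  assumes nn: "A \<ge> 0" "B \<ge> 0" "C \<ge> 0" and det: "A * B + B * C + C * A = 1" and \<alpha>: "\<alpha> \<ge> 1"
    and small: "A + B < 0.795 \<or> B + C < 0.795 \<or> C + A < 0.795"
  shows "weight_theta hex_weight hex_weight hex_weight \<alpha> < weight_theta A B C \<alpha>"
proof -
  define \<mu> where "\<mu> = pi * \<alpha>"
  have \<mu>: "\<mu> > 0" using \<alpha> by (simp add: \<mu>_def)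
  define E where "E = (\<lambda>(m::int, n::int). exp (- \<mu> * (A * (real_of_int m)\<^sup>2 + B * (real_of_int n)\<^sup>2 + C * (real_of_int m - real_of_int n)\<^sup>2)))"
  have E: "(E has_sum weight_theta A B C \<alpha>) UNIV"
    using has_sum_weight_theta[OF nn det, of \<alpha>] \<alpha> by (simp add: E_def \<mu>_def)
  have "\<exists>v. v \<noteq> (0, 0) \<and> exp (- \<mu> * 0.795) \<le> E v \<and> exp (- \<mu> * 0.795) \<le> E (- v)"
    using small
  proof (elim disjE)
    assume "A + B < 0.795" then show ?thesis using \<mu> by (intro exI[of _ "(1, 1)"]) (auto simp: E_def)
  next
    assume "B + C < 0.795" then show ?thesis using \<mu> by (intro exI[of _ "(0, 1)"]) (auto simp: E_def)
  next
    assume "C + A < 0.795" then show ?thesis using \<mu> by (intro exI[of _ "(1, 0)"]) (auto simp: E_def)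
  qed
  then obtain v where v: "v \<noteq> (0, 0)" "exp (- \<mu> * 0.795) \<le> E v" "exp (- \<mu> * 0.795) \<le> E (- v)" by blast
  have ne: "- v \<noteq> (0, 0)" "v \<noteq> - v" using v(1) by (cases v; auto)+
  have "sum E {(0, 0), v, - v} \<le> weight_theta A B C \<alpha>"
    by (rule finite_sum_le_has_sum[OF E]) (auto simp: E_def)
  moreover have "sum E {(0, 0), v, - v} = 1 + (E v + E (- v))"
    using v(1) ne by (simp add: E_def)
  ultimately show ?thesis using hex_theta_less_cusp[OF \<alpha>] v by (simp add: \<mu>_def)
qed

theorem weight_theta_hex_minimal:
  assumes nn: "A \<ge> 0" "B \<ge> 0" "C \<ge> 0" and det: "A * B + B * C + C * A = 1" and \<alpha>: "\<alpha> > 0"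
    and ne: "\<not> (A = B \<and> B = C)"
  shows "weight_theta hex_weight hex_weight hex_weight \<alpha> < weight_theta A B C \<alpha>"
proof -
  have ge1: "weight_theta hex_weight hex_weight hex_weight \<beta> < weight_theta A B C \<beta>" if \<beta>: "\<beta> \<ge> 1" for \<beta>
  proof (cases "A + B < 0.795 \<or> B + C < 0.795 \<or> C + A < 0.795")
    case True
    then show ?thesis by (rule weight_theta_gt_hex_cusp[OF nn det \<beta>])
  next
    case False
    then have "A + B + C \<le> 2.053" by (intro weight_sum_le[OF nn det]) auto
    moreover have "sqrt 3 < A + B + C" using weight_sum_ge[OF nn det] ne by fastforce
    ultimately show ?thesis by (intro weight_theta_gt_hex_compact[OF nn det \<beta>])
  qed
  show ?thesis
  proof (cases "\<alpha> \<ge> 1")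
    case False
    then have inv: "1 / \<alpha> \<ge> 1" using \<alpha> by simp
    have hex: "weight_theta hex_weight hex_weight hex_weight \<alpha> = weight_theta hex_weight hex_weight hex_weight (1 / \<alpha>) / \<alpha>"
      by (rule weight_theta_functional_equation) (use \<alpha> in auto)
    show ?thesis
      unfolding hex weight_theta_functional_equation[OF nn det \<alpha>]
      using ge1[OF inv] \<alpha> by (intro divide_strict_right_mono)
  qed (rule ge1)
qed

section \<open>Lattices in the plane\<close>

definition plane_lattice :: "real^2 \<Rightarrow> real^2 \<Rightarrow> (real^2) set" where
  "plane_lattice x y = range (\<lambda>(m, n). real_of_int m *\<^sub>R x + real_of_int n *\<^sub>R y)"

definition cross2 :: "real^2 \<Rightarrow> real^2 \<Rightarrow> real" where
  "cross2 x y = x $ 1 * y $ 2 - x $ 2 * y $ 1"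

lemma inner_2: "(x :: real^2) \<bullet> y = x $ 1 * y $ 1 + x $ 2 * y $ 2"
  by (simp add: inner_vec_def sum_2)

lemma vec_eq_2: "(x :: real^2) = y \<longleftrightarrow> x $ 1 = y $ 1 \<and> x $ 2 = y $ 2"
  by (simp add: vec_eq_iff forall_2)

lemma cross2_sq: "(cross2 x y)\<^sup>2 = (x \<bullet> x) * (y \<bullet> y) - (x \<bullet> y)\<^sup>2"
  by (simp add: cross2_def inner_2 power2_eq_square algebra_simps)

lemma cross2_expand:
  assumes "cross2 x y \<noteq> 0"
  shows "z = (cross2 z y / cross2 x y) *\<^sub>R x + (cross2 x z / cross2 x y) *\<^sub>R y"
proof -
  have "cross2 x y *\<^sub>R z = cross2 z y *\<^sub>R x + cross2 x z *\<^sub>R y"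
    by (simp add: vec_eq_2 cross2_def algebra_simps)
  then have "z = (1 / cross2 x y) *\<^sub>R (cross2 z y *\<^sub>R x + cross2 x z *\<^sub>R y)"
    using assms by (metis divide_self_if mult.commute scaleR_one scaleR_scaleR times_divide_eq_right mult_1_right)
  then show ?thesis by (simp add: scaleR_right_distrib)
qed

lemma cross2_lincomb: "cross2 (a *\<^sub>R x + b *\<^sub>R y) (c *\<^sub>R x + d *\<^sub>R y) = (a * d - b * c) * cross2 x y"
  by (simp add: cross2_def algebra_simps)

lemma lincomb_eq_iff:
  assumes "cross2 x y \<noteq> 0"
  shows "a *\<^sub>R x + b *\<^sub>R y = c *\<^sub>R x + d *\<^sub>R y \<longleftrightarrow> a = c \<and> b = d"
proof
  assume eq: "a *\<^sub>R x + b *\<^sub>R y = c *\<^sub>R x + d *\<^sub>R y"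
  have "cross2 (a *\<^sub>R x + b *\<^sub>R y) y = a * cross2 x y" "cross2 (c *\<^sub>R x + d *\<^sub>R y) y = c * cross2 x y"
    "cross2 x (a *\<^sub>R x + b *\<^sub>R y) = b * cross2 x y" "cross2 x (c *\<^sub>R x + d *\<^sub>R y) = d * cross2 x y"
    by (simp_all add: cross2_def algebra_simps)
  then show "a = c \<and> b = d" using assms eq by (metis mult_right_cancel)
qed auto

lemma plane_lattice_eq_int_span:
  assumes "x \<noteq> y"
  shows "plane_lattice x y = int_span {x, y}"
proof -
  have "int_span {x, y} = range (\<lambda>c. real_of_int (c x) *\<^sub>R x + real_of_int (c y) *\<^sub>R y)"
    unfolding int_span_def using assms by auto
  also have "\<dots> = plane_lattice x y"
  proof (intro equalityI subsetI)
    fix z assume "z \<in> plane_lattice x y"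
    then obtain m n where "z = real_of_int m *\<^sub>R x + real_of_int n *\<^sub>R y" unfolding plane_lattice_def by auto
    then show "z \<in> range (\<lambda>c. real_of_int (c x) *\<^sub>R x + real_of_int (c y) *\<^sub>R y)"
      using assms by (intro range_eqI[of _ _ "\<lambda>v. if v = x then m else n"]) auto
  qed (auto simp: plane_lattice_def)
  finally show ?thesis by simp
qed

lemma span_pair:
  assumes "cross2 x y \<noteq> 0"
  shows "span {x, y} = UNIV"
proof -
  have "z \<in> span {x, y}" for z
    by (subst cross2_expand[OF assms, of z]) (intro span_add span_scale span_base, auto)
  then show ?thesis by blast
qed

lemma bravais_lattice_plane_lattice:
  assumes "cross2 x y \<noteq> 0"
  shows "bravais_lattice (plane_lattice x y)"
proof -
  have ne: "x \<noteq> y" using assms by (auto simp: cross2_def)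
  have "independent {x, y}"
    by (rule card_le_dim_spanning[of _ UNIV]) (use span_pair[OF assms] ne in auto)
  then show ?thesis
    unfolding bravais_lattice_def plane_lattice_eq_int_span[OF ne] using span_pair[OF assms] by blast
qed

lemma bravais_lattice_planeE:
  fixes L :: "(real^2) set"
  assumes "bravais_lattice L"
  obtains x y where "cross2 x y \<noteq> 0" "L = plane_lattice x y"
proof -
  obtain B where B: "independent B" "span B = UNIV" "L = int_span B"
    using assms unfolding bravais_lattice_def by blast
  have "card B = 2" using basis_card_eq_dim[of B UNIV] B by simp
  then obtain x y where xy: "B = {x, y}" "x \<noteq> y" by (auto simp: card_2_iff)
  have "\<exists>s t. z = s *\<^sub>R x + t *\<^sub>R y" for z
  proof -
    have "z \<in> span {x, y}" using B xy by simp
    then obtain s t where "z - s *\<^sub>R x = t *\<^sub>R y"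
      unfolding span_breakdown_eq span_singleton by auto
    then have "z = s *\<^sub>R x + t *\<^sub>R y" by (simp add: algebra_simps)
    then show ?thesis by blast
  qed
  then obtain s t s' t' where e: "vector [1, 0] = s *\<^sub>R x + t *\<^sub>R y" "vector [0, 1] = s' *\<^sub>R x + t' *\<^sub>R y" by metis
  have "cross2 (vector [1, 0]) (vector [0, 1]) = 1" by (simp add: cross2_def)
  then have "cross2 x y \<noteq> 0" unfolding e cross2_lincomb by auto
  then show ?thesis using that B xy plane_lattice_eq_int_span by blast
qed

text \<open>
  Cut \<open>F\<close> into its intersections with the translates of \<open>P\<close>. Moved back by the same lattice vectors, the
  pieces tile \<open>P\<close>. One of the two domains has finite measure, which makes all the pieces
  measurable of finite measure.
\<close>

lemma fundamental_domain_emeasure_eq: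
  fixes L :: "'a::euclidean_space set"
  assumes L: "countable L" "\<And>p. p \<in> L \<Longrightarrow> - p \<in> L"
    and F: "fundamental_domain L F" and P: "fundamental_domain L P" and PL: "P \<in> lmeasurable"
  shows "emeasure lebesgue F = emeasure lebesgue P"
proof -
  have Fm: "F \<in> sets lebesgue" using F by (simp add: fundamental_domain_def)
  have Fx: "\<exists>!p. p \<in> L \<and> x - p \<in> F" and Px: "\<exists>!p. p \<in> L \<and> x - p \<in> P" for x
    using F P by (auto simp: fundamental_domain_def)
  define X where "X = (\<lambda>p. F \<inter> (+) p ` P)"
  define Y where "Y = (\<lambda>p. {x. p + x \<in> F} \<inter> P)"
  have XL: "X p \<in> lmeasurable" for p
    unfolding X_def using Fm measurable_translation[OF PL, of p] by (metis Int_commute fmeasurable_Int_fmeasurable)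
  have YX: "Y p = (+) (- p) ` X p" for p
  proof (intro equalityI subsetI)
    fix x assume "x \<in> Y p"
    then have "p + x \<in> X p" by (simp add: X_def Y_def)
    then show "x \<in> (+) (- p) ` X p" by (intro image_eqI[of _ _ "p + x"]) simp_all
  qed (auto simp: X_def Y_def)
  have YL: "Y p \<in> lmeasurable" for p
    unfolding YX by (rule measurable_translation[OF XL])
  have eq: "emeasure lebesgue (X p) = emeasure lebesgue (Y p)" for p
    using measure_translation[of "- p" "X p"] XL[of p] YL[of p]
    by (simp add: YX emeasure_eq_measure2)
  have "F = (\<Union>p\<in>L. X p)"
  proof (intro equalityI subsetI)
    fix x assume "x \<in> F"
    obtain p where "p \<in> L" "x - p \<in> P" using Px[of x] by blast
    then show "x \<in> (\<Union>p\<in>L. X p)" using \<open>x \<in> F\<close> unfolding X_def by (auto intro!: bexI[of _ p] image_eqI[of _ _ "x - p"])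
  qed (auto simp: X_def)
  moreover have "emeasure lebesgue (\<Union>p\<in>L. X p) = (\<integral>\<^sup>+p. emeasure lebesgue (X p) \<partial>count_space L)"
  proof (rule emeasure_UN_countable[OF _ L(1)])
    show "disjoint_family_on X L"
      unfolding disjoint_family_on_def
    proof (intro ballI impI)
      fix p q assume "p \<in> L" "q \<in> L" "p \<noteq> q"
      have "p = q" if "x \<in> X p" "x \<in> X q" for x
      proof -
        have "y - r \<in> P" if "y \<in> X r" for y r using that by (auto simp: X_def)
        then have "x - p \<in> P" "x - q \<in> P" using that by blast+
        then show ?thesis using Px[of x] \<open>p \<in> L\<close> \<open>q \<in> L\<close> by blast
      qed
      then show "X p \<inter> X q = {}" using \<open>p \<noteq> q\<close> by blast
    qed
  qed (use XL in \<open>auto dest: fmeasurableD\<close>)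
  moreover have "P = (\<Union>p\<in>L. Y p)"
  proof (intro equalityI subsetI)
    fix x assume "x \<in> P"
    obtain p where "p \<in> L" "x - p \<in> F" using Fx[of x] by blast
    then show "x \<in> (\<Union>p\<in>L. Y p)" using \<open>x \<in> P\<close> L(2) unfolding Y_def by (auto intro!: bexI[of _ "- p"])
  qed (auto simp: Y_def)
  moreover have "emeasure lebesgue (\<Union>p\<in>L. Y p) = (\<integral>\<^sup>+p. emeasure lebesgue (Y p) \<partial>count_space L)"
  proof (rule emeasure_UN_countable[OF _ L(1)])
    show "disjoint_family_on Y L"
      unfolding disjoint_family_on_def
    proof (intro ballI impI)
      fix p q assume "p \<in> L" "q \<in> L" "p \<noteq> q"
      have "p = q" if "x \<in> Y p" "x \<in> Y q" for x
      proof -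
        have "x - (- p) \<in> F" "x - (- q) \<in> F" using that unfolding Y_def by (auto simp: add.commute)
        then have "- p = - q" using Fx[of x] L(2) \<open>p \<in> L\<close> \<open>q \<in> L\<close> by blast
        then show ?thesis by simp
      qed
      then show "Y p \<inter> Y q = {}" using \<open>p \<noteq> q\<close> by blast
    qed
  qed (use YL in \<open>auto dest: fmeasurableD\<close>)
  ultimately show ?thesis using eq by simp
qed

lemma fundamental_parallelogram:
  assumes "cross2 x y \<noteq> 0"
  shows "\<exists>P. fundamental_domain (plane_lattice x y) P \<and> P \<in> lmeasurable \<and> measure lebesgue P = \<bar>cross2 x y\<bar>"
proof -
  define f where "f = (\<lambda>v :: real^2. (v $ 1) *\<^sub>R x + (v $ 2) *\<^sub>R y)"
  have lin: "linear f" unfolding f_def by (intro linearI) (auto simp: algebra_simps)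
  define Q where "Q = {v :: real^2. 0 \<le> v $ 1 \<and> v $ 1 < 1 \<and> 0 \<le> v $ 2 \<and> v $ 2 < 1}"
  have Q1: "box 0 1 \<subseteq> Q" "Q \<subseteq> cbox 0 1"
    by (auto simp: Q_def mem_box_cart forall_2)
  have Qm: "Q \<in> sets lebesgue"
  proof -
    have "Q = {v. 0 \<le> v $ 1} \<inter> - {v. 1 \<le> v $ 1} \<inter> {v. 0 \<le> v $ 2} \<inter> - {v. 1 \<le> v $ 2}"
      unfolding Q_def by auto
    also have "\<dots> \<in> sets borel"
      by (intro sets.Int borel_closed borel_comp closed_Collect_le continuous_intros)
    finally show ?thesis by simp
  qed
  have cb: "measure lebesgue (cbox 0 (1 :: real^2)) = 1"
  proof -
    have "(0 :: real^2) \<in> cbox 0 1" by (simp add: mem_box_cart)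
    then have "cbox 0 (1 :: real^2) \<noteq> {}" by blast
    then show ?thesis by (simp add: content_cbox_cart)
  qed
  have Ql: "Q \<in> lmeasurable" by (rule fmeasurableI2[OF lmeasurable_cbox Q1(2) Qm])
  have "measure lebesgue (box 0 (1 :: real^2)) = measure lebesgue (cbox 0 (1 :: real^2))"
    unfolding interior_cbox[symmetric] by (rule measure_interior) (auto intro: negligible_convex_frontier)
  then have Qmeas: "measure lebesgue Q = 1"
    using measure_mono_fmeasurable[OF Q1(1) _ Ql] measure_mono_fmeasurable[OF Q1(2) Qm] cb by simp
  have det: "\<bar>det (matrix f)\<bar> = \<bar>cross2 x y\<bar>"
    by (simp add: det_2 matrix_def f_def cross2_def axis_def algebra_simps)
  define P where "P = f ` Q"
  have "P \<in> lmeasurable" "measure lebesgue P = \<bar>cross2 x y\<bar>"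
    unfolding P_def using measurable_linear_image[OF lin Ql] measure_linear_image[OF lin Ql] Qmeas det by simp_all
  moreover have "fundamental_domain (plane_lattice x y) P"
    unfolding fundamental_domain_def
  proof (intro conjI allI)
    show "P \<in> sets lebesgue" using \<open>P \<in> lmeasurable\<close> by (rule fmeasurableD)
    fix z
    define s t where "s = cross2 z y / cross2 x y" and "t = cross2 x z / cross2 x y"
    have z: "z = s *\<^sub>R x + t *\<^sub>R y" unfolding s_def t_def by (rule cross2_expand[OF assms])
    have inP: "a *\<^sub>R x + b *\<^sub>R y \<in> P \<longleftrightarrow> 0 \<le> a \<and> a < 1 \<and> 0 \<le> b \<and> b < 1" for a b
    proof
      assume "a *\<^sub>R x + b *\<^sub>R y \<in> P"
      then obtain v where "v \<in> Q" "a *\<^sub>R x + b *\<^sub>R y = v $ 1 *\<^sub>R x + v $ 2 *\<^sub>R y" unfolding P_def f_def by auto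
      then show "0 \<le> a \<and> a < 1 \<and> 0 \<le> b \<and> b < 1" unfolding lincomb_eq_iff[OF assms] by (simp add: Q_def)
    next
      assume "0 \<le> a \<and> a < 1 \<and> 0 \<le> b \<and> b < 1"
      then show "a *\<^sub>R x + b *\<^sub>R y \<in> P" unfolding P_def f_def
        by (intro image_eqI[of _ _ "vector [a, b]"]) (auto simp: Q_def)
    qed
    have diff: "z - (real_of_int m *\<^sub>R x + real_of_int n *\<^sub>R y) = (s - m) *\<^sub>R x + (t - n) *\<^sub>R y" for m n
      unfolding z by (simp add: algebra_simps)
    show "\<exists>!p. p \<in> plane_lattice x y \<and> z - p \<in> P"
    proof (rule ex1I[of _ "real_of_int \<lfloor>s\<rfloor> *\<^sub>R x + real_of_int \<lfloor>t\<rfloor> *\<^sub>R y"])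
      have "s - real_of_int \<lfloor>s\<rfloor> < 1" "t - real_of_int \<lfloor>t\<rfloor> < 1" by linarith+
      then show "real_of_int \<lfloor>s\<rfloor> *\<^sub>R x + real_of_int \<lfloor>t\<rfloor> *\<^sub>R y \<in> plane_lattice x y \<and>
          z - (real_of_int \<lfloor>s\<rfloor> *\<^sub>R x + real_of_int \<lfloor>t\<rfloor> *\<^sub>R y) \<in> P"
        unfolding diff inP by (auto simp: plane_lattice_def)
      fix p assume p: "p \<in> plane_lattice x y \<and> z - p \<in> P"
      then obtain m n where mn: "p = real_of_int m *\<^sub>R x + real_of_int n *\<^sub>R y" unfolding plane_lattice_def by auto
      have "0 \<le> s - m" "s - m < 1" "0 \<le> t - n" "t - n < 1" using p unfolding mn diff inP by auto
      then have "m = \<lfloor>s\<rfloor>" "n = \<lfloor>t\<rfloor>" by linarith+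
      then show "p = real_of_int \<lfloor>s\<rfloor> *\<^sub>R x + real_of_int \<lfloor>t\<rfloor> *\<^sub>R y" using mn by simp
    qed
  qed
  ultimately show ?thesis by blast
qed

lemma lattice_volume_plane_lattice:
  assumes "cross2 x y \<noteq> 0"
  shows "lattice_volume (plane_lattice x y) = \<bar>cross2 x y\<bar>"
proof -
  obtain P where P: "fundamental_domain (plane_lattice x y) P" "P \<in> lmeasurable" "measure lebesgue P = \<bar>cross2 x y\<bar>"
    using fundamental_parallelogram[OF assms] by blast
  have c: "countable (plane_lattice x y)" unfolding plane_lattice_def by simp
  have "measure lebesgue F = \<bar>cross2 x y\<bar>" if "fundamental_domain (plane_lattice x y) F" for F
    using fundamental_domain_emeasure_eq[OF c bravais_lattice_closed(4)[OF bravais_lattice_plane_lattice[OF assms]] that P(1,2)] P(3)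
    by (simp add: measure_def)
  then show ?thesis
    unfolding lattice_volume_def using P by (intro the_equality) auto
qed

lemma plane_lattice_change:
  "plane_lattice x (y + x) = plane_lattice x y" "plane_lattice x (y - x) = plane_lattice x y"
  "plane_lattice (x + y) y = plane_lattice x y" "plane_lattice (x - y) y = plane_lattice x y"
  "plane_lattice x (- y) = plane_lattice x y"
proof -
  have sub: "plane_lattice x' y' \<subseteq> plane_lattice x y"
    if "x' = real_of_int a *\<^sub>R x + real_of_int b *\<^sub>R y" "y' = real_of_int c *\<^sub>R x + real_of_int d *\<^sub>R y" for x y x' y' a b c d
  proof -
    have "real_of_int m *\<^sub>R x' + real_of_int n *\<^sub>R y' = real_of_int (m * a + n * c) *\<^sub>R x + real_of_int (m * b + n * d) *\<^sub>R y" for m n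
      unfolding that by (simp add: algebra_simps)
    then have "real_of_int m *\<^sub>R x' + real_of_int n *\<^sub>R y' \<in> plane_lattice x y" for m n
      unfolding plane_lattice_def by (intro range_eqI[of _ _ "(m * a + n * c, m * b + n * d)"]) (simp only: prod.case)
    then show ?thesis unfolding plane_lattice_def[of x' y'] by auto
  qed
  show "plane_lattice x (y + x) = plane_lattice x y"
    by (intro equalityI sub[of x 1 x 0 y "y + x" 1 1] sub[of x 1 x 0 "y + x" y "- 1" 1]) simp_all
  show "plane_lattice x (y - x) = plane_lattice x y"
    by (intro equalityI sub[of x 1 x 0 y "y - x" "- 1" 1] sub[of x 1 x 0 "y - x" y 1 1]) simp_all
  show "plane_lattice (x + y) y = plane_lattice x y"
    by (intro equalityI sub[of "x + y" 1 x 1 y y 0 1] sub[of x 1 "x + y" "- 1" y y 0 1]) simp_all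
  show "plane_lattice (x - y) y = plane_lattice x y"
    by (intro equalityI sub[of "x - y" 1 x "- 1" y y 0 1] sub[of x 1 "x - y" 1 y y 0 1]) simp_all
  show "plane_lattice x (- y) = plane_lattice x y"
    by (intro equalityI sub[of x 1 x 0 y "- y" 0 "- 1"] sub[of x 1 x 0 "- y" y 0 "- 1"]) simp_all
qed

lemma norm_lincomb_sq:
  "(norm (m *\<^sub>R x + n *\<^sub>R y))\<^sup>2 = (x \<bullet> x) * m\<^sup>2 + 2 * (x \<bullet> y) * m * n + (y \<bullet> y) * n\<^sup>2"
  unfolding power2_norm_eq_inner by (simp add: inner_simps power2_eq_square inner_commute algebra_simps)

lemma finite_plane_lattice_ball:
  assumes "cross2 x y \<noteq> 0"
  shows "finite {p \<in> plane_lattice x y. p \<bullet> p \<le> R}"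
proof -
  have "x \<noteq> 0" "y \<noteq> 0" using assms by (auto simp: cross2_def)
  then have pos: "x \<bullet> x > 0" "y \<bullet> y > 0" by auto
  define \<delta> where "\<delta> = ((x \<bullet> x) * (y \<bullet> y) - (x \<bullet> y)\<^sup>2) / (x \<bullet> x + y \<bullet> y)"
  have \<delta>: "\<delta> > 0" unfolding \<delta>_def cross2_sq[symmetric] using assms pos by (intro divide_pos_pos add_pos_pos) auto
  \<comment> \<open>The form is at least \<open>\<delta>\<close> times the sum of the squared coordinates, and \<open>\<bar>k\<bar> \<le> k\<^sup>2 + 1\<close>.\<close>
  define K where "K = \<lceil>\<bar>R\<bar> / \<delta> + 1\<rceil>"
  have "{p \<in> plane_lattice x y. p \<bullet> p \<le> R} \<subseteq> (\<lambda>(m, n). real_of_int m *\<^sub>R x + real_of_int n *\<^sub>R y) ` ({- K..K} \<times> {- K..K})"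
  proof
    fix p assume p: "p \<in> {p \<in> plane_lattice x y. p \<bullet> p \<le> R}"
    then obtain m n where mn: "p = real_of_int m *\<^sub>R x + real_of_int n *\<^sub>R y" unfolding plane_lattice_def by auto
    have "\<delta> * ((real_of_int m)\<^sup>2 + (real_of_int n)\<^sup>2) \<le> p \<bullet> p"
      unfolding \<delta>_def mn norm_lincomb_sq[unfolded power2_norm_eq_inner] by (rule pos_def_form_ge[OF pos])
    then have "\<delta> * ((real_of_int m)\<^sup>2 + (real_of_int n)\<^sup>2) \<le> \<bar>R\<bar>" using p by auto
    then have le: "(real_of_int m)\<^sup>2 + (real_of_int n)\<^sup>2 \<le> \<bar>R\<bar> / \<delta>" using \<delta> by (simp add: pos_le_divide_eq mult.commute)
    have bound: "\<bar>k\<bar> \<le> K" if "(real_of_int k)\<^sup>2 \<le> \<bar>R\<bar> / \<delta>" for k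
    proof -
      have "real_of_int \<bar>k\<bar> \<le> (real_of_int k)\<^sup>2 + 1"
        using zero_le_power2[of "real_of_int \<bar>k\<bar> - 1"] by (simp add: power2_eq_square algebra_simps)
      then have "real_of_int \<bar>k\<bar> \<le> \<bar>R\<bar> / \<delta> + 1" using that by linarith
      then show ?thesis unfolding K_def by linarith
    qed
    have "(real_of_int m)\<^sup>2 \<le> \<bar>R\<bar> / \<delta>" "(real_of_int n)\<^sup>2 \<le> \<bar>R\<bar> / \<delta>"
      using le zero_le_power2[of "real_of_int m"] zero_le_power2[of "real_of_int n"] by linarith+
    then have "\<bar>m\<bar> \<le> K" "\<bar>n\<bar> \<le> K" by (auto intro: bound)
    then show "p \<in> (\<lambda>(m, n). real_of_int m *\<^sub>R x + real_of_int n *\<^sub>R y) ` ({- K..K} \<times> {- K..K})"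
      unfolding mn by (intro image_eqI[of _ _ "(m, n)"]) auto
  qed
  then show ?thesis by (rule finite_subset) simp
qed

text \<open>
  Take a basis with minimal sum of squared norms; it exists because there are only finitely many lattice vectors
  in a ball. Replacing one basis vector by its sum or difference with the other one cannot decrease the
  norm, so \<open>2 \<bar>a \<bullet> b\<bar>\<close> is at most either squared norm. If the angle is acute, the sign of \<open>b\<close> is changed.
\<close>

lemma plane_lattice_reduced_basis:
  assumes "cross2 x y \<noteq> 0"
  obtains a b where "plane_lattice a b = plane_lattice x y" "\<bar>cross2 a b\<bar> = \<bar>cross2 x y\<bar>"
    "a \<bullet> b \<le> 0" "0 \<le> a \<bullet> a + a \<bullet> b" "0 \<le> b \<bullet> b + a \<bullet> b"
proof -
  define S where "S = {(a, b). plane_lattice a b = plane_lattice x y \<and> \<bar>cross2 a b\<bar> = \<bar>cross2 x y\<bar>}"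
  define f where "f = (\<lambda>(a :: real^2, b :: real^2). a \<bullet> a + b \<bullet> b)"
  define R where "R = f (x, y)"
  have mem: "a \<in> plane_lattice a b" "b \<in> plane_lattice a b" for a b
    unfolding plane_lattice_def by (auto intro: range_eqI[of _ _ "(1, 0)"] range_eqI[of _ _ "(0, 1)"])
  define T where "T = {v \<in> S. f v \<le> R}"
  have "T \<subseteq> {p \<in> plane_lattice x y. p \<bullet> p \<le> R} \<times> {p \<in> plane_lattice x y. p \<bullet> p \<le> R}"
  proof
    fix v assume v: "v \<in> T"
    obtain a b where ab: "v = (a, b)" by force
    have "a \<in> plane_lattice x y" "b \<in> plane_lattice x y" using v mem[of a b] mem[of b a] unfolding ab T_def S_def by auto
    moreover have "a \<bullet> a \<le> R" "b \<bullet> b \<le> R"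
      using v inner_ge_zero[of a] inner_ge_zero[of b] unfolding ab T_def f_def by (simp_all del: inner_ge_zero)
    ultimately show "v \<in> {p \<in> plane_lattice x y. p \<bullet> p \<le> R} \<times> {p \<in> plane_lattice x y. p \<bullet> p \<le> R}" using ab by simp
  qed
  then have "finite T" using finite_plane_lattice_ball[OF assms] by (meson finite_SigmaI finite_subset)
  moreover have "(x, y) \<in> T" by (simp add: T_def S_def R_def)
  ultimately obtain v where v: "is_arg_min f (\<lambda>x. x \<in> T) v" using ex_is_arg_min_if_finite[of T f] by blast
  obtain a b where ab: "v = (a, b)" by force
  have abT: "(a, b) \<in> T" and min: "\<And>w. w \<in> T \<Longrightarrow> f (a, b) \<le> f w"
    using v unfolding ab is_arg_min_linorder by auto
  have abS: "plane_lattice a b = plane_lattice x y" "\<bar>cross2 a b\<bar> = \<bar>cross2 x y\<bar>" "f (a, b) \<le> R"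
    using abT by (auto simp: T_def S_def)
  have minS: "f (a, b) \<le> f (c, d)" if "plane_lattice c d = plane_lattice x y" "\<bar>cross2 c d\<bar> = \<bar>cross2 x y\<bar>" for c d
  proof (cases "f (c, d) \<le> R")
    case True
    then show ?thesis using that by (intro min) (simp add: T_def S_def)
  qed (use abS in simp)
  have cr: "cross2 a (b + a) = cross2 a b" "cross2 a (b - a) = cross2 a b" "cross2 (a + b) b = cross2 a b" "cross2 (a - b) b = cross2 a b"
    "cross2 a (- b) = - cross2 a b"
    by (simp_all add: cross2_def algebra_simps)
  have 1: "0 \<le> a \<bullet> a + 2 * (a \<bullet> b)" using minS[of a "b + a"] abS plane_lattice_change(1)[of a b] cr
    by (simp add: f_def inner_simps inner_commute)
  have 2: "0 \<le> a \<bullet> a - 2 * (a \<bullet> b)" using minS[of a "b - a"] abS plane_lattice_change(2)[of a b] cr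
    by (simp add: f_def inner_simps inner_commute)
  have 3: "0 \<le> b \<bullet> b + 2 * (a \<bullet> b)" using minS[of "a + b" b] abS plane_lattice_change(3)[of a b] cr
    by (simp add: f_def inner_simps inner_commute)
  have 4: "0 \<le> b \<bullet> b - 2 * (a \<bullet> b)" using minS[of "a - b" b] abS plane_lattice_change(4)[of a b] cr
    by (simp add: f_def inner_simps inner_commute)
  have nn: "0 \<le> a \<bullet> a" "0 \<le> b \<bullet> b" by simp_all
  show ?thesis
  proof (cases "a \<bullet> b \<le> 0")
    case True
    then show ?thesis using that[of a b] abS 1 3 nn by auto
  next
    case False
    then show ?thesis using that[of a "- b"] abS 2 4 nn plane_lattice_change(5)[of a b] cr by auto
  qed
qed

text \<open>
  Dividing the Gram matrix by the cell area normalises the determinant, and \<open>\<alpha>\<close> takes up the area.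
\<close>

lemma theta_plane_lattice:
  assumes ne: "cross2 x y \<noteq> 0" and \<alpha>: "\<alpha> > 0"
  shows "theta (plane_lattice x y) \<alpha> = weight_theta ((x \<bullet> x + x \<bullet> y) / \<bar>cross2 x y\<bar>) ((y \<bullet> y + x \<bullet> y) / \<bar>cross2 x y\<bar>)
    (- (x \<bullet> y) / \<bar>cross2 x y\<bar>) (\<alpha> * \<bar>cross2 x y\<bar>)"
proof -
  define D where "D = \<bar>cross2 x y\<bar>"
  have D: "D > 0" using ne by (simp add: D_def)
  have "inj (\<lambda>(m, n). real_of_int m *\<^sub>R x + real_of_int n *\<^sub>R y)"
    by (auto simp: inj_def lincomb_eq_iff[OF ne])
  then have "theta (plane_lattice x y) \<alpha> = (\<Sum>\<^sub>\<infinity>v\<in>UNIV. exp (- pi * \<alpha> * (norm (case v of (m, n) \<Rightarrow> real_of_int m *\<^sub>R x + real_of_int n *\<^sub>R y))\<^sup>2))"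
    unfolding theta_def plane_lattice_def by (subst infsum_reindex) (auto simp: o_def)
  also have "\<dots> = weight_theta ((x \<bullet> x + x \<bullet> y) / D) ((y \<bullet> y + x \<bullet> y) / D) (- (x \<bullet> y) / D) (\<alpha> * D)"
    unfolding weight_theta_def form_theta_def
  proof (intro infsum_cong)
    fix v :: "int \<times> int"
    obtain m n where v: "v = (m, n)" by force
    have "\<alpha> * (norm (real_of_int m *\<^sub>R x + real_of_int n *\<^sub>R y))\<^sup>2 =
      \<alpha> * D * (((x \<bullet> x + x \<bullet> y) / D + - (x \<bullet> y) / D) * (real_of_int m)\<^sup>2 + 2 * - (- (x \<bullet> y) / D) * real_of_int m * real_of_int n
        + ((y \<bullet> y + x \<bullet> y) / D + - (x \<bullet> y) / D) * (real_of_int n)\<^sup>2)"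
      unfolding norm_lincomb_sq using D by (simp add: field_simps)
    then show "exp (- pi * \<alpha> * (norm (case v of (m, n) \<Rightarrow> real_of_int m *\<^sub>R x + real_of_int n *\<^sub>R y))\<^sup>2) =
      (case v of (m, n) \<Rightarrow> exp (- pi * (\<alpha> * D) * (((x \<bullet> x + x \<bullet> y) / D + - (x \<bullet> y) / D) * (real_of_int m)\<^sup>2 + 2 * - (- (x \<bullet> y) / D) * real_of_int m * real_of_int n
        + ((y \<bullet> y + x \<bullet> y) / D + - (x \<bullet> y) / D) * (real_of_int n)\<^sup>2)))"
      unfolding v prod.case by (simp only: mult.assoc)
  qed
  finally show ?thesis by (simp add: D_def)
qed


lemma A2_eq_plane_lattice:
  "A2 = plane_lattice (vector [1, 0]) (vector [1/2, sqrt 3 / 2])"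
  "A2 = plane_lattice (vector [1, 0]) (- vector [1/2, sqrt 3 / 2])"
  unfolding plane_lattice_change(5) by (auto simp: A2_def plane_lattice_def)

lemma cross2_A2: "cross2 (vector [1, 0]) (vector [1/2, sqrt 3 / 2]) = sqrt 3 / 2"
  by (simp add: cross2_def)

lemma bravais_lattice_A2: "bravais_lattice A2"
  unfolding A2_eq_plane_lattice(1) by (rule bravais_lattice_plane_lattice) (simp add: cross2_A2)

lemma lattice_volume_A2: "lattice_volume A2 = sqrt 3 / 2"
  unfolding A2_eq_plane_lattice(1) by (subst lattice_volume_plane_lattice) (simp_all add: cross2_A2)

text \<open>
  The basis \<open>(1, 0)\<close>, \<open>(1/2, sqrt 3 / 2)\<close> is acute; with the second vector negated it is reduced.
\<close>

lemma theta_A2: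
  assumes "\<alpha> > 0"
  shows "theta A2 \<alpha> = weight_theta hex_weight hex_weight hex_weight (\<alpha> * (sqrt 3 / 2))"
proof -
  define e1 e2 :: "real^2" where "e1 = vector [1, 0]" and "e2 = - vector [1/2, sqrt 3 / 2]"
  have c: "\<bar>cross2 e1 e2\<bar> = sqrt 3 / 2" by (simp add: cross2_def e1_def e2_def)
  have i: "e1 \<bullet> e1 = 1" "e1 \<bullet> e2 = - (1 / 2)" "e2 \<bullet> e2 = 1"
    by (simp_all add: inner_2 e1_def e2_def power2_eq_square)
  have "cross2 e1 e2 \<noteq> 0" using c by auto
  from theta_plane_lattice[OF this assms] show ?thesis
    unfolding A2_eq_plane_lattice(2) e1_def[symmetric] e2_def[symmetric] c i by simp
qed

lemma equal_up_to_rotation_imp_theta_eq: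
  assumes "equal_up_to_rotation L M"
  shows "theta L \<alpha> = theta M \<alpha>"
proof -
  obtain Q where Q: "rotation_matrix Q" "L = (*v) Q ` M" using assms unfolding equal_up_to_rotation_def by blast
  then have ot: "orthogonal_transformation ((*v) Q)"
    by (simp add: rotation_matrix_def orthogonal_transformation_matrix)
  then have "inj_on ((*v) Q) M" by (meson inj_on_subset orthogonal_transformation_inj subset_UNIV)
  then show ?thesis
    unfolding theta_def Q(2) by (subst infsum_reindex) (auto simp: o_def orthogonal_transformation_norm[OF ot] intro!: infsum_cong)
qed

text \<open>
  The rotation that takes \<open>(1, 0)\<close> to \<open>x\<close> also takes the lattice to the one spanned by \<open>x\<close>, for either
  orientation of the basis: the rotated second basis vector \<open>z\<close> satisfies \<open>y = z - x\<close> or \<open>y = -z\<close>.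
\<close>

lemma hex_basis_imp_rotation:
  assumes "x \<bullet> x = 1" "y \<bullet> y = 1" "x \<bullet> y = - (1 / 2)"
  shows "equal_up_to_rotation (plane_lattice x y) A2"
proof -
  define Q :: "real^2^2" where "Q = vector [vector [x $ 1, - x $ 2], vector [x $ 2, x $ 1]]"
  have x1: "x $ 1 * x $ 1 + x $ 2 * x $ 2 = 1" using assms(1) by (simp add: inner_2)
  have rot: "rotation_matrix Q"
    unfolding rotation_matrix_def orthogonal_matrix Q_def
    using x1 by (simp add: det_2 vec_eq_iff matrix_matrix_mult_def transpose_def mat_def sum_2 forall_2 add.commute)
  have Qv: "Q *v v = v $ 1 *\<^sub>R x + v $ 2 *\<^sub>R vector [- x $ 2, x $ 1]" for v
    by (simp add: Q_def vec_eq_2 matrix_vector_mult_def sum_2 algebra_simps)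
  define z where "z = Q *v vector [1/2, sqrt 3 / 2]"
  have Qx: "Q *v vector [1, 0] = x" unfolding Qv by simp
  have QA: "(*v) Q ` A2 = plane_lattice x z"
    unfolding A2_eq_plane_lattice(1) plane_lattice_def image_image
    by (auto simp: z_def Qx matrix_vector_right_distrib matrix_vector_mult_scaleR case_prod_unfold)
  have c2: "(cross2 x y)\<^sup>2 = (sqrt 3 / 2)\<^sup>2" unfolding cross2_sq assms by (simp add: power2_eq_square)
  have y: "y = (x \<bullet> y) *\<^sub>R x + cross2 x y *\<^sub>R vector [- x $ 2, x $ 1]"
  proof -
    have "y $ 1 * (x $ 1 * x $ 1 + x $ 2 * x $ 2) = (x \<bullet> y) * x $ 1 - cross2 x y * x $ 2"
      "y $ 2 * (x $ 1 * x $ 1 + x $ 2 * x $ 2) = (x \<bullet> y) * x $ 2 + cross2 x y * x $ 1"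
      by (simp_all add: inner_2 cross2_def algebra_simps)
    then show ?thesis unfolding x1 by (simp add: vec_eq_2)
  qed
  have z: "z = (1 / 2) *\<^sub>R x + (sqrt 3 / 2) *\<^sub>R vector [- x $ 2, x $ 1]" unfolding z_def Qv by simp
  from c2 consider "cross2 x y = sqrt 3 / 2" | "cross2 x y = - (sqrt 3 / 2)" by (auto simp: power2_eq_iff)
  then have "plane_lattice x y = plane_lattice x z"
  proof cases
    case 1
    then have "y = z - x" using y assms(3) unfolding z by (simp add: vec_eq_2)
    then show ?thesis by (simp add: plane_lattice_change)
  next
    case 2
    then have "y = - z" using y assms(3) unfolding z by (simp add: vec_eq_2)
    then show ?thesis by (simp add: plane_lattice_change)
  qed
  then show ?thesis unfolding equal_up_to_rotation_def using rot QA by metis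
qed

text \<open>
  In a reduced basis the weights of \<open>L\<close> are nonnegative with \<open>AB + BC + CA = 1\<close>. Equal weights together with
  the area of a cell determine the Gram matrix of the basis.
\<close>

theorem theta_A2_minimal:
  assumes L: "bravais_lattice L" and vol: "lattice_volume L = lattice_volume A2" and \<alpha>: "\<alpha> > 0"
  shows "theta A2 \<alpha> \<le> theta L \<alpha>" and "theta A2 \<alpha> = theta L \<alpha> \<longleftrightarrow> equal_up_to_rotation L A2"
proof -
  obtain x0 y0 where xy0: "cross2 x0 y0 \<noteq> 0" "L = plane_lattice x0 y0" using bravais_lattice_planeE[OF L] .
  obtain x y where xy: "plane_lattice x y = plane_lattice x0 y0" "\<bar>cross2 x y\<bar> = \<bar>cross2 x0 y0\<bar>"
    "x \<bullet> y \<le> 0" "0 \<le> x \<bullet> x + x \<bullet> y" "0 \<le> y \<bullet> y + x \<bullet> y"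
    using plane_lattice_reduced_basis[OF xy0(1)] .
  define D where "D = sqrt 3 / 2"
  have D: "D > 0" "D\<^sup>2 = 3 / 4" by (simp_all add: D_def power_divide)
  have cD: "\<bar>cross2 x y\<bar> = D"
    using vol lattice_volume_plane_lattice[OF xy0(1)] xy(2) unfolding xy0(2) lattice_volume_A2 D_def by simp
  have ne: "cross2 x y \<noteq> 0" using cD D by auto
  define A B C where "A = (x \<bullet> x + x \<bullet> y) / D" and "B = (y \<bullet> y + x \<bullet> y) / D" and "C = - (x \<bullet> y) / D"
  have nn: "A \<ge> 0" "B \<ge> 0" "C \<ge> 0"
    unfolding A_def B_def C_def using xy D by (intro divide_nonneg_pos; simp)+
  have D2: "D\<^sup>2 = (x \<bullet> x) * (y \<bullet> y) - (x \<bullet> y)\<^sup>2" using cross2_sq[of x y] cD by (metis power2_abs)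
  have det: "A * B + B * C + C * A = 1"
  proof -
    have "(A * B + B * C + C * A) * D\<^sup>2 = (A * D) * (B * D) + (B * D) * (C * D) + (C * D) * (A * D)"
      by (simp add: power2_eq_square algebra_simps)
    also have "A * D = x \<bullet> x + x \<bullet> y" using D by (simp add: A_def)
    also have "B * D = y \<bullet> y + x \<bullet> y" using D by (simp add: B_def)
    also have "C * D = - (x \<bullet> y)" using D by (simp add: C_def)
    also have "(x \<bullet> x + x \<bullet> y) * (y \<bullet> y + x \<bullet> y) + (y \<bullet> y + x \<bullet> y) * - (x \<bullet> y) + - (x \<bullet> y) * (x \<bullet> x + x \<bullet> y) = D\<^sup>2"
      unfolding D2 by (simp add: power2_eq_square algebra_simps)
    finally show ?thesis using D by simp
  qed
  have thL: "theta L \<alpha> = weight_theta A B C (\<alpha> * D)"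
    using theta_plane_lattice[OF ne \<alpha>] unfolding cD xy(1) xy0(2)[symmetric] A_def B_def C_def .
  have thA: "theta A2 \<alpha> = weight_theta hex_weight hex_weight hex_weight (\<alpha> * D)"
    unfolding D_def by (rule theta_A2[OF \<alpha>])
  have \<alpha>D: "\<alpha> * D > 0" using \<alpha> D by simp
  show le: "theta A2 \<alpha> \<le> theta L \<alpha>" and "theta A2 \<alpha> = theta L \<alpha> \<longleftrightarrow> equal_up_to_rotation L A2"
  proof -
    have strict: "theta A2 \<alpha> < theta L \<alpha>" if "\<not> (A = B \<and> B = C)"
      unfolding thL thA by (rule weight_theta_hex_minimal[OF nn det \<alpha>D that])
    have eq: "equal_up_to_rotation L A2" if "A = B" "B = C"
    proof -
      have AB: "A * D = B * D" "B * D = C * D" using that by simp_all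
      then have e: "x \<bullet> x = y \<bullet> y" "y \<bullet> y = - 2 * (x \<bullet> y)" using D by (simp_all add: A_def B_def C_def)
      have "3 / 4 = 3 * (x \<bullet> y)\<^sup>2" using D2 unfolding D(2) e(1) unfolding e(2) by (simp add: power2_eq_square)
      then have "(x \<bullet> y)\<^sup>2 = (1 / 2)\<^sup>2" by (simp add: power2_eq_square)
      then have "x \<bullet> y = - (1 / 2)" using xy(3) by (auto simp: power2_eq_iff)
      then have "equal_up_to_rotation (plane_lattice x y) A2" using e by (intro hex_basis_imp_rotation) auto
      then show ?thesis unfolding xy(1) xy0(2) .
    qed
    show "theta A2 \<alpha> \<le> theta L \<alpha>"
      using strict eq equal_up_to_rotation_imp_theta_eq[of L A2 \<alpha>] by (cases "A = B \<and> B = C") auto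
    show "theta A2 \<alpha> = theta L \<alpha> \<longleftrightarrow> equal_up_to_rotation L A2"
      using strict eq equal_up_to_rotation_imp_theta_eq[of L A2 \<alpha>] by (cases "A = B \<and> B = C") auto
  qed
qed


section \<open>Maximality of the untranslated sum and minimality of the triangular lattice\<close>

theorem proposition1p2:
  "(\<forall>(\<alpha>::real) (L::(real^'n) set) (u::real^'n).
      \<alpha> > 0 \<longrightarrow> bravais_lattice L \<longrightarrow> lattice_density L = 1 \<longrightarrow>
        theta_translate L u \<alpha> \<le> theta L \<alpha> \<and>
        (theta_translate L u \<alpha> = theta L \<alpha> \<longleftrightarrow> u \<in> L)) \<and>
   (\<forall>(L::(real^2) set) (\<alpha>::real) (u::real^2).
      bravais_lattice L \<longrightarrow> lattice_volume L = lattice_volume A2 \<longrightarrow> \<alpha> > 0 \<longrightarrow>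
        theta_translate A2 u \<alpha> \<le> theta L \<alpha> \<and>
        (theta_translate A2 u \<alpha> = theta L \<alpha> \<longleftrightarrow> u \<in> A2 \<and> equal_up_to_rotation L A2))"
proof (intro conjI allI impI)
  fix \<alpha> :: real and L :: "(real^'n) set" and u :: "real^'n"
  assume "\<alpha> > 0" "bravais_lattice L"
  then show "theta_translate L u \<alpha> \<le> theta L \<alpha>" and "theta_translate L u \<alpha> = theta L \<alpha> \<longleftrightarrow> u \<in> L"
    by (rule theta_translate_le[rotated], rule theta_translate_eq_iff[rotated])
next
  fix L :: "(real^2) set" and \<alpha> :: real and u :: "real^2"
  assume L: "bravais_lattice L" "lattice_volume L = lattice_volume A2" and \<alpha>: "\<alpha> > 0"
  note 1 = theta_translate_le[OF bravais_lattice_A2 \<alpha>, of u] theta_A2_minimal(1)[OF L \<alpha>]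
  then show "theta_translate A2 u \<alpha> \<le> theta L \<alpha>" by linarith
  have "theta_translate A2 u \<alpha> = theta L \<alpha> \<longleftrightarrow> theta_translate A2 u \<alpha> = theta A2 \<alpha> \<and> theta A2 \<alpha> = theta L \<alpha>"
    using 1 by linarith
  then show "theta_translate A2 u \<alpha> = theta L \<alpha> \<longleftrightarrow> u \<in> A2 \<and> equal_up_to_rotation L A2"
    unfolding theta_translate_eq_iff[OF bravais_lattice_A2 \<alpha>] theta_A2_minimal(2)[OF L \<alpha>] .
qed

end
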